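(* There exist discrete Beurling prime systems $\mathcal{P}_1$ and $\mathcal{P}_2$ such that \[ \pi_{\mathcal{P}_1}(x)=\operatorname{Li}(x)+O(1)\quad\text{and}\quad \Pi_{\mathcal{P}_2}(x)=\operatorname{Li}(x)+O(\log\log x), \] and such that, for $j=1,2$, the generalized integer counting function $N_{\mathcal{P}_j}$ has a positive asymptotic density $\rho_j>0$ (i.e. $N_{\mathcal{P}_j}(x)\sim\rho_j x$) and, for every $c>2\sqrt{2}$, \[ N_{\mathcal{P}_j}(x)=\rho_j x+\Omega_{\pm}\bigl(x\exp(-c\sqrt{\log x\log\log x})\bigr). \]
   Context: A Beurling prime system is an unbounded non-decreasing sequence of reals $\mathcal{P}=\{p_j\}$ with $p_1>1$; $\pi_{\mathcal{P}}(x)$ counts the $p_j\le x$ with multiplicity, and $\Pi_{\mathcal{P}}(x)=\sum_{\nu\ge1}\pi_{\mathcal{P}}(x^{1/\nu})/\nu$. The generalized integers are the multiset of all finite products of the $p_j$ (including $1$), and $N_{\mathcal{P}}(x)$ counts those $\le x$ with multiplicity. $\operatorname{Li}(x)=\int_1^x\frac{1-u^{-1}}{\log u}\,\mathrm{d}u$. $g(x)=\Omega_{\pm}(h(x))$ (with $h>0$) means $\limsup_{x\to\infty} g(x)/h(x)>0$ and $\liminf_{x\to\infty} g(x)/h(x)<0$. *)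

theory Defs
  imports "HOL-Analysis.Analysis" "HOL-Library.Multiset" "HOL-Library.Landau_Symbols"
    "HOL-Library.Liminf_Limsup"
begin

definition beurling_primes :: "(nat \<Rightarrow> real) \<Rightarrow> bool" where
  "beurling_primes p \<longleftrightarrow> mono p \<and> p 0 > 1 \<and> \<not> bdd_above (range p)"

definition bpi :: "(nat \<Rightarrow> real) \<Rightarrow> real \<Rightarrow> real" where
  "bpi p x = real (card {j. p j \<le> x})"

definition bPi :: "(nat \<Rightarrow> real) \<Rightarrow> real \<Rightarrow> real" where
  "bPi p x = (\<Sum>n. bpi p (x powr (1 / real (Suc n))) / real (Suc n))"

text \<open>Generalized integers counted with multiplicity: a generalized integer is a
  finite multiset of prime indices; its value is the product of the primes.\<close>
definition bN :: "(nat \<Rightarrow> real) \<Rightarrow> real \<Rightarrow> real" where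
  "bN p x = real (card {M :: nat multiset. (\<Prod>j\<in>#M. p j) \<le> x})"

definition Li :: "real \<Rightarrow> real" where
  "Li x = integral {1..x} (\<lambda>u. (1 - 1 / u) / ln u)"

definition Omega_pm :: "(real \<Rightarrow> real) \<Rightarrow> (real \<Rightarrow> real) \<Rightarrow> bool" where
  "Omega_pm g h \<longleftrightarrow>
     Limsup at_top (\<lambda>x. ereal (g x / h x)) > 0 \<and> Liminf at_top (\<lambda>x. ereal (g x / h x)) < 0"

end

theory Submission
  imports Defs "HOL-Complex_Analysis.Complex_Analysis" "HOL-Real_Asymp.Real_Asymp"
    "HOL-Probability.Sinc_Integral"
begin

text \<open>
  On the logarithmic scale $v = \log x$ the function $\mathrm{Li}$ has the density
  $w(v) = (e^v - 1)/v$. Moving each prime freely inside its own cell of unit mass of a density $f$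
  close to $w$ changes the prime counting function by $O(1)$ only, and $\zeta(s) = Z(s)\,s/(s-1)$
  with $Z$ holomorphic and zero-free to the left of the line $\Re s = 1$. The freedom is used to make
  $p^{i\tau} = 1$ for all primes $p$ between $\tau^{1/2}$ and about $\tau \log \tau$, for a sparse
  sequence of $\tau$. Then $|\zeta(1 - \delta + i\tau)|$ is as large as the trivial bound allows:
  its logarithm is about $\tau^\delta / (\delta \log \tau)$, and $\delta$ is chosen such that
  $\tau^\delta = \log \tau$.

  Let $a(L) = N(e^L) e^{-L}$ and $F(s) = \zeta(s)/s - \rho/(s-1)$, the Laplace transform of
  $a - \rho$. Its Taylor coefficients at $2 + i\tau$ are integrals of $a - \rho$ against
  $L^n e^{-L}/n!$ times an oscillating factor, and $L^n e^{-L} / n!$ is concentrated near $L = n$.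
  If $a - \rho$ were bounded from one side by $\exp(-2\sqrt 2\sqrt{L \log L})$, then, as in Landau's
  oscillation theorem, these coefficients would be dominated by the tiny ones at the real point $2$
  and by the one-sided bound. Together with Cauchy's estimates for the very small and the very large
  indices this makes $F(1 - \delta + i\tau)$ too small. For $\mathrm{Li}$ itself one takes $f = w$;
  for $\Pi = \mathrm{Li} + O(\log\log x)$ the density $f$ of Riemann's function
  $\sum_\nu \frac{\mu(\nu)}{\nu} \mathrm{Li}(x^{1/\nu})$, given by the Gram series.
\<close>

section \<open>The weight $(e^v - 1)/v$ and its Laplace transform\<close>

text \<open>The range of resonant primes comes from a balance. Near \<open>exp V\<close> a cell has
  length about \<open>V / exp V\<close>, and it is sure to contain a point of the resonant lattice
  only while this exceeds the spacing \<open>2 * pi / \<tau>\<close>, hence up to primes of size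
  about \<open>\<tau> * ln \<tau>\<close>. Beyond this size nothing is known about the phases, but
  replacing primes by their density then costs about
  \<open>\<tau> * exp (- (1 - \<delta>) * V)\<close>, which is bounded there precisely because
  \<tau> to the power \<delta> is \<open>ln \<tau>\<close>. So the constructed range and the range
  of trivial estimates meet without loss. The shape of the oscillation term has the same origin. Put
  \<open>t = ln \<tau>\<close>, so that \<open>\<delta> = ln t / t\<close>. The Taylor terms that
  decide the size of \<open>F\<close> have index \<open>n\<close> of order
  \<open>t^2 / ln t\<close>. For such \<open>n\<close> both \<open>n * \<delta>\<close> and
  \<open>sqrt (n * ln n)\<close> are of order \<open>t\<close>, as is the logarithm of the factor
  \<open>1 / \<tau>\<close> by which \<open>F\<close> is smaller than \<open>zeta\<close>. The much
  smaller order \<open>t / ln t\<close> of \<open>ln (norm (zeta s))\<close> only serves to cut off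
  the indices outside a window of this order.\<close>

definition wgt :: "real \<Rightarrow> real" where
  "wgt v = (if v = 0 then 1 else (exp v - 1) / v)"

text \<open>Averaging \<open>exp (u * v)\<close> over \<open>u\<close> removes the case distinction
  at 0: continuity, monotonicity and positivity of \<open>wgt\<close> are read off under the
  integral, and its Laplace transform becomes an average of \<open>1 / (s - u)\<close>.\<close>

lemma wgt_eq_integral: "wgt v = integral {0..1} (\<lambda>u. exp (u * v))"
proof (cases "v = 0")
  case False
  have "((\<lambda>u. exp (u * v)) has_integral exp (1 * v) / v - exp (0 * v) / v) {0..1}"
    using False by (intro fundamental_theorem_of_calculus)
      (auto intro!: derivative_eq_intros simp flip: has_real_derivative_iff_has_vector_derivative)
  then show ?thesis using False by (simp add: wgt_def integral_unique diff_divide_distrib)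
qed (simp add: wgt_def)

lemma continuous_on_wgt [continuous_intros]:
  assumes "continuous_on A g" shows "continuous_on A (\<lambda>x. wgt (g x))"
proof -
  have c: "continuous_on UNIV (\<lambda>v. integral (cbox 0 1) (\<lambda>u. exp (u * v)) :: real)"
    by (rule integral_continuous_on_param) (auto intro!: continuous_intros simp: case_prod_unfold)
  show ?thesis
    using continuous_on_compose2[OF c assms] by (simp add: wgt_eq_integral)
qed

lemma exp_scale_integrable: "(\<lambda>u. exp (u * v :: real)) integrable_on {a..b}"
  by (intro integrable_continuous_interval continuous_intros)

lemma wgt_mono: "a \<le> b \<Longrightarrow> wgt a \<le> wgt b"
  unfolding wgt_eq_integral
  by (intro integral_le exp_scale_integrable) (auto intro: mult_left_mono)

lemma wgt_ge_1: "0 \<le> v \<Longrightarrow> 1 \<le> wgt v"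
  using wgt_mono[of 0 v] by (simp add: wgt_def)

lemma wgt_nonneg [simp]: "0 \<le> wgt v"
  unfolding wgt_eq_integral by (intro integral_nonneg exp_scale_integrable) auto

lemma wgt_le_exp: assumes "0 \<le> v" shows "wgt v \<le> exp v"
proof -
  have "wgt v \<le> integral {0..1} (\<lambda>u::real. exp v)"
    unfolding wgt_eq_integral
    by (intro integral_le exp_scale_integrable) (use assms in \<open>auto simp: mult_left_le_one_le\<close>)
  then show ?thesis by simp
qed

lemma times_wgt: "v * wgt v = exp v - 1"
  by (simp add: wgt_def)

lemma wgt_le_divide: "0 < v \<Longrightarrow> wgt v \<le> exp v / v"
  by (simp add: wgt_def divide_right_mono)

lemma Li_exp:
  assumes "0 \<le> v" shows "Li (exp v) = integral {0..v} wgt"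
proof -
  define g where "g = (\<lambda>u::real. wgt (ln u) / u)"
  have g: "continuous_on {1..exp v} g"
    unfolding g_def by (intro continuous_intros) auto
  have "((\<lambda>x. exp x *\<^sub>R g (exp x)) has_integral (integral {exp 0..exp v} g)) {0..v}"
    using assms g
    by (intro has_integral_substitution[where a=0 and b=v and g=exp and c=1 and d="exp v"])
       (auto intro!: derivative_eq_intros)
  then have "(wgt has_integral (integral {1..exp v} g)) {0..v}"
    by (simp add: g_def)
  moreover have "integral {1..exp v} g = Li (exp v)"
    unfolding Li_def
    \<comment> \<open>At \<open>u = 1\<close> the integrand of \<open>Li\<close> is
      \<open>0 / 0 = 0\<close>, whereas \<open>g 1 = wgt 0 = 1\<close>; the two functions differ
      only there.\<close>
    by (rule integral_spike[of "{1}"]) (auto simp: g_def wgt_def field_simps)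
  ultimately show ?thesis by (simp add: integral_unique)
qed

lemma Ln_minus_derivative:
  assumes "Im s \<noteq> 0 \<or> Re s > 1" "0 \<le> u" "u \<le> (1::real)"
  shows "s - of_real u \<notin> \<real>\<^sub>\<le>\<^sub>0"
  using assms by (auto simp: complex_nonpos_Reals_iff)

text \<open>Exchange the integrals over \<open>u\<close> and \<open>v\<close>: the inner one is
  elementary, and \<open>1 / (s - u)\<close> has the primitive \<open>- Ln (s - u)\<close>, the
  hypothesis on \<open>s\<close> keeping \<open>s - u\<close> off the branch cut. Since
  \<open>V\<close> is finite the formula also holds to the left of the line Re s = 1.\<close>

lemma laplace_wgt:
  fixes s :: complex
  assumes s: "Im s \<noteq> 0 \<or> Re s > 1" and V: "0 \<le> V"
  shows "integral {0..V} (\<lambda>v. exp (- s * of_real v) * of_real (wgt v)) =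
    Ln s - Ln (s - 1) - integral {0..1} (\<lambda>u. exp (- (s - of_real u) * of_real V) / (s - of_real u))"
proof -
  have nz: "s - of_real u \<noteq> 0" if "u \<in> {0..1}" for u :: real
    using Ln_minus_derivative[OF s, of u] that by auto
  have inner: "integral {0..1} (\<lambda>u. exp (- (s - of_real u) * of_real v)) =
      exp (- s * of_real v) * of_real (wgt v)" for v :: real
  proof -
    have "((\<lambda>u. of_real (exp (u * v)) :: complex) has_integral of_real (wgt v)) {0..1}"
      unfolding wgt_eq_integral
      using integrable_integral[OF exp_scale_integrable[of v 0 1]] has_integral_of_real by blast
    then have "((\<lambda>u. exp (- s * of_real v) * of_real (exp (u * v)) :: complex) has_integral
        exp (- s * of_real v) * of_real (wgt v)) {0..1}"
      by (rule has_integral_mult_right)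
    then have "((\<lambda>u. exp (- (s - of_real u) * of_real v)) has_integral
        exp (- s * of_real v) * of_real (wgt v)) {0..1}"
      by (rule has_integral_eq[rotated]) (simp add: exp_of_real[symmetric] exp_add[symmetric] algebra_simps)
    then show ?thesis by (rule integral_unique)
  qed
  have outer: "integral {0..V} (\<lambda>v. exp (- (s - of_real u) * of_real v)) =
      (1 - exp (- (s - of_real u) * of_real V)) / (s - of_real u)" if u: "u \<in> {0..1}" for u :: real
  proof -
    define z where "z = s - of_real u"
    have "z \<noteq> 0" using nz[OF u] by (simp add: z_def)
    have "((\<lambda>v. exp (- z * of_real v)) has_integral
        (- exp (- z * of_real V) / z) - (- exp (- z * of_real 0) / z)) {0..V}"
      using V \<open>z \<noteq> 0\<close>
      by (intro fundamental_theorem_of_calculus) (auto intro!: derivative_eq_intros 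
          has_vector_derivative_real_field)
    then show ?thesis unfolding z_def by (simp add: integral_unique diff_divide_distrib)
  qed
  have ln: "((\<lambda>u. 1 / (s - of_real u)) has_integral (- Ln (s - of_real 1)) - (- Ln (s - of_real 0))) {0..1}"
    using Ln_minus_derivative[OF s]
    by (intro fundamental_theorem_of_calculus) (auto intro!: derivative_eq_intros 
          has_vector_derivative_real_field simp: divide_simps nz)
  have i2: "(\<lambda>u. exp (- (s - of_real u) * of_real V) / (s - of_real u)) integrable_on {0..1}"
    using nz by (intro integrable_continuous_interval continuous_intros) auto
  have "integral {0..V} (\<lambda>v. exp (- s * of_real v) * of_real (wgt v)) =
      integral {0..V} (\<lambda>v. integral {0..1} (\<lambda>u. exp (- (s - of_real u) * of_real v)))"
    by (simp only: inner)
  also have "\<dots> = integral {0..1} (\<lambda>u. integral {0..V} (\<lambda>v. exp (- (s - of_real u) * of_real v)))"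
  proof -
    have "continuous_on (cbox (0, 0) (V, 1)) (\<lambda>(v, u). exp (- (s - of_real u) * of_real v))"
      by (auto intro!: continuous_intros simp: case_prod_unfold)
    from integral_swap_continuous[OF this] show ?thesis by simp
  qed
  also have "\<dots> = integral {0..1} (\<lambda>u. 1 / (s - of_real u) - exp (- (s - of_real u) * of_real V) / (s - of_real u))"
    by (rule integral_cong) (simp only: outer diff_divide_distrib)
  also have "\<dots> = integral {0..1} (\<lambda>u. 1 / (s - of_real u)) -
      integral {0..1} (\<lambda>u. exp (- (s - of_real u) * of_real V) / (s - of_real u))"
    using ln i2 by (intro Henstock_Kurzweil_Integration.integral_diff) auto
  also have "integral {0..1} (\<lambda>u. 1 / (s - of_real u)) = Ln s - Ln (s - 1)"
    using integral_unique[OF ln] by simp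
  finally show ?thesis .
qed

text \<open>There are two ways to stay at distance \<open>b\<close> from the segment from 0 to 1: by
  height, as needed for growth estimates left of the line Re s = 1, or to the right of 1, as needed
  for the limit of the Euler product.\<close>

lemma norm_laplace_remainder:
  fixes s :: complex
  assumes V: "0 \<le> V" and b: "0 < b" and s: "b \<le> \<bar>Im s\<bar> \<or> b \<le> Re s - 1"
  shows "norm (integral {0..1} (\<lambda>u. exp (- (s - of_real u) * of_real V) / (s - of_real u))) \<le>
    exp ((1 - Re s) * V) / b"
proof -
  have s': "Im s \<noteq> 0 \<or> Re s > 1" using s b by auto
  have nz: "s - of_real u \<noteq> 0" if "u \<in> {0..1}" for u :: real
    using Ln_minus_derivative[OF s', of u] that by auto
  have "norm (integral {0..1} (\<lambda>u. exp (- (s - of_real u) * of_real V) / (s - of_real u))) \<le>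
      integral {0..1} (\<lambda>u::real. exp ((1 - Re s) * V) / b)"
  proof (rule integral_norm_bound_integral)
    show "(\<lambda>u. exp (- (s - of_real u) * of_real V) / (s - of_real u)) integrable_on {0..1}"
      using nz by (intro integrable_continuous_interval continuous_intros) auto
    fix u :: real assume u: "u \<in> {0..1}"
    have 1: "b \<le> norm (s - of_real u)"
      using s
    proof
      assume "b \<le> \<bar>Im s\<bar>" then show ?thesis using abs_Im_le_cmod[of "s - of_real u"] by simp
    next
      assume "b \<le> Re s - 1" then show ?thesis using complex_Re_le_cmod[of "s - of_real u"] u by simp
    qed
    have 2: "u * V - Re s * V \<le> (1 - Re s) * V"
      using mult_right_mono[of u 1 V] u V by (simp add: algebra_simps)
    show "norm (exp (- (s - of_real u) * of_real V) / (s - of_real u)) \<le> exp ((1 - Re s) * V) / b"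
      unfolding norm_divide using 1 2 b by (intro frac_le) (auto simp: algebra_simps)
  qed auto
  then show ?thesis by simp
qed

section \<open>Discretized densities\<close>

text \<open>\<open>lam\<close> lists the quantiles of the density \<open>f\<close>, and \<open>l j\<close> is the logarithm of the \<open>j\<close>-th prime.\<close>

locale beurling_sample =
  fixes f :: "real \<Rightarrow> real" and C0 :: real and lam l :: "nat \<Rightarrow> real"
  assumes f_cont: "continuous_on {0..} f"
    and f_ge: "\<And>v. 0 \<le> v \<Longrightarrow> 1/2 \<le> f v"
    and f_le: "\<And>v. 0 \<le> v \<Longrightarrow> f v \<le> wgt v"
    and f_close: "\<And>v. 0 \<le> v \<Longrightarrow> wgt v - f v \<le> C0 * exp (v / 2)"
    and lam_0: "lam 0 = 0"
    and lam_Suc: "\<And>j. lam j < lam (Suc j)"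
    and integral_f_step: "\<And>j. integral {lam j..lam (Suc j)} f = 1"
    and l_gt: "\<And>j. lam j < l j" and l_le: "\<And>j. l j \<le> lam (Suc j)"
begin

lemma C0_nonneg: "0 \<le> C0"
  using f_le[of 0] f_close[of 0] by simp

lemma lam_strict_mono: "strict_mono lam"
  by (simp add: strict_mono_Suc_iff lam_Suc)

lemma lam_mono: "i \<le> j \<Longrightarrow> lam i \<le> lam j"
  using lam_strict_mono by (simp add: strict_mono_less_eq)

lemma lam_nonneg [simp]: "0 \<le> lam j"
  using lam_mono[of 0 j] by (simp add: lam_0)

lemma nonneg_of_lam_le: "lam j \<le> v \<Longrightarrow> 0 \<le> v"
  using lam_nonneg order_trans by blast

lemma f_nonneg: "0 \<le> v \<Longrightarrow> 0 \<le> f v"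
  using f_ge[of v] by simp

lemma l_pos [simp]: "0 < l j"
  using l_gt[of j] lam_nonneg[of j] by linarith

lemma l_mono: "i \<le> j \<Longrightarrow> l i \<le> l j"
proof (cases "i = j")
  case False
  assume "i \<le> j"
  with False have "lam (Suc i) \<le> lam j" by (intro lam_mono) auto
  then show ?thesis using l_le[of i] l_gt[of j] by linarith
qed simp

lemma cont_f: "0 \<le> a \<Longrightarrow> continuous_on {a..b} f"
  using f_cont by (rule continuous_on_subset) auto

lemma integrable_mult_f:
  fixes h :: "real \<Rightarrow> 'a::{euclidean_space,real_normed_algebra_1}"
  assumes "0 \<le> a" "continuous_on {a..b} h"
  shows "(\<lambda>v. h v * of_real (f v)) integrable_on {a..b}"
  using assms cont_f by (intro integrable_continuous_interval continuous_intros) auto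

lemma f_integrable: "0 \<le> a \<Longrightarrow> f integrable_on {a..b}"
  by (intro integrable_continuous_interval cont_f)

lemma lam_diff_le: "lam (Suc j) - lam j \<le> 2"
proof -
  have "integral {lam j..lam (Suc j)} (\<lambda>_. 1/2 :: real) \<le> integral {lam j..lam (Suc j)} f"
    by (intro integral_le f_integrable) (auto dest!: nonneg_of_lam_le f_ge)
  then show ?thesis using lam_Suc[of j] by (simp add: integral_f_step)
qed

lemma integral_f_lam: "integral {0..lam m} f = real m"
proof (induction m)
  case (Suc m)
  have "integral {0..lam m} f + integral {lam m..lam (Suc m)} f = integral {0..lam (Suc m)} f"
    using lam_Suc[of m] by (intro Henstock_Kurzweil_Integration.integral_combine f_integrable) auto
  then show ?case using Suc by (simp add: integral_f_step)
qed (simp add: lam_0)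

lemma lam_at_top: "filterlim lam at_top sequentially"
proof (rule ccontr)
  assume "\<not> ?thesis"
  then have "\<not> (\<forall>B. \<exists>m. B \<le> lam m)"
    using filterlim_at_top_mono[of ] unfolding filterlim_at_top eventually_sequentially
    by (meson lam_mono order_trans)
  then obtain B where B: "\<And>m. lam m < B" by (auto simp: not_le)
  have "real m \<le> integral {0..B} f" for m
  proof -
    have "integral {0..lam m} f \<le> integral {0..B} f"
      using B[of m] by (intro integral_subset_le f_integrable) (auto intro: f_nonneg)
    then show ?thesis by (simp add: integral_f_lam)
  qed
  then show False using reals_Archimedean2 not_le by metis
qed

lemma l_at_top: "filterlim l at_top sequentially"
  by (rule filterlim_at_top_mono[OF lam_at_top]) (auto intro!: always_eventually less_imp_le l_gt)

text \<open>\<open>f\<close> has mass 1 on the cell, so the integral is an average of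
  \<open>h\<close>.\<close>

lemma step_integral_le:
  assumes "continuous_on {lam j..lam (Suc j)} h" "\<And>v. lam j \<le> v \<Longrightarrow> v \<le> lam (Suc j) \<Longrightarrow> h v \<le> c"
  shows "integral {lam j..lam (Suc j)} (\<lambda>v. h v * f v) \<le> (c::real)"
proof -
  have "integral {lam j..lam (Suc j)} (\<lambda>v. h v * f v) \<le> integral {lam j..lam (Suc j)} (\<lambda>v. c * f v)"
    using assms integrable_mult_f[of "lam j" "lam (Suc j)" h] f_integrable[of "lam j" "lam (Suc j)"]
    by (intro integral_le integrable_on_mult_right)
       (auto intro!: mult_right_mono f_nonneg dest: nonneg_of_lam_le)
  then show ?thesis by (simp add: integral_f_step)
qed

lemma step_integral_ge:
  assumes "continuous_on {lam j..lam (Suc j)} h" "\<And>v. lam j \<le> v \<Longrightarrow> v \<le> lam (Suc j) \<Longrightarrow> c \<le> h v"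
  shows "(c::real) \<le> integral {lam j..lam (Suc j)} (\<lambda>v. h v * f v)"
proof -
  have "integral {lam j..lam (Suc j)} (\<lambda>v. c * f v) \<le> integral {lam j..lam (Suc j)} (\<lambda>v. h v * f v)"
    using assms integrable_mult_f[of "lam j" "lam (Suc j)" h] f_integrable[of "lam j" "lam (Suc j)"]
    by (intro integral_le integrable_on_mult_right)
       (auto intro!: mult_right_mono f_nonneg dest: nonneg_of_lam_le)
  then show ?thesis by (simp add: integral_f_step)
qed

lemma integral_mult_f_lam:
  fixes h :: "real \<Rightarrow> real"
  assumes "continuous_on {0..} h"
  shows "integral {0..lam m} (\<lambda>v. h v * f v) = (\<Sum>j<m. integral {lam j..lam (Suc j)} (\<lambda>v. h v * f v))"
proof (induction m)
  case (Suc m)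
  have "continuous_on {0..lam (Suc m)} h" using assms by (rule continuous_on_subset) auto
  then have "integral {0..lam m} (\<lambda>v. h v * f v) + integral {lam m..lam (Suc m)} (\<lambda>v. h v * f v) =
      integral {0..lam (Suc m)} (\<lambda>v. h v * f v)"
    using lam_Suc[of m] integrable_mult_f[of 0 "lam (Suc m)" h]
    by (intro Henstock_Kurzweil_Integration.integral_combine) auto
  then show ?case using Suc by simp
qed (simp add: lam_0)

text \<open>A decreasing weight at the left end of a cell is at most its average over the preceding
  cell. The shift by one index costs only the term \<open>j = 0\<close>, which is at most 1.\<close>

lemma sum_exp_l_le:
  assumes "0 \<le> \<sigma>"
  shows "(\<Sum>j<m. exp (- \<sigma> * l j)) \<le> 1 + integral {0..lam m} (\<lambda>v. exp (- \<sigma> * v) * f v)"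
proof (cases m)
  case (Suc n)
  have "(\<Sum>j<m. exp (- \<sigma> * l j)) \<le> (\<Sum>j<Suc n. exp (- \<sigma> * lam j))"
    using assms less_imp_le[OF l_gt] unfolding Suc by (intro sum_mono) (auto intro!: mult_left_mono)
  also have "\<dots> = 1 + (\<Sum>j<n. exp (- \<sigma> * lam (Suc j)))"
    unfolding sum.lessThan_Suc_shift by (simp add: lam_0)
  also have "(\<Sum>j<n. exp (- \<sigma> * lam (Suc j))) \<le> (\<Sum>j<n. integral {lam j..lam (Suc j)} (\<lambda>v. exp (- \<sigma> * v) * f v))"
    using assms by (intro sum_mono step_integral_ge continuous_intros) (auto intro!: mult_left_mono)
  also have "\<dots> \<le> (\<Sum>j<m. integral {lam j..lam (Suc j)} (\<lambda>v. exp (- \<sigma> * v) * f v))"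
    unfolding Suc sum.lessThan_Suc
    by (simp del: mult_minus_left, intro step_integral_ge continuous_intros) auto
  also have "\<dots> = integral {0..lam m} (\<lambda>v. exp (- \<sigma> * v) * f v)"
    by (rule integral_mult_f_lam[symmetric]) (intro continuous_intros)
  finally show ?thesis by simp
qed (simp add: lam_0)

lemma sum_exp_l_ge:
  assumes "0 \<le> \<sigma>"
  shows "integral {0..lam m} (\<lambda>v. exp (- \<sigma> * v) * f v) - 1 \<le> (\<Sum>j<m. exp (- \<sigma> * l j))"
proof -
  have "integral {0..lam m} (\<lambda>v. exp (- \<sigma> * v) * f v) =
      (\<Sum>j<m. integral {lam j..lam (Suc j)} (\<lambda>v. exp (- \<sigma> * v) * f v))"
    by (rule integral_mult_f_lam) (intro continuous_intros)
  also have "\<dots> \<le> (\<Sum>j<m. exp (- \<sigma> * lam j))"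
    using assms by (intro sum_mono step_integral_le continuous_intros) (auto intro!: mult_left_mono)
  also have "\<dots> \<le> (\<Sum>j<Suc m. exp (- \<sigma> * lam j))" by simp
  also have "\<dots> = 1 + (\<Sum>j<m. exp (- \<sigma> * lam (Suc j)))"
    unfolding sum.lessThan_Suc_shift by (simp add: lam_0)
  also have "\<dots> \<le> 1 + (\<Sum>j<m. exp (- \<sigma> * l j))"
    using assms l_le by (intro add_left_mono sum_mono) (auto intro!: mult_left_mono)
  finally show ?thesis by simp
qed

text \<open>Closed form of the integral of \<open>exp (- \<sigma> * v)\<close> over cell
  \<open>j\<close>. Times \<open>norm s\<close> it bounds the variation of
  \<open>exp (- s * v)\<close> on the cell, and it telescopes over \<open>j\<close>.\<close>

definition E :: "real \<Rightarrow> nat \<Rightarrow> real" where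
  "E \<sigma> j = (exp (- \<sigma> * lam j) - exp (- \<sigma> * lam (Suc j))) / \<sigma>"

lemma has_integral_exp_E:
  assumes "\<sigma> > 0"
  shows "((\<lambda>v. exp (- \<sigma> * v)) has_integral E \<sigma> j) {lam j..lam (Suc j)}"
proof -
  have "((\<lambda>v. exp (- \<sigma> * v)) has_integral
      (- exp (- \<sigma> * lam (Suc j)) / \<sigma>) - (- exp (- \<sigma> * lam j) / \<sigma>)) {lam j..lam (Suc j)}"
    using assms lam_Suc[of j]
    by (intro fundamental_theorem_of_calculus)
      (auto intro!: derivative_eq_intros simp flip: has_real_derivative_iff_has_vector_derivative)
  then show ?thesis by (simp add: E_def diff_divide_distrib)
qed

lemma E_nonneg: "\<sigma> > 0 \<Longrightarrow> 0 \<le> E \<sigma> j"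
  using has_integral_nonneg[OF has_integral_exp_E] by simp

lemma E_sums:
  assumes "\<sigma> > 0" shows "(\<lambda>j. E \<sigma> (j + J)) sums (exp (- \<sigma> * lam J) / \<sigma>)"
proof -
  have "filterlim (\<lambda>j. lam (j + J)) at_top sequentially"
    using lam_at_top by (rule filterlim_compose) (rule filterlim_add_const_nat_at_top)
  then have "(\<lambda>j. exp (- \<sigma> * lam (j + J)) / \<sigma>) \<longlonglongrightarrow> 0"
    by (rule filterlim_compose[rotated]) (use assms in real_asymp)
  from telescope_sums'[OF this] show ?thesis
    by (simp add: E_def diff_divide_distrib)
qed

text \<open>Logarithm of the \<open>j\<close>-th Euler factor minus its continuous model. The model
  uses \<open>wgt\<close> and not \<open>f\<close>, so that the subtracted integrals add up to the
  logarithm of \<open>s / (s - 1)\<close>.\<close>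

definition R :: "nat \<Rightarrow> complex \<Rightarrow> complex" where
  "R j s = - Ln (1 - exp (- s * of_real (l j))) -
     integral {lam j..lam (Suc j)} (\<lambda>v. exp (- s * of_real v) * of_real (wgt v))"

text \<open>For Re s at least 3/5 every prime gives a \<open>z\<close> of norm at most
  \<open>exp (- (3/5) * l 0) < 1\<close>, so one constant serves for \<open>1 / (1 - norm z)\<close>
  in the remainder of \<open>Ln (1 - z)\<close>.\<close>

definition Ln_const :: real where "Ln_const = 1 / (1 - exp (- (3/5) * l 0))"

lemma Ln_const_pos: "0 < Ln_const"
  by (simp add: Ln_const_def)

lemma norm_exp_l:
  assumes "\<sigma> \<le> Re s" shows "norm (exp (- s * of_real (l j))) \<le> exp (- \<sigma> * l j)"
  using assms l_pos[of j] by (simp add: mult_right_mono)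

lemma exp_l_le: "exp (- (3/5) * l j) \<le> exp (- (3/5) * l 0)" "exp (- (3/5) * l 0) < 1"
  using l_mono[of 0 j] by auto

lemma norm_exp_diff_le:
  fixes s :: complex
  assumes "a \<le> b" "\<sigma> > 0" "\<sigma> \<le> Re s" "0 \<le> a" "lam j \<le> a" "b \<le> lam (Suc j)"
  shows "norm (exp (- s * of_real b) - exp (- s * of_real a)) \<le> norm s * E \<sigma> j"
proof -
  have "((\<lambda>v. - s * exp (- s * of_real v)) has_integral exp (- s * of_real b) - exp (- s * of_real a)) {a..b}"
    using assms by (intro fundamental_theorem_of_calculus)
      (auto intro!: derivative_eq_intros has_vector_derivative_real_field)
  then have "norm (exp (- s * of_real b) - exp (- s * of_real a)) =
      norm (integral {a..b} (\<lambda>v. - s * exp (- s * of_real v)))"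
    by (simp only: integral_unique)
  also have "\<dots> \<le> integral {a..b} (\<lambda>v. norm s * exp (- \<sigma> * v))"
    using assms
    by (intro integral_norm_bound_integral integrable_continuous_interval continuous_intros)
       (auto simp: norm_mult intro!: mult_left_mono mult_right_mono)
  also have "\<dots> = norm s * integral {a..b} (\<lambda>v. exp (- \<sigma> * v))"
    by simp
  also have "integral {a..b} (\<lambda>v. exp (- \<sigma> * v)) \<le> integral {lam j..lam (Suc j)} (\<lambda>v. exp (- \<sigma> * v))"
    using assms by (intro integral_subset_le integrable_continuous_interval continuous_intros) auto
  also have "\<dots> = E \<sigma> j"
    by (rule integral_unique[OF has_integral_exp_E]) (use assms in auto)
  finally show ?thesis by (simp add: mult_left_mono)
qed

lemma norm_Ln_1_minus_le:
  fixes z :: complex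
  assumes "norm z \<le> exp (- (3/5) * l 0)"
  shows "norm (- Ln (1 - z) - z) \<le> Ln_const * (norm z)\<^sup>2"
proof -
  have lt: "norm z < 1" using assms exp_l_le(2) by linarith
  have "norm (Ln (1 + (- z)) - (- z)) \<le> norm (- z) ^ 2 / (1 - norm (- z))"
    by (rule Ln_approx_linear) (use lt in auto)
  then have "norm (- Ln (1 - z) - z) \<le> norm z ^ 2 / (1 - norm z)"
    by (simp add: norm_minus_commute flip: norm_minus_cancel[of "Ln _ + z"])
  also have "\<dots> \<le> norm z ^ 2 / (1 - exp (- (3/5) * l 0))"
    using assms exp_l_le(2) by (intro divide_left_mono) (auto intro!: mult_pos_pos lt)
  finally show ?thesis by (simp add: Ln_const_def)
qed

text \<open>Three errors: concentrating the mass of the cell at one point, replacing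
  \<open>f\<close> by \<open>wgt\<close>, and the higher powers of the prime. The abscissa 3/5
  leaves room above 1/2: \<open>exp (- (3/5) * v) * exp (v / 2)\<close> still decays, and squares of
  primes give the exponent 6/5 > 1. Only the first error grows with \<open>norm s\<close>.\<close>

lemma norm_R_le:
  assumes "3/5 \<le> \<sigma>" "\<sigma> \<le> Re s"
  shows "norm (R j s) \<le> norm s * E \<sigma> j + C0 * E (1/10) j + Ln_const * exp (- (6/5) * l j)"
proof -
  define z where "z = exp (- s * of_real (l j))"
  define I where "I = {lam j..lam (Suc j)}"
  have z: "norm z \<le> exp (- (3/5) * l j)"
    unfolding z_def by (rule norm_exp_l) (use assms in auto)
  \<comment> \<open>Mass 1 allows the main term \<open>z\<close> of the prime to be spread over the
    cell with density \<open>f\<close>, where it can be compared pointwise with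
    \<open>exp (- s * v)\<close>.\<close>
  have int_f: "((\<lambda>v. z * of_real (f v)) has_integral z * of_real 1) I"
  proof (intro has_integral_mult_right has_integral_of_real)
    show "(f has_integral 1) I"
      using f_integrable[of "lam j" "lam (Suc j)"] integral_f_step[of j]
      unfolding I_def by (auto simp: has_integral_iff)
  qed
  have i1: "(\<lambda>v. (z - exp (- s * of_real v)) * of_real (f v)) integrable_on I"
    unfolding I_def by (intro integrable_mult_f continuous_intros) auto
  have i2: "(\<lambda>v. exp (- s * of_real v) * of_real (wgt v)) integrable_on I"
    unfolding I_def by (intro integrable_continuous_interval continuous_intros)
  have i3: "(\<lambda>v. exp (- s * of_real v) * of_real (f v)) integrable_on I"
    unfolding I_def by (intro integrable_mult_f continuous_intros) auto
  have i4: "(\<lambda>v. exp (- s * of_real v) * of_real (wgt v - f v)) integrable_on I"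
    using integrable_diff[OF i2 i3] by (simp add: algebra_simps)
  have "integral I (\<lambda>v. (z - exp (- s * of_real v)) * of_real (f v)) -
      integral I (\<lambda>v. exp (- s * of_real v) * of_real (wgt v - f v)) =
      integral I (\<lambda>v. z * of_real (f v) - exp (- s * of_real v) * of_real (wgt v))"
    unfolding integral_diff[OF i1 i4, symmetric] by (rule integral_cong) (simp add: algebra_simps)
  also have "\<dots> = z - integral I (\<lambda>v. exp (- s * of_real v) * of_real (wgt v))"
    using int_f i2 by (subst integral_diff) (auto simp: has_integral_iff)
  finally have eq: "R j s = (- Ln (1 - z) - z) +
      integral I (\<lambda>v. (z - exp (- s * of_real v)) * of_real (f v)) -
      integral I (\<lambda>v. exp (- s * of_real v) * of_real (wgt v - f v))"
    unfolding R_def z_def I_def by (simp add: algebra_simps)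
  have b1: "norm (- Ln (1 - z) - z) \<le> Ln_const * exp (- (6/5) * l j)"
  proof -
    have "norm (- Ln (1 - z) - z) \<le> Ln_const * (norm z)\<^sup>2"
      by (rule norm_Ln_1_minus_le) (use z exp_l_le(1)[of j] in linarith)
    also have "(norm z)\<^sup>2 \<le> (exp (- (3/5) * l j))\<^sup>2"
      using z by (intro power_mono) auto
    also have "\<dots> = exp (- (6/5) * l j)"
      by (simp add: power2_eq_square flip: exp_add)
    finally show ?thesis using Ln_const_pos by (simp add: mult_left_mono)
  qed
  have b2: "norm (integral I (\<lambda>v. (z - exp (- s * of_real v)) * of_real (f v))) \<le> norm s * E \<sigma> j"
  proof -
    have "norm (integral I (\<lambda>v. (z - exp (- s * of_real v)) * of_real (f v))) \<le>
        integral I (\<lambda>v. norm s * E \<sigma> j * f v)"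
    proof (rule integral_norm_bound_integral[OF i1])
      show "(\<lambda>v. norm s * E \<sigma> j * f v) integrable_on I"
        unfolding I_def by (intro integrable_on_mult_right f_integrable) auto
      fix v assume v: "v \<in> I"
      have "norm (z - exp (- s * of_real v)) \<le> norm s * E \<sigma> j"
      proof (cases "v \<le> l j")
        case True
        show ?thesis unfolding z_def using True assms v l_le[of j]
          by (intro norm_exp_diff_le) (auto simp: I_def dest: nonneg_of_lam_le)
      next
        case False
        have "norm (exp (- s * of_real v) - z) \<le> norm s * E \<sigma> j"
          unfolding z_def using False assms v l_gt[of j]
          by (intro norm_exp_diff_le) (auto simp: I_def less_imp_le)
        then show ?thesis by (simp add: norm_minus_commute)
      qed
      moreover have "0 \<le> f v"
        using v f_ge[of v] lam_nonneg[of j] by (auto simp: I_def)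
      ultimately show "norm ((z - exp (- s * of_real v)) * of_real (f v)) \<le> norm s * E \<sigma> j * f v"
        by (simp add: norm_mult mult_right_mono)
    qed
    also have "\<dots> = norm s * E \<sigma> j"
      unfolding I_def using integral_f_step[of j] by simp
    finally show ?thesis .
  qed
  have b3: "norm (integral I (\<lambda>v. exp (- s * of_real v) * of_real (wgt v - f v))) \<le> C0 * E (1/10) j"
  proof -
    have "norm (integral I (\<lambda>v. exp (- s * of_real v) * of_real (wgt v - f v))) \<le>
        integral I (\<lambda>v. C0 * exp (- (1/10) * v))"
    proof (rule integral_norm_bound_integral[OF i4])
      show "(\<lambda>v. C0 * exp (- (1/10) * v)) integrable_on I"
        unfolding I_def by (intro integrable_continuous_interval continuous_intros)
      fix v assume "v \<in> I"
      then have v: "0 \<le> v" by (auto simp: I_def dest: nonneg_of_lam_le)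
      have sv: "exp (- Re s * v) \<le> exp (- (3/5) * v)"
        unfolding exp_le_cancel_iff by (rule mult_right_mono) (use assms v in auto)
      have "norm (exp (- s * of_real v) * of_real (wgt v - f v)) = exp (- Re s * v) * (wgt v - f v)"
        using f_le[OF v] by (simp only: norm_mult norm_of_real norm_exp_eq_Re) simp
      also have "\<dots> \<le> exp (- (3/5) * v) * (C0 * exp (v / 2))"
        using f_le[OF v] by (intro mult_mono[OF sv f_close[OF v]]) auto
      also have "\<dots> = C0 * exp (- (1/10) * v)"
        by (simp flip: exp_add)
      finally show "norm (exp (- s * of_real v) * of_real (wgt v - f v)) \<le> C0 * exp (- (1/10) * v)" .
    qed
    also have "\<dots> = C0 * E (1/10) j"
      using integral_unique[OF has_integral_exp_E[of "1/10" j]] unfolding I_def by simp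
    finally show ?thesis .
  qed
  have "norm (x + y - w) \<le> norm x + norm y + norm w" for x y w :: complex
    using norm_triangle_ineq4[of "x + y" w] norm_triangle_ineq[of x y] by linarith
  from order_trans[OF this add_mono[OF add_mono[OF b1 b2] b3]] show ?thesis
    unfolding eq by simp
qed

end

section \<open>Convergence of the sum over cells and the zero-free factor \<open>Z\<close>\<close>

context beurling_sample begin

definition bnd :: "nat \<Rightarrow> real" where
  "bnd j = C0 * E (1/10) j + Ln_const * exp (- (6/5) * l j)"

lemma bnd_nonneg: "0 \<le> bnd j"
  unfolding bnd_def using C0_nonneg Ln_const_pos by (auto intro!: add_nonneg_nonneg mult_nonneg_nonneg E_nonneg)

lemma integral_exp_f_le:
  assumes "0 \<le> V"
  shows "integral {0..V} (\<lambda>v. exp (- \<sigma> * v) * f v) \<le> integral {0..V} (\<lambda>v. exp (- \<sigma> * v) * wgt v)"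
  by (intro integral_le integrable_continuous_interval continuous_intros cont_f) (auto intro!: f_le)

lemma integral_exp_le:
  assumes "0 \<le> V" "0 < (\<sigma>::real)" shows "integral {0..V} (\<lambda>v. exp (- \<sigma> * v)) \<le> 1 / \<sigma>"
proof -
  have "((\<lambda>v. exp (- \<sigma> * v)) has_integral (- exp (- \<sigma> * V) / \<sigma>) - (- exp (- \<sigma> * 0) / \<sigma>)) {0..V}"
    using assms by (intro fundamental_theorem_of_calculus[of 0 V "\<lambda>v. - exp (- \<sigma> * v) / \<sigma>"])
      (auto intro!: derivative_eq_intros simp flip: has_real_derivative_iff_has_vector_derivative)
  then have "integral {0..V} (\<lambda>v. exp (- \<sigma> * v)) = (- exp (- \<sigma> * V) / \<sigma>) - (- exp (- \<sigma> * 0) / \<sigma>)"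
    by (rule integral_unique)
  also have "\<dots> \<le> 1 / \<sigma>" using assms by (simp add: field_simps)
  finally show ?thesis .
qed

lemma summable_exp_l: "summable (\<lambda>j. exp (- (6/5) * l j))"
proof (rule summableI_nonneg_bounded)
  fix m
  have "(\<Sum>j<m. exp (- (6/5) * l j)) \<le> 1 + integral {0..lam m} (\<lambda>v. exp (- (6/5) * v) * wgt v)"
    using sum_exp_l_le[of "6/5" m] integral_exp_f_le[of "lam m" "6/5"] by simp
  also have "integral {0..lam m} (\<lambda>v. exp (- (6/5) * v) * wgt v) \<le> integral {0..lam m} (\<lambda>v. exp (- (1/5) * v))"
  proof (intro integral_le integrable_continuous_interval continuous_intros)
    fix v assume "v \<in> {0..lam m}"
    then have "exp (- (6/5) * v) * wgt v \<le> exp (- (6/5) * v) * exp v"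
      by (intro mult_left_mono wgt_le_exp) auto
    then show "exp (- (6/5) * v) * wgt v \<le> exp (- (1/5) * v)"
      by (simp flip: exp_add)
  qed
  also have "\<dots> \<le> 5" using integral_exp_le[of "lam m" "1/5"] by simp
  finally show "(\<Sum>j<m. exp (- (6/5) * l j)) \<le> 1 + 5" by simp
qed simp

lemma summable_bnd: "summable bnd"
  unfolding bnd_def using E_sums[of "1/10" 0]
  by (intro summable_add summable_mult summable_exp_l) (auto simp: sums_iff)

definition K_tail :: real where "K_tail = suminf bnd"

lemma norm_R_le':
  assumes "3/5 \<le> \<sigma>" "\<sigma> \<le> Re s"
  shows "norm (R j s) \<le> norm s * E \<sigma> j + bnd j"
  using norm_R_le[OF assms, of j] by (simp add: bnd_def)

lemma summable_R: assumes "3/5 \<le> Re s" shows "summable (\<lambda>j. R j s)"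
proof (rule summable_comparison_test')
  show "summable (\<lambda>j. norm s * E (3/5) j + bnd j)"
    using E_sums[of "3/5" 0] by (intro summable_add summable_mult summable_bnd) (auto simp: sums_iff)
  show "norm (R j s) \<le> norm s * E (3/5) j + bnd j" for j
    using assms by (intro norm_R_le') auto
qed

text \<open>The factor \<open>norm s\<close> is paired with \<open>exp (- \<sigma> * lam J)\<close>:
  once \<open>lam J\<close> is slightly beyond the logarithm of the height, the remaining cells
  contribute little, wherever their primes lie.\<close>

lemma norm_R_tail:
  assumes "3/5 \<le> \<sigma>" "\<sigma> \<le> Re s"
  shows "norm (\<Sum>j. R (j + J) s) \<le> norm s * exp (- \<sigma> * lam J) / \<sigma> + K_tail"
proof -
  have s1: "(\<lambda>j. norm s * E \<sigma> (j + J)) sums (norm s * (exp (- \<sigma> * lam J) / \<sigma>))"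
    using assms by (intro sums_mult E_sums) auto
  have s2: "summable (\<lambda>j. bnd (j + J))"
    using summable_bnd by (simp add: summable_iff_shift)
  have s3: "(\<lambda>j. norm s * E \<sigma> (j + J) + bnd (j + J)) sums (norm s * (exp (- \<sigma> * lam J) / \<sigma>) + (\<Sum>j. bnd (j + J)))"
    using s1 s2 by (intro sums_add) auto
  have "norm (\<Sum>j. R (j + J) s) \<le> (\<Sum>j. norm s * E \<sigma> (j + J) + bnd (j + J))"
    using s3 norm_R_le'[OF assms] by (intro norm_suminf_le) (auto simp: sums_iff)
  also have "\<dots> = norm s * exp (- \<sigma> * lam J) / \<sigma> + (\<Sum>j. bnd (j + J))"
    using s3 by (simp add: sums_iff)
  also have "(\<Sum>j. bnd (j + J)) \<le> K_tail"
    using suminf_split_initial_segment[OF summable_bnd, of J] sum_nonneg[of "{..<J}" bnd] bnd_nonneg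
    by (simp add: K_tail_def)
  finally show ?thesis by simp
qed

definition Z :: "complex \<Rightarrow> complex" where "Z s = exp (\<Sum>j. R j s)"

lemma Z_nonzero [simp]: "Z s \<noteq> 0"
  by (simp add: Z_def)

lemma one_minus_exp_Re:
  assumes "0 < Re s" shows "0 < Re (1 - exp (- s * of_real (l j)))"
proof -
  have "norm (exp (- s * of_real (l j))) < 1"
    using assms by (simp add: zero_less_mult_iff)
  then show ?thesis
    using complex_Re_le_cmod[of "exp (- s * of_real (l j))"]
    by (simp only: minus_complex.sel one_complex.sel)
qed

lemma R_holomorphic: "R j holomorphic_on {s. 0 < Re s}"
proof -
  have "(\<lambda>s. integral (cbox (lam j) (lam (Suc j))) (\<lambda>v. exp (- s * of_real v) * of_real (wgt v))) holomorphic_on {s. 0 < Re s}"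
  proof (rule leibniz_rule_holomorphic)
    show "((\<lambda>s. exp (- s * of_real v) * of_real (wgt v)) has_field_derivative
        - of_real v * exp (- s * of_real v) * of_real (wgt v)) (at s within {s. 0 < Re s})" for s v
      by (auto intro!: derivative_eq_intros)
    show "(\<lambda>v. exp (- s * of_real v) * of_real (wgt v)) integrable_on cbox (lam j) (lam (Suc j))" for s :: complex
      by (intro integrable_continuous continuous_intros)
    show "continuous_on ({s. 0 < Re s} \<times> cbox (lam j) (lam (Suc j)))
        (\<lambda>(s, v). - of_real v * exp (- s * of_real v) * of_real (wgt v))"
      by (auto intro!: continuous_intros simp: case_prod_unfold)
    show "convex {s. 0 < Re s}" by (rule convex_halfspace_Re_gt)
  qed
  moreover have "1 - exp (- s * of_real (l j)) \<notin> \<real>\<^sub>\<le>\<^sub>0" if "0 < Re s" for s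
    using one_minus_exp_Re[OF that, of j] complex_nonpos_Reals_iff by force
  ultimately show ?thesis
    unfolding R_def by (intro holomorphic_intros) auto
qed

lemma D_holomorphic: "(\<lambda>s. \<Sum>j. R j s) holomorphic_on {s. 3/5 < Re s}"
proof (rule holomorphic_uniform_sequence)
  show op: "open {s. 3/5 < Re s}" by (rule open_halfspace_Re_gt)
  show "(\<lambda>s. \<Sum>j<n. R j s) holomorphic_on {s. 3/5 < Re s}" for n
    by (intro holomorphic_intros holomorphic_on_subset[OF R_holomorphic]) auto
  fix x assume "x \<in> {s. 3/5 < Re s}"
  then obtain d where d: "d > 0" "cball x d \<subseteq> {s. 3/5 < Re s}"
    using op by (metis open_contains_cball)
  have "uniform_limit (cball x d) (\<lambda>n s. \<Sum>j<n. R j s) (\<lambda>s. \<Sum>j. R j s) sequentially"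
  proof (rule Weierstrass_m_test)
    show "summable (\<lambda>j. (norm x + d) * E (3/5) j + bnd j)"
      using E_sums[of "3/5" 0] by (intro summable_add summable_mult summable_bnd) (auto simp: sums_iff)
    fix j s assume s: "s \<in> cball x d"
    have "norm s \<le> norm x + d"
      using s norm_triangle_ineq2[of s x] by (simp add: dist_norm norm_minus_commute)
    moreover have "norm (R j s) \<le> norm s * E (3/5) j + bnd j"
      using s d by (intro norm_R_le') (auto intro: less_imp_le)
    ultimately show "norm (R j s) \<le> (norm x + d) * E (3/5) j + bnd j"
      using mult_right_mono[OF _ E_nonneg[of "3/5" j]] by fastforce
  qed
  with d show "\<exists>d>0. cball x d \<subseteq> {s. 3/5 < Re s} \<and>
      uniform_limit (cball x d) (\<lambda>n s. \<Sum>j<n. R j s) (\<lambda>s. \<Sum>j. R j s) sequentially" by blast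
qed

lemma Z_holomorphic: "Z holomorphic_on {s. 3/5 < Re s}"
  unfolding Z_def by (intro holomorphic_intros D_holomorphic)

lemma integral_wgt_lam:
  "integral {0..lam m} (\<lambda>v. exp (- s * of_real v) * of_real (wgt v)) =
    (\<Sum>j<m. integral {lam j..lam (Suc j)} (\<lambda>v. exp (- s * of_real v) * of_real (wgt v) :: complex))"
proof (induction m)
  case (Suc m)
  have "integral {0..lam m} (\<lambda>v. exp (- s * of_real v) * of_real (wgt v) :: complex) +
      integral {lam m..lam (Suc m)} (\<lambda>v. exp (- s * of_real v) * of_real (wgt v)) =
      integral {0..lam (Suc m)} (\<lambda>v. exp (- s * of_real v) * of_real (wgt v))"
    using lam_Suc[of m]
    by (intro Henstock_Kurzweil_Integration.integral_combine integrable_continuous_interval continuous_intros) auto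
  then show ?case using Suc by simp
qed (simp add: lam_0)

definition rem :: "nat \<Rightarrow> complex \<Rightarrow> complex" where
  "rem J s = integral {0..1} (\<lambda>u. exp (- (s - of_real u) * of_real (lam J)) / (s - of_real u))"

text \<open>The Euler factors of the first \<open>J\<close> cells are kept exactly, and
  \<open>laplace_wgt\<close> evaluates their models as \<open>Ln s - Ln (s - 1)\<close> up to
  \<open>rem\<close>. With \<open>J\<close> free this approximates \<open>zeta\<close> by finite
  Euler products even left of the line Re s = 1.\<close>

lemma Z_eq:
  assumes s: "Im s \<noteq> 0 \<or> Re s > 1" and s': "3/5 \<le> Re s"
  shows "Z s * (s / (s - 1)) =
    exp ((\<Sum>j<J. - Ln (1 - exp (- s * of_real (l j)))) + (\<Sum>j. R (j + J) s) + rem J s)"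
proof -
  have "(\<Sum>j. R j s) = (\<Sum>j. R (j + J) s) + (\<Sum>j<J. R j s)"
    by (rule suminf_split_initial_segment) (rule summable_R[OF s'])
  also have "(\<Sum>j<J. R j s) = (\<Sum>j<J. - Ln (1 - exp (- s * of_real (l j)))) -
      integral {0..lam J} (\<lambda>v. exp (- s * of_real v) * of_real (wgt v))"
    unfolding R_def sum_subtractf integral_wgt_lam by simp
  also have "integral {0..lam J} (\<lambda>v. exp (- s * of_real v) * of_real (wgt v)) = Ln s - Ln (s - 1) - rem J s"
    unfolding rem_def by (rule laplace_wgt) (use s in auto)
  finally have eq: "(\<Sum>j. R j s) + (Ln s - Ln (s - 1)) = (\<Sum>j<J. - Ln (1 - exp (- s * of_real (l j)))) +
      (\<Sum>j. R (j + J) s) + rem J s" by simp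
  have "s \<noteq> 0" "s \<noteq> 1" using s s' by auto
  then have "Z s * (s / (s - 1)) = exp ((\<Sum>j. R j s) + (Ln s - Ln (s - 1)))"
    by (simp only: Z_def exp_add exp_diff) simp
  then show ?thesis unfolding eq .
qed

lemma norm_rem_le:
  assumes "0 < b" "b \<le> \<bar>Im s\<bar> \<or> b \<le> Re s - 1"
  shows "norm (rem J s) \<le> exp ((1 - Re s) * lam J) / b"
  unfolding rem_def by (rule norm_laplace_remainder) (use assms in auto)

text \<open>Let \<open>J\<close> tend to infinity in \<open>Z_eq\<close>: to the right of 1 both the
  tail of the \<open>R j\<close> and \<open>rem\<close> vanish.\<close>

lemma euler_prod_LIMSEQ:
  assumes s: "Re s > 1"
  shows "(\<lambda>J. \<Prod>j<J. 1 / (1 - exp (- s * of_real (l j)))) \<longlonglongrightarrow> Z s * (s / (s - 1))"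
proof -
  have *: "(\<Prod>j<J. 1 / (1 - exp (- s * of_real (l j)))) =
      Z s * (s / (s - 1)) * exp (- (\<Sum>j. R (j + J) s) - rem J s)" for J
  proof -
    have nz: "1 - exp (- s * of_real (l j)) \<noteq> 0" for j
      using one_minus_exp_Re[of s j] s by auto
    have "(\<Prod>j<J. 1 / (1 - exp (- s * of_real (l j)))) =
        exp (\<Sum>j<J. - Ln (1 - exp (- s * of_real (l j))))"
      using nz by (simp add: exp_sum exp_minus field_simps)
    then show ?thesis using s by (subst Z_eq[where J = J]) (auto simp flip: exp_add)
  qed
  have "(\<lambda>J. \<Sum>j. R (j + J) s) \<longlonglongrightarrow> 0"
    using suminf_exist_split2[OF summable_R[of s]] s by simp
  moreover have "(\<lambda>J. rem J s) \<longlonglongrightarrow> 0"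
  proof (rule Lim_null_comparison)
    show "\<forall>\<^sub>F J in sequentially. norm (rem J s) \<le> exp ((1 - Re s) * lam J) / (Re s - 1)"
      by (intro always_eventually allI norm_rem_le) (use s in auto)
    show "(\<lambda>J. exp ((1 - Re s) * lam J) / (Re s - 1)) \<longlonglongrightarrow> 0"
      by (rule filterlim_compose[OF _ lam_at_top]) (use s in real_asymp)
  qed
  ultimately have "(\<lambda>J. Z s * (s / (s - 1)) * exp (- (\<Sum>j. R (j + J) s) - rem J s)) \<longlonglongrightarrow> Z s * (s / (s - 1)) * exp (- 0 - 0)"
    by (intro tendsto_intros)
  then show ?thesis unfolding * by simp
qed

end

section \<open>Generalized integers and the Euler product\<close>

lemma bij_betw_add_replicate_mset:
  "bij_betw (\<lambda>(M, k). M + replicate_mset k m)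
     ({M. set_mset M \<subseteq> {..<m}} \<times> UNIV) {M. set_mset M \<subseteq> {..<Suc m}}"
proof (rule bij_betwI[where g = "\<lambda>M. (filter_mset (\<lambda>x. x \<noteq> m) M, count M m)"])
  show "(\<lambda>(M, k). M + replicate_mset k m) \<in> {M. set_mset M \<subseteq> {..<m}} \<times> UNIV \<rightarrow> {M. set_mset M \<subseteq> {..<Suc m}}"
    by (auto simp: less_Suc_eq subset_iff split: if_splits)
  show "(\<lambda>M. (filter_mset (\<lambda>x. x \<noteq> m) M, count M m)) \<in> {M. set_mset M \<subseteq> {..<Suc m}} \<rightarrow> {M. set_mset M \<subseteq> {..<m}} \<times> UNIV"
    by (auto simp: less_Suc_eq)
  fix p assume "p \<in> {M. set_mset M \<subseteq> {..<m}} \<times> (UNIV :: nat set)"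
  then show "(filter_mset (\<lambda>x. x \<noteq> m) (case p of (M, k) \<Rightarrow> M + replicate_mset k m),
      count (case p of (M, k) \<Rightarrow> M + replicate_mset k m) m) = p"
    by (cases p) (auto simp: multiset_eq_iff count_eq_zero_iff)
next
  fix M assume "M \<in> {M. set_mset M \<subseteq> {..<Suc m}}"
  show "(case (filter_mset (\<lambda>x. x \<noteq> m) M, count M m) of (M, k) \<Rightarrow> M + replicate_mset k m) = M"
    by (auto simp: multiset_eq_iff)
qed

text \<open>Induction on the number of primes: the multiplicity of the new prime contributes a
  geometric series. Absolute summability is carried along because the sum over pairs of multiset and
  multiplicity is evaluated iteratively.\<close>

lemma has_sum_prod_mset:
  fixes z :: "nat \<Rightarrow> complex"
  assumes z: "\<And>j. norm (z j) < 1"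
  shows "((\<lambda>M. \<Prod>j\<in>#M. z j) has_sum (\<Prod>j<m. 1 / (1 - z j))) {M. set_mset M \<subseteq> {..<m}} \<and>
    (\<lambda>M. norm (\<Prod>j\<in>#M. z j)) summable_on {M. set_mset M \<subseteq> {..<m}}"
proof (induction m)
  case 0
  have "{M :: nat multiset. set_mset M \<subseteq> {..<0}} = {{#}}" by auto
  then show ?case using has_sum_finite[of "{{#}}" "\<lambda>M. \<Prod>j\<in>#M. z j"] by simp
next
  case (Suc m)
  define g where "g M = (\<Prod>j\<in>#M. z j)" for M
  define S where "S m = {M. set_mset M \<subseteq> {..<m}}" for m :: nat
  have geo: "((\<lambda>k. w ^ k) has_sum (1 / (1 - w))) UNIV" if "norm w < 1" for w :: "'b :: {real_normed_field, banach}"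
    using that geometric_sums[OF that] 
    by (intro norm_summable_imp_has_sum) (auto simp: norm_power intro!: summable_geometric)
  have "(\<lambda>p. norm (g (fst p) * z m ^ snd p)) summable_on (S m \<times> UNIV)"
  proof (rule summable_on_SigmaI)
    show "((\<lambda>k. norm (g (fst (M, k)) * z m ^ snd (M, k))) has_sum norm (g M) * (1 / (1 - norm (z m)))) UNIV" for M
      using has_sum_cmult_right[OF geo[of "norm (z m)"], of "norm (g M)"] z[of m] by (simp add: norm_mult norm_power)
    show "(\<lambda>M. norm (g M) * (1 / (1 - norm (z m)))) summable_on S m"
      using Suc.IH unfolding g_def S_def by (intro summable_on_cmult_left) auto
  qed auto
  then have abs: "(\<lambda>p. norm (g (fst p) * z m ^ snd p)) summable_on (S m \<times> UNIV)" by simp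
  have "((\<lambda>p. g (fst p) * z m ^ snd p) has_sum (\<Prod>j<m. 1 / (1 - z j)) * (1 / (1 - z m))) (S m \<times> UNIV)"
  proof (rule has_sum_SigmaI)
    show "((\<lambda>k. g (fst (M, k)) * z m ^ snd (M, k)) has_sum g M * (1 / (1 - z m))) UNIV" for M
      using has_sum_cmult_right[OF geo[of "z m"], of "g M"] z[of m] by simp
    show "((\<lambda>M. g M * (1 / (1 - z m))) has_sum (\<Prod>j<m. 1 / (1 - z j)) * (1 / (1 - z m))) (S m)"
      using Suc.IH unfolding g_def S_def by (intro has_sum_cmult_left) auto
    show "(\<lambda>p. g (fst p) * z m ^ snd p) summable_on S m \<times> UNIV"
      using abs by (rule abs_summable_summable)
  qed
  moreover have eq: "g (fst p) * z m ^ snd p = g ((\<lambda>(M, k). M + replicate_mset k m) p)" for p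
    by (cases p) (simp add: g_def)
  moreover note bij = bij_betw_add_replicate_mset[of m, folded S_def]
  ultimately have 1: "(g has_sum (\<Prod>j<Suc m. 1 / (1 - z j))) (S (Suc m))"
    using has_sum_reindex_bij_betw[OF bij, of g] by simp
  have 2: "(\<lambda>x. norm (g x)) summable_on S (Suc m)"
    using abs summable_on_reindex_bij_betw[OF bij, of "\<lambda>M. norm (g M)"] by (simp only: eq)
  show ?case using 1 2 unfolding g_def S_def by simp
qed

text \<open>The sets \<open>A m\<close> may be infinite, as are the multisets over the first
  \<open>m\<close> primes, so convergence along finite sets does not apply to them directly. The sum
  over \<open>A m\<close> is itself a limit over finite sets that contain \<open>X\<close>, and
  those are all close to \<open>S\<close>.\<close>

lemma infsum_exhaust_LIMSEQ:
  fixes g :: "'b \<Rightarrow> complex"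
  assumes g: "(g has_sum S) UNIV" and abs: "(\<lambda>x. norm (g x)) summable_on UNIV"
    and A: "\<And>X. finite X \<Longrightarrow> \<forall>\<^sub>F m in sequentially. X \<subseteq> A m"
  shows "(\<lambda>m. infsum g (A m)) \<longlonglongrightarrow> S"
proof (rule tendstoI)
  fix e :: real assume e: "e > 0"
  have "\<forall>\<^sub>F X in finite_subsets_at_top UNIV. dist (sum g X) S < e / 2"
    using g e unfolding has_sum_def by (intro tendstoD) auto
  then obtain X where X: "finite X" "\<And>Y. finite Y \<Longrightarrow> X \<subseteq> Y \<Longrightarrow> dist (sum g Y) S < e / 2"
    unfolding eventually_finite_subsets_at_top by auto
  have "\<forall>\<^sub>F m in sequentially. X \<subseteq> A m" using A X by blast
  then show "\<forall>\<^sub>F m in sequentially. dist (infsum g (A m)) S < e"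
  proof eventually_elim
    case (elim m)
    have "g summable_on A m"
      using abs abs_summable_summable summable_on_subset_banach by blast
    then have lim: "(sum g \<longlongrightarrow> infsum g (A m)) (finite_subsets_at_top (A m))"
      using has_sum_infsum has_sum_def by blast
    have "\<forall>\<^sub>F Y in finite_subsets_at_top (A m). dist (sum g Y) S \<le> e / 2"
      unfolding eventually_finite_subsets_at_top
      by (rule exI[of _ X]) (use X elim in \<open>auto intro: less_imp_le\<close>)
    then have "dist (infsum g (A m)) S \<le> e / 2"
      by (intro tendsto_upperbound[OF tendsto_dist[OF lim tendsto_const]]) auto
    then show ?case using e by simp
  qed
qed

context beurling_sample begin

definition Lam :: "nat multiset \<Rightarrow> real" where "Lam M = (\<Sum>j\<in>#M. l j)"
definition Ints :: "real \<Rightarrow> nat multiset set" where "Ints L = {M. Lam M \<le> L}"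
definition Nc :: "real \<Rightarrow> real" where "Nc L = real (card (Ints L))"
definition zeta :: "complex \<Rightarrow> complex" where "zeta s = Z s * (s / (s - 1))"

lemma Lam_empty [simp]: "Lam {#} = 0" and Lam_add [simp]: "Lam (M + M') = Lam M + Lam M'"
  and Lam_replicate [simp]: "Lam (replicate_mset k j) = k * l j"
  by (auto simp: Lam_def)

lemma Lam_nonneg [simp]: "0 \<le> Lam M"
  unfolding Lam_def by (induction M) (auto intro!: add_nonneg_nonneg less_imp_le[OF l_pos])

lemma exp_Lam: "exp (- s * of_real (Lam M)) = (\<Prod>j\<in>#M. exp (- s * of_real (l j) :: complex))"
  unfolding Lam_def by (induction M) (simp_all add: ring_distribs exp_diff exp_minus divide_inverse)

lemma finite_mset_subset_lessThan:
  assumes "finite X" shows "\<forall>\<^sub>F m in sequentially. X \<subseteq> {M :: nat multiset. set_mset M \<subseteq> {..<m}}"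
proof -
  have "finite (\<Union> (set_mset ` X))" using assms by auto
  then obtain m where "\<Union> (set_mset ` X) \<subseteq> {..<m}"
    using finite_nat_iff_bounded by blast
  then have "X \<subseteq> {M. set_mset M \<subseteq> {..<n}}" if "n \<ge> m" for n using that by fastforce
  then show ?thesis unfolding eventually_sequentially by blast
qed

text \<open>Finite sums are dominated by partial Euler products at the real point Re s, which
  converge and hence are bounded.\<close>

lemma exp_Lam_abs_summable:
  assumes s: "Re s > 1" shows "(\<lambda>M. norm (exp (- s * of_real (Lam M)) :: complex)) summable_on UNIV"
proof (rule nonneg_bdd_above_summable_on)
  define \<sigma> where "\<sigma> = complex_of_real (Re s)"
  define P where "P m = (\<Prod>j<m. 1 / (1 - exp (- \<sigma> * of_real (l j))))" for m
  have "Bseq P"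
    unfolding P_def using euler_prod_LIMSEQ[of \<sigma>] s by (intro convergent_imp_Bseq) (auto simp: convergent_def \<sigma>_def)
  then obtain K where K: "\<And>m. norm (P m) \<le> K" by (auto elim!: BseqE)
  show "bdd_above (sum (\<lambda>M. norm (exp (- s * of_real (Lam M)))) ` {F. F \<subseteq> UNIV \<and> finite F})"
  proof (rule bdd_aboveI2)
    fix F :: "nat multiset set" assume "F \<in> {F. F \<subseteq> UNIV \<and> finite F}"
    then have F: "finite F" by simp
    obtain m where m: "F \<subseteq> {M. set_mset M \<subseteq> {..<m}}"
      using finite_mset_subset_lessThan[OF F] by (auto simp: eventually_sequentially)
    define h where "h M = (\<Prod>j\<in>#M. exp (- \<sigma> * of_real (l j)))" for M
    have h: "(h has_sum P m) {M. set_mset M \<subseteq> {..<m}}"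
      unfolding h_def P_def using s has_sum_prod_mset[of "\<lambda>j. exp (- \<sigma> * of_real (l j))" m]
      by (auto simp: \<sigma>_def)
    have hM: "h M = of_real (norm (exp (- s * of_real (Lam M))))" for M
      unfolding h_def exp_Lam[symmetric] by (simp add: \<sigma>_def flip: exp_of_real)
    have "((\<lambda>M. norm (exp (- s * of_real (Lam M)))) has_sum Re (P m)) {M. set_mset M \<subseteq> {..<m}}"
      using has_sum_Re[OF h] by (simp only: hM Re_complex_of_real)
    then have "sum (\<lambda>M. norm (exp (- s * of_real (Lam M)))) F \<le> Re (P m)"
      using F m by (intro has_sum_mono2[OF has_sum_finite]) auto
    also have "\<dots> \<le> K" using complex_Re_le_cmod[of "P m"] K[of m] by linarith
    finally show "sum (\<lambda>M. norm (exp (- s * of_real (Lam M)))) F \<le> K" .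
  qed
qed auto

lemma zeta_has_sum:
  assumes s: "Re s > 1" shows "((\<lambda>M. exp (- s * of_real (Lam M))) has_sum zeta s) UNIV"
proof -
  define g where "g M = exp (- s * of_real (Lam M))" for M
  have abs: "(\<lambda>x. norm (g x)) summable_on UNIV" unfolding g_def by (rule exp_Lam_abs_summable[OF s])
  have sum: "(g has_sum infsum g UNIV) UNIV"
    using abs abs_summable_summable has_sum_infsum by blast
  have lim: "(\<lambda>m. infsum g {M. set_mset M \<subseteq> {..<m}}) \<longlonglongrightarrow> infsum g UNIV"
    using sum abs finite_mset_subset_lessThan by (rule infsum_exhaust_LIMSEQ)
  have eq: "infsum g {M. set_mset M \<subseteq> {..<m}} = (\<Prod>j<m. 1 / (1 - exp (- s * of_real (l j))))" for m
    unfolding g_def exp_Lam using s has_sum_prod_mset[of "\<lambda>j. exp (- s * of_real (l j))" m]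
    by (auto intro!: infsumI)
  have "infsum g UNIV = zeta s"
    using LIMSEQ_unique[OF lim[unfolded eq] euler_prod_LIMSEQ[OF s]] unfolding zeta_def .
  then show ?thesis using sum unfolding g_def by simp
qed

text \<open>Rankin's trick with exponent 2: each element of \<open>Ints L\<close> contributes at
  least \<open>exp (- 2 * L)\<close> to a convergent sum.\<close>

lemma finite_Ints [simp]: "finite (Ints L)"
proof -
  define h where "h M = norm (exp (- 2 * of_real (Lam M) :: complex))" for M
  have h: "h summable_on UNIV" unfolding h_def using exp_Lam_abs_summable[of 2] by simp
  have "card F \<le> nat \<lceil>infsum h UNIV * exp (2 * L)\<rceil>" if F: "F \<subseteq> Ints L" "finite F" for F
  proof -
    have "real (card F) * exp (- 2 * L) = (\<Sum>M\<in>F. exp (- 2 * L))" by simp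
    also have "\<dots> \<le> sum h F"
      using F by (intro sum_mono) (auto simp: h_def Ints_def)
    also have "\<dots> \<le> infsum h UNIV"
      using F h by (intro finite_sum_le_infsum) (auto simp: h_def)
    finally have "real (card F) \<le> infsum h UNIV * exp (2 * L)"
      by (simp add: exp_minus field_simps)
    then show ?thesis by linarith
  qed
  then show ?thesis using finite_if_finite_subsets_card_bdd by blast
qed

lemma Ints_mono: "L \<le> L' \<Longrightarrow> Ints L \<subseteq> Ints L'"
  by (auto simp: Ints_def)

lemma Nc_mono: "L \<le> L' \<Longrightarrow> Nc L \<le> Nc L'"
  by (auto simp: Nc_def intro!: card_mono Ints_mono)

lemma Nc_neg: "L < 0 \<Longrightarrow> Ints L = {}"
  unfolding Ints_def using order_trans[OF Lam_nonneg] by fastforce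

lemma filterlim_Ints: "filterlim Ints (finite_subsets_at_top UNIV) at_top"
  unfolding filterlim_finite_subsets_at_top
proof (intro allI impI)
  fix X :: "nat multiset set" assume "finite X \<and> X \<subseteq> UNIV"
  then have X: "finite X" by simp
  show "\<forall>\<^sub>F L in at_top. finite (Ints L) \<and> X \<subseteq> Ints L \<and> Ints L \<subseteq> UNIV"
  proof (rule eventually_at_top_linorderI)
    fix L assume "(\<Sum>M\<in>X. Lam M) \<le> L"
    then have "Lam M \<le> L" if "M \<in> X" for M
      using member_le_sum[OF that, of Lam] X by auto
    then show "finite (Ints L) \<and> X \<subseteq> Ints L \<and> Ints L \<subseteq> UNIV"
      using finite_Ints[of L] by (auto simp: Ints_def)
  qed
qed

lemma sum_Ints_tendsto:
  assumes s: "Re s > 1"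
  shows "((\<lambda>L. \<Sum>M\<in>Ints L. exp (- s * of_real (Lam M))) \<longlongrightarrow> zeta s) at_top"
  using zeta_has_sum[OF s] filterlim_Ints unfolding has_sum_def by (rule filterlim_compose)

end

section \<open>Chebyshev estimate\<close>

context beurling_sample begin

lemma mult_l_nonneg: "0 \<le> real \<nu> * l j"
  by (simp add: less_imp_le)

definition J :: "real \<Rightarrow> nat" where "J Y = card {j. l j \<le> Y}"

lemma l_le_eq_lessThan: "{j. l j \<le> Y} = {..<J Y}"
proof -
  have "\<exists>m. \<not> l m \<le> Y"
  proof -
    have "\<forall>\<^sub>F m in sequentially. Y + 1 \<le> l m"
      using l_at_top by (simp add: filterlim_at_top)
    then obtain m where "Y + 1 \<le> l m" by (auto simp: eventually_sequentially)
    then show ?thesis by (intro exI[of _ m]) auto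
  qed
  define m where "m = (LEAST m. \<not> l m \<le> Y)"
  have "\<not> l m \<le> Y" unfolding m_def using \<open>\<exists>m. \<not> l m \<le> Y\<close> by (rule LeastI_ex)
  then have "\<not> l j \<le> Y" if "m \<le> j" for j using l_mono[OF that] by simp
  moreover have "l j \<le> Y" if "j < m" for j using not_less_Least that unfolding m_def by blast
  ultimately have "{j. l j \<le> Y} = {..<m}" by (auto simp: not_le[symmetric])
  then show ?thesis by (simp add: J_def)
qed

lemma l_le_iff: "l j \<le> Y \<longleftrightarrow> j < J Y"
  using l_le_eq_lessThan[of Y] by auto

lemma lam_le_of_J:
  assumes "0 \<le> Y" shows "lam (J Y) \<le> Y + 2" "Y < lam (Suc (J Y))" "J Y = Suc n \<Longrightarrow> lam n \<le> Y"
proof -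
  show *: "lam n \<le> Y" if "J Y = Suc n" for n
    using l_le_iff[of n Y] l_gt[of n] that by simp
  show "lam (J Y) \<le> Y + 2"
  proof (cases "J Y")
    case (Suc n)
    then show ?thesis using *[of n] lam_diff_le[of n] by simp
  qed (use assms in \<open>simp add: lam_0\<close>)
  show "Y < lam (Suc (J Y))"
    using l_le_iff[of "J Y" Y] l_le[of "J Y"] by simp
qed

lemma integral_f_le:
  assumes "0 \<le> V" shows "integral {0..V} f \<le> exp V - 1"
proof -
  have "(exp has_integral exp V - exp 0) {0..V}"
    using assms by (intro fundamental_theorem_of_calculus)
      (auto intro!: derivative_eq_intros simp flip: has_real_derivative_iff_has_vector_derivative)
  moreover have "f v \<le> exp v" if "v \<in> {0..V}" for v
    using f_le[of v] wgt_le_exp[of v] that by simp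
  ultimately show ?thesis
    using has_integral_le[OF integrable_integral[OF f_integrable[of 0 V]]] by fastforce
qed

lemma J_le: assumes "0 \<le> V" shows "real (J V) \<le> exp V"
proof (cases "J V")
  case (Suc n)
  have "real n = integral {0..lam n} f" by (simp add: integral_f_lam)
  also have "\<dots> \<le> integral {0..V} f"
    using lam_le_of_J(3)[OF assms Suc] by (intro integral_subset_le f_integrable) (auto intro: f_nonneg)
  also have "\<dots> \<le> exp V - 1" by (rule integral_f_le[OF assms])
  finally show ?thesis using Suc by simp
qed simp

lemma sum_lam_le: "(\<Sum>j<m. lam j) \<le> integral {0..lam m} (\<lambda>v. v * f v)"
proof -
  have "(\<Sum>j<m. lam j) \<le> (\<Sum>j<m. integral {lam j..lam (Suc j)} (\<lambda>v. v * f v))"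
    by (intro sum_mono step_integral_ge continuous_intros) auto
  also have "\<dots> = integral {0..lam m} (\<lambda>v. v * f v)"
    by (rule integral_mult_f_lam[symmetric]) (intro continuous_intros)
  finally show ?thesis .
qed

lemma sum_lam_ge: "integral {0..lam m} (\<lambda>v. v * f v) \<le> (\<Sum>j<m. lam (Suc j))"
proof -
  have "integral {0..lam m} (\<lambda>v. v * f v) = (\<Sum>j<m. integral {lam j..lam (Suc j)} (\<lambda>v. v * f v))"
    by (rule integral_mult_f_lam) (intro continuous_intros)
  also have "\<dots> \<le> (\<Sum>j<m. lam (Suc j))"
    by (intro sum_mono step_integral_le continuous_intros) auto
  finally show ?thesis .
qed

lemma integral_times_f_mono:
  assumes "a \<le> b" shows "integral {0..a} (\<lambda>v. v * f v) \<le> integral {0..b} (\<lambda>v. v * f v)"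
  using assms integrable_mult_f[of 0 _ "\<lambda>v. v"]
  by (intro integral_subset_le) (auto intro!: mult_nonneg_nonneg f_nonneg)

text \<open>Left and right ends of the cells enclose both the sum and the integral. The two end
  point sums are shifts of one another, so the error consists of two end points near
  \<open>Y\<close>.\<close>

lemma theta_bound:
  assumes Y: "0 \<le> Y"
  shows "\<bar>(\<Sum>j<J Y. l j) - integral {0..Y} (\<lambda>v. v * f v)\<bar> \<le> 2 * Y + 6"
proof -
  define I where "I = integral {0..Y} (\<lambda>v. v * f v)"
  have shift: "(\<Sum>j<n. lam (Suc j)) = (\<Sum>j<Suc n. lam j)" for n
    unfolding sum.lessThan_Suc_shift by (simp add: lam_0)
  have 1: "I \<le> (\<Sum>j<J Y. l j) + 2 * Y + 6"
  proof -
    have "I \<le> (\<Sum>j<Suc (J Y). lam (Suc j))"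
      unfolding I_def using lam_le_of_J(2)[OF Y]
      by (intro order_trans[OF integral_times_f_mono sum_lam_ge]) auto
    also have "\<dots> = (\<Sum>j<J Y. lam j) + lam (J Y) + lam (Suc (J Y))" by (simp only: shift sum.lessThan_Suc)
    also have "(\<Sum>j<J Y. lam j) \<le> (\<Sum>j<J Y. l j)" by (intro sum_mono less_imp_le l_gt)
    finally show ?thesis using lam_le_of_J(1)[OF Y] lam_diff_le[of "J Y"] by linarith
  qed
  have 2: "(\<Sum>j<J Y. l j) \<le> I + 2 * Y + 6"
  proof (cases "J Y")
    case 0
    have "0 \<le> I" unfolding I_def using integral_times_f_mono[OF Y] by simp
    then show ?thesis using 0 Y by simp
  next
    case (Suc n)
    have "(\<Sum>j<J Y. l j) \<le> (\<Sum>j<Suc n. lam (Suc j))" unfolding Suc by (intro sum_mono l_le)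
    also have "\<dots> = (\<Sum>j<n. lam j) + lam n + lam (Suc n)" by (simp only: shift sum.lessThan_Suc)
    also have "(\<Sum>j<n. lam j) \<le> I"
      unfolding I_def using lam_le_of_J(3)[OF Y Suc]
      by (intro order_trans[OF sum_lam_le integral_times_f_mono])
    finally show ?thesis using lam_le_of_J(3)[OF Y Suc] lam_diff_le[of n] by linarith
  qed
  show ?thesis using 1 2 unfolding I_def by linarith
qed

lemma times_exp_le: "(v::real) \<le> 4 * exp (v / 4)"
  using exp_ge_add_one_self[of "v / 4"] by linarith

text \<open>\<open>v * wgt v = exp v - 1\<close> makes the model integral explicit. The exponent 3/4
  is 1/2 from the distance of \<open>f\<close> to \<open>wgt\<close> plus 1/4 from absorbing the
  factor \<open>v\<close>.\<close>

lemma integral_times_f_bound: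
  assumes Y: "0 \<le> Y"
  shows "\<bar>integral {0..Y} (\<lambda>v. v * f v) - exp Y\<bar> \<le> 1 + Y + 6 * C0 * exp (3/4 * Y)"
proof -
  have i1: "((\<lambda>v. v * wgt v) has_integral (exp Y - Y) - (exp 0 - 0)) {0..Y}"
    unfolding times_wgt using Y by (intro fundamental_theorem_of_calculus[of 0 Y "\<lambda>v. exp v - v"])
      (auto intro!: derivative_eq_intros simp flip: has_real_derivative_iff_has_vector_derivative)
  have i2: "(\<lambda>v. v * f v) integrable_on {0..Y}"
    using integrable_mult_f[of 0 Y "\<lambda>v. v"] by auto
  have i3: "((\<lambda>v. C0 * (4 * exp (3/4 * v))) has_integral C0 * (16/3 * exp (3/4 * Y)) - C0 * (16/3 * exp (3/4 * 0))) {0..Y}"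
    using Y by (intro fundamental_theorem_of_calculus[of 0 Y "\<lambda>v. C0 * (16/3 * exp (3/4 * v))"])
      (auto intro!: derivative_eq_intros simp flip: has_real_derivative_iff_has_vector_derivative)
  have le: "integral {0..Y} (\<lambda>v. v * f v) \<le> integral {0..Y} (\<lambda>v. v * wgt v)"
    using i1 i2 f_le by (intro integral_le) (auto intro!: mult_left_mono)
  have "integral {0..Y} (\<lambda>v. v * wgt v) - integral {0..Y} (\<lambda>v. v * f v) = integral {0..Y} (\<lambda>v. v * wgt v - v * f v)"
    using i1 i2 by (intro integral_diff[symmetric]) auto
  also have "\<dots> \<le> integral {0..Y} (\<lambda>v. C0 * (4 * exp (3/4 * v)))"
  proof (rule integral_le)
    show "(\<lambda>v. v * wgt v - v * f v) integrable_on {0..Y}" using i1 i2 by (intro integrable_diff) auto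
    show "(\<lambda>v. C0 * (4 * exp (3/4 * v))) integrable_on {0..Y}" using i3 by blast
    fix v assume "v \<in> {0..Y}"
    then have "v * (wgt v - f v) \<le> (4 * exp (v / 4)) * (C0 * exp (v / 2))"
      using f_le[of v] by (intro mult_mono times_exp_le f_close) auto
    also have "\<dots> = C0 * (4 * (exp (v / 4) * exp (v / 2)))" by simp
    also have "exp (v / 4) * exp (v / 2) = exp (3/4 * v)" by (simp flip: exp_add)
    finally show "v * wgt v - v * f v \<le> C0 * (4 * exp (3/4 * v))" by (simp add: algebra_simps)
  qed
  also have "\<dots> \<le> 6 * C0 * exp (3/4 * Y)"
    unfolding integral_unique[OF i3] using C0_nonneg by (simp add: algebra_simps mult_right_mono)
  finally show ?thesis using le integral_unique[OF i1] Y by simp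
qed

text \<open>Prime powers up to \<open>exp Y\<close>, as pairs of prime index and exponent; so
  \<open>Psi Y\<close> is Chebyshev's psi at \<open>exp Y\<close>. \<open>PP2\<close> collects the
  exponents from 2 on, which only primes up to \<open>exp (Y / 2)\<close> can have.\<close>

definition PP :: "real \<Rightarrow> (nat \<times> nat) set" where "PP Y = {(j, \<nu>). 1 \<le> \<nu> \<and> \<nu> * l j \<le> Y}"
definition Psi :: "real \<Rightarrow> real" where "Psi Y = (\<Sum>(j, \<nu>)\<in>PP Y. l j)"
definition PP2 :: "real \<Rightarrow> (nat \<times> nat) set" where
  "PP2 Y = Sigma {..<J (Y / 2)} (\<lambda>j. {2..nat \<lfloor>Y / l j\<rfloor>})"

lemma PP_split:
  assumes "0 \<le> Y"
  shows "PP Y = (\<lambda>j. (j, 1)) ` {..<J Y} \<union> PP2 Y" "(\<lambda>j. (j, 1)) ` {..<J Y} \<inter> PP2 Y = {}"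
proof -
  have iff: "(real \<nu> * l j \<le> Y) = (\<nu> \<le> nat \<lfloor>Y / l j\<rfloor>)" for \<nu> j
    using assms by (simp add: le_nat_iff le_floor_iff pos_le_divide_eq)
  have half: "l j \<le> Y / 2" if "2 \<le> \<nu>" "real \<nu> * l j \<le> Y" for \<nu> j
  proof -
    have "2 * l j \<le> real \<nu> * l j" using that by (intro mult_right_mono) (auto intro: less_imp_le)
    then show ?thesis using that by linarith
  qed
  show "PP Y = (\<lambda>j. (j, 1)) ` {..<J Y} \<union> PP2 Y"
  proof safe
    fix j \<nu> assume *: "(j, \<nu>) \<in> PP Y" "(j, \<nu>) \<notin> PP2 Y"
    then have "\<not> 2 \<le> \<nu>"
      using half[of \<nu> j] by (auto simp: PP_def PP2_def iff l_le_iff[symmetric])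
    then have "\<nu> = 1" using * by (auto simp: PP_def)
    then show "(j, \<nu>) \<in> (\<lambda>j. (j, 1)) ` {..<J Y}"
      using * by (auto simp: PP_def l_le_iff)
  qed (use iff[of 1] in \<open>auto simp: PP_def PP2_def l_le_iff[symmetric] iff\<close>)
  show "(\<lambda>j. (j, 1)) ` {..<J Y} \<inter> PP2 Y = {}" by (auto simp: PP2_def)
qed

lemma finite_PP [simp]: "finite (PP Y)"
proof (cases "0 \<le> Y")
  case True
  then show ?thesis unfolding PP_split(1)[OF True] PP2_def by auto
next
  case False
  then have "PP Y = {}" using order_trans[OF mult_l_nonneg] unfolding PP_def by fastforce
  then show ?thesis by simp
qed

definition K_psi :: real where "K_psi = 20 + 6 * C0"

text \<open>Only primes up to \<open>exp (Y / 2)\<close> have proper powers in range, and all powers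
  of one prime together weigh at most \<open>Y\<close>.\<close>

lemma Psi_bound:
  assumes Y: "0 \<le> Y" shows "\<bar>Psi Y - exp Y\<bar> \<le> K_psi * exp (3/4 * Y)"
proof -
  have fin: "finite (PP2 Y)" by (auto simp: PP2_def)
  have "Psi Y = (\<Sum>(j, \<nu>)\<in>(\<lambda>j. (j, 1::nat)) ` {..<J Y}. l j) + (\<Sum>(j, \<nu>)\<in>PP2 Y. l j)"
    unfolding Psi_def PP_split(1)[OF Y] using PP_split(2)[OF Y] fin by (intro sum.union_disjoint) auto
  also have "(\<Sum>(j, \<nu>)\<in>(\<lambda>j. (j, 1::nat)) ` {..<J Y}. l j) = (\<Sum>j<J Y. l j)"
    by (subst sum.reindex) (auto simp: inj_on_def)
  finally have eq: "Psi Y = (\<Sum>j<J Y. l j) + (\<Sum>(j, \<nu>)\<in>PP2 Y. l j)" .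
  have nn: "0 \<le> (\<Sum>(j, \<nu>)\<in>PP2 Y. l j)"
    by (intro sum_nonneg) (auto intro: less_imp_le)
  have "(\<Sum>(j, \<nu>)\<in>PP2 Y. l j) = (\<Sum>j<J (Y / 2). \<Sum>\<nu>\<in>{2..nat \<lfloor>Y / l j\<rfloor>}. l j)"
    unfolding PP2_def by (subst sum.Sigma) auto
  also have "\<dots> \<le> (\<Sum>j<J (Y / 2). Y)"
  proof (rule sum_mono)
    fix j
    have "real (card {2..nat \<lfloor>Y / l j\<rfloor>}) \<le> Y / l j"
      using Y divide_nonneg_pos[OF Y l_pos[of j]] of_int_floor_le[of "Y / l j"]
      by (auto simp: of_nat_diff) linarith
    then show "(\<Sum>\<nu>\<in>{2..nat \<lfloor>Y / l j\<rfloor>}. l j) \<le> Y"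
      using l_pos[of j] by (simp add: pos_le_divide_eq)
  qed
  also have "\<dots> = real (J (Y / 2)) * Y" by simp
  also have "\<dots> \<le> exp (Y / 2) * (4 * exp (Y / 4))"
    using Y by (intro mult_mono J_le times_exp_le) auto
  also have "\<dots> = 4 * exp (3/4 * Y)" by (simp flip: exp_add)
  finally have pp2: "(\<Sum>(j, \<nu>)\<in>PP2 Y. l j) \<le> 4 * exp (3/4 * Y)" .
  have "1 + 3/4 * Y \<le> exp (3/4 * Y)" by (rule exp_ge_add_one_self)
  then have Yle: "Y \<le> 4/3 * exp (3/4 * Y)" "1 \<le> exp (3/4 * Y)" using Y by linarith+
  have "\<bar>Psi Y - exp Y\<bar> \<le> (2 * Y + 6) + (1 + Y + 6 * C0 * exp (3/4 * Y)) + 4 * exp (3/4 * Y)"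
    using theta_bound[OF Y] integral_times_f_bound[OF Y] pp2 nn unfolding eq by linarith
  also have "\<dots> \<le> K_psi * exp (3/4 * Y)"
    using Yle unfolding K_psi_def ring_distribs by linarith
  finally show ?thesis .
qed

lemma Lam_eq_count':
  assumes "finite A" "set_mset M \<subseteq> A" shows "Lam M = (\<Sum>j\<in>A. count M j * l j)"
  using assms(2)
proof (induction M)
  case (add x M)
  have "(\<Sum>j\<in>A. count (add_mset x M) j * l j) = (\<Sum>j\<in>A. count M j * l j + (if j = x then l j else 0))"
    by (intro sum.cong) (auto simp: algebra_simps)
  also have "\<dots> = Lam M + l x"
    using add assms(1) by (simp add: sum.distrib)
  finally show ?case by (simp add: Lam_def)
qed simp

lemma Lam_eq_count: "Lam M = (\<Sum>j\<in>set_mset M. count M j * l j)"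
  by (rule Lam_eq_count') auto

lemma count_times_l_le: "count M j * l j \<le> Lam M"
proof -
  have "M = replicate_mset (count M j) j + filter_mset (\<lambda>i. i \<noteq> j) M"
    by (auto simp: multiset_eq_iff)
  then have "Lam M = count M j * l j + Lam (filter_mset (\<lambda>i. i \<noteq> j) M)"
    by (metis Lam_add Lam_replicate)
  then show ?thesis using Lam_nonneg[of "filter_mset (\<lambda>i. i \<noteq> j) M"] by linarith
qed

text \<open>The logarithm of an integer is the sum of log p over the prime powers dividing it. All
  integers in \<open>Ints L\<close> share the index set \<open>PP L\<close>, which makes the sums
  exchangeable.\<close>

lemma Lam_eq_sum_PP:
  assumes "M \<in> Ints L"
  shows "Lam M = (\<Sum>(j, \<nu>)\<in>PP L. if \<nu> \<le> count M j then l j else 0)"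
proof -
  have *: "{p \<in> PP L. case p of (j, \<nu>) \<Rightarrow> \<nu> \<le> count M j} = Sigma (set_mset M) (\<lambda>j. {1..count M j})"
  proof -
    have "real \<nu> * l j \<le> L" if "\<nu> \<le> count M j" for j \<nu>
    proof -
      have "real \<nu> * l j \<le> count M j * l j" using that by (intro mult_right_mono) (auto intro: less_imp_le)
      also have "\<dots> \<le> L" using count_times_l_le[of M j] assms by (auto simp: Ints_def)
      finally show ?thesis .
    qed
    then show ?thesis by (auto simp: PP_def count_greater_zero_iff[symmetric] simp del: count_greater_zero_iff)
  qed
  have "(\<Sum>(j, \<nu>)\<in>PP L. if \<nu> \<le> count M j then l j else 0) =
      (\<Sum>p\<in>PP L. if (case p of (j, \<nu>) \<Rightarrow> \<nu> \<le> count M j) then l (fst p) else 0)"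
    by (intro sum.cong) (auto split: prod.splits)
  also have "\<dots> = (\<Sum>p\<in>Sigma (set_mset M) (\<lambda>j. {1..count M j}). l (fst p))"
    unfolding *[symmetric] by (simp add: sum.inter_filter)
  also have "\<dots> = (\<Sum>j\<in>set_mset M. \<Sum>\<nu>\<in>{1..count M j}. l j)"
    by (subst sum.Sigma) (auto simp: case_prod_unfold)
  also have "\<dots> = Lam M" by (simp add: Lam_eq_count)
  finally show ?thesis ..
qed

text \<open>Division by the \<nu>-th power of the \<open>j\<close>-th prime.\<close>

lemma card_Ints_count:
  "card {M \<in> Ints L. \<nu> \<le> count M j} = card {M \<in> Ints L. \<nu> * l j \<le> L - Lam M}"
proof -
  have "bij_betw (\<lambda>M. M + replicate_mset \<nu> j) {M \<in> Ints L. \<nu> * l j \<le> L - Lam M} {M \<in> Ints L. \<nu> \<le> count M j}"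
  proof (rule bij_betwI[where g = "\<lambda>M. M - replicate_mset \<nu> j"])
    show "(\<lambda>M. M - replicate_mset \<nu> j) \<in> {M \<in> Ints L. \<nu> \<le> count M j} \<rightarrow> {M \<in> Ints L. \<nu> * l j \<le> L - Lam M}"
    proof
      fix M assume M: "M \<in> {M \<in> Ints L. \<nu> \<le> count M j}"
      then have "M = (M - replicate_mset \<nu> j) + replicate_mset \<nu> j"
        by (auto simp: multiset_eq_iff)
      then have eq: "Lam M = Lam (M - replicate_mset \<nu> j) + \<nu> * l j"
        by (metis Lam_add Lam_replicate)
      have "0 \<le> \<nu> * l j" by (rule mult_l_nonneg)
      then show "M - replicate_mset \<nu> j \<in> {M \<in> Ints L. \<nu> * l j \<le> L - Lam M}"
        using M eq by (auto simp: Ints_def)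
    qed
  qed (auto simp: Ints_def multiset_eq_iff)
  then show ?thesis by (rule bij_betw_same_card[symmetric])
qed

text \<open>Chebyshev's identity: the sum of log n over n up to x equals the sum of psi(x/n). Since
  integers are multisets of prime indices, coinciding values do no harm.\<close>

lemma sum_Lam_eq: "(\<Sum>M\<in>Ints L. Lam M) = (\<Sum>M\<in>Ints L. Psi (L - Lam M))"
proof -
  have "(\<Sum>M\<in>Ints L. Lam M) = (\<Sum>M\<in>Ints L. \<Sum>(j, \<nu>)\<in>PP L. if \<nu> \<le> count M j then l j else 0)"
    by (intro sum.cong Lam_eq_sum_PP) auto
  also have "\<dots> = (\<Sum>(j, \<nu>)\<in>PP L. \<Sum>M\<in>Ints L. if \<nu> \<le> count M j then l j else 0)"
    by (subst sum.swap) (simp add: case_prod_unfold)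
  also have "\<dots> = (\<Sum>(j, \<nu>)\<in>PP L. \<Sum>M\<in>Ints L. if \<nu> * l j \<le> L - Lam M then l j else 0)"
    by (intro sum.cong refl) (auto simp: sum.inter_filter[symmetric] card_Ints_count)
  also have "\<dots> = (\<Sum>M\<in>Ints L. \<Sum>(j, \<nu>)\<in>PP L. if \<nu> * l j \<le> L - Lam M then l j else 0)"
    by (subst sum.swap) (simp add: case_prod_unfold)
  also have "\<dots> = (\<Sum>M\<in>Ints L. Psi (L - Lam M))"
  proof (intro sum.cong refl)
    fix M
    have "{p \<in> PP L. case p of (j, \<nu>) \<Rightarrow> \<nu> * l j \<le> L - Lam M} = PP (L - Lam M)"
      unfolding PP_def using Lam_nonneg[of M] by (auto; linarith)
    then have "Psi (L - Lam M) = (\<Sum>p\<in>PP L. if (case p of (j, \<nu>) \<Rightarrow> \<nu> * l j \<le> L - Lam M) then l (fst p) else 0)"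
      unfolding Psi_def by (simp add: sum.inter_filter[symmetric] case_prod_unfold)
    then show "(\<Sum>(j, \<nu>)\<in>PP L. if \<nu> * l j \<le> L - Lam M then l j else 0) = Psi (L - Lam M)"
      by (simp add: case_prod_unfold)
  qed
  finally show ?thesis .
qed

end

section \<open>Existence of the density\<close>

context beurling_sample begin

lemma Nc_has_integral:
  fixes h :: "real \<Rightarrow> 'a::euclidean_space"
  assumes "continuous_on {0..X} h"
  shows "((\<lambda>v. Nc v *\<^sub>R h v) has_integral (\<Sum>M\<in>Ints X. integral {Lam M..X} h)) {0..X}"
proof -
  have "((\<lambda>v. \<Sum>M\<in>Ints X. if v \<in> {Lam M..X} then h v else 0) has_integral
      (\<Sum>M\<in>Ints X. integral {Lam M..X} h)) {0..X}"
  proof (rule has_integral_sum)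
    fix M assume "M \<in> Ints X"
    then have sub: "{Lam M..X} \<subseteq> {0..X}" by auto
    then have "(h has_integral integral {Lam M..X} h) {Lam M..X}"
      using assms by (intro integrable_integral integrable_continuous_interval continuous_on_subset[OF assms])
    then show "((\<lambda>v. if v \<in> {Lam M..X} then h v else 0) has_integral integral {Lam M..X} h) {0..X}"
      unfolding has_integral_restrict[OF sub] .
  qed simp
  then show ?thesis
  proof (rule has_integral_eq[rotated])
    fix v assume v: "v \<in> {0..X}"
    then have "{M \<in> Ints X. v \<in> {Lam M..X}} = Ints v" by (auto simp: Ints_def)
    then show "(\<Sum>M\<in>Ints X. if v \<in> {Lam M..X} then h v else 0) = Nc v *\<^sub>R h v"
      by (simp add: sum.inter_filter[symmetric] Nc_def sum_constant_scaleR)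
  qed
qed

definition a :: "real \<Rightarrow> real" where "a L = Nc L * exp (- L)"
definition S :: "real \<Rightarrow> real" where "S L = (\<Sum>M\<in>Ints L. exp (- Lam M))"
text \<open>\<open>S L\<close> is the sum of 1/n over integers up to x = \<open>exp L\<close>; here
  each term is damped by the factor x/n to the power -1/4, the relative error that the exponent 3/4
  of \<open>Psi_bound\<close> leaves for psi(x/n).\<close>

definition W :: "real \<Rightarrow> real" where "W L = (\<Sum>M\<in>Ints L. exp (- Lam M) * exp (- (L - Lam M) / 4))"

lemma a_nonneg: "0 \<le> a L"
  by (simp add: a_def Nc_def)

lemma W_le_S: "W L \<le> S L"
  unfolding W_def S_def by (intro sum_mono) (auto simp: Ints_def mult_left_le)

text \<open>\<open>L * Nc L\<close> is the sum of \<open>(L - Lam M) + Psi (L - Lam M)\<close> by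
  Chebyshev's identity. Inserting \<open>exp (L - Lam M)\<close> for \<open>Psi\<close> yields
  \<open>exp L * S L\<close>.\<close>

lemma L_a_minus_S: "\<bar>L * a L - S L\<bar> \<le> (K_psi + 2) * W L"
proof -
  have "L * Nc L = (\<Sum>M\<in>Ints L. L - Lam M) + (\<Sum>M\<in>Ints L. Lam M)"
    by (simp add: Nc_def sum_subtractf)
  also have "\<dots> = (\<Sum>M\<in>Ints L. (L - Lam M) + Psi (L - Lam M))"
    unfolding sum_Lam_eq by (simp add: sum.distrib)
  finally have eq: "L * a L - S L = (\<Sum>M\<in>Ints L. ((L - Lam M) + Psi (L - Lam M)) * exp (- L) - exp (- Lam M))"
    unfolding a_def S_def by (simp add: mult.assoc[symmetric] sum_distrib_right sum_subtractf)
  have "\<bar>L * a L - S L\<bar> \<le> (\<Sum>M\<in>Ints L. \<bar>((L - Lam M) + Psi (L - Lam M)) * exp (- L) - exp (- Lam M)\<bar>)"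
    unfolding eq by (rule sum_abs)
  also have "\<dots> \<le> (\<Sum>M\<in>Ints L. (K_psi + 2) * (exp (- Lam M) * exp (- (L - Lam M) / 4)))"
  proof (rule sum_mono)
    fix M assume "M \<in> Ints L"
    define Y where "Y = L - Lam M"
    have Y: "0 \<le> Y" using \<open>M \<in> Ints L\<close> by (simp add: Y_def Ints_def)
    have "1 + 3/4 * Y \<le> exp (3/4 * Y)" by (rule exp_ge_add_one_self)
    then have "\<bar>(Y + Psi Y) - exp Y\<bar> \<le> (K_psi + 2) * exp (3/4 * Y)"
      using Psi_bound[OF Y] Y unfolding ring_distribs by linarith
    then have "exp (- L) * \<bar>(Y + Psi Y) - exp Y\<bar> \<le> exp (- L) * ((K_psi + 2) * exp (3/4 * Y))"
      by (intro mult_left_mono) auto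
    moreover have "\<bar>(Y + Psi Y) * exp (- L) - exp (- Lam M)\<bar> = exp (- L) * \<bar>(Y + Psi Y) - exp Y\<bar>"
    proof -
      have "exp (- Lam M) = exp (- L) * exp Y" by (simp add: Y_def flip: exp_add)
      then have "(Y + Psi Y) * exp (- L) - exp (- Lam M) = exp (- L) * ((Y + Psi Y) - exp Y)"
        by (simp add: algebra_simps)
      then show ?thesis by (simp add: abs_mult)
    qed
    moreover have "exp (- L) * ((K_psi + 2) * exp (3/4 * Y)) = (K_psi + 2) * (exp (- Lam M) * exp (- (L - Lam M) / 4))"
    proof -
      have "exp (- L) * exp (3/4 * Y) = exp (- Lam M) * exp (- (L - Lam M) / 4)"
        unfolding exp_add[symmetric] Y_def by (simp add: field_simps)
      then show ?thesis by (simp add: algebra_simps)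
    qed
    ultimately show "\<bar>((L - Lam M) + Psi (L - Lam M)) * exp (- L) - exp (- Lam M)\<bar> \<le>
        (K_psi + 2) * (exp (- Lam M) * exp (- (L - Lam M) / 4))"
      unfolding Y_def by linarith
  qed
  also have "\<dots> = (K_psi + 2) * W L" by (simp add: W_def sum_distrib_left)
  finally show ?thesis .
qed

lemma S_le_zeta:
  assumes "0 < \<eta>"
  shows "(\<Sum>M\<in>Ints L. exp (- (1 + \<eta>) * Lam M)) \<le> norm (zeta (of_real (1 + \<eta>)))"
proof -
  have *: "exp (- of_real (1 + \<eta>) * of_real (Lam M)) = (of_real (exp (- (1 + \<eta>) * Lam M)) :: complex)" for M
    by (simp add: exp_of_real[symmetric])
  have "((\<lambda>M. exp (- (1 + \<eta>) * Lam M)) has_sum Re (zeta (of_real (1 + \<eta>)))) UNIV"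
    using has_sum_Re[OF zeta_has_sum[of "of_real (1 + \<eta>)"]] assms unfolding * by simp
  then have "(\<Sum>M\<in>Ints L. exp (- (1 + \<eta>) * Lam M)) \<le> Re (zeta (of_real (1 + \<eta>)))"
    by (intro has_sum_mono2[OF has_sum_finite]) auto
  then show ?thesis using complex_Re_le_cmod order_trans by blast
qed

text \<open>Passing to the exponent \<open>1 + 1 / L\<close> costs a factor \<open>exp 1\<close>,
  and the simple pole of \<open>zeta\<close> at 1 then gives the order \<open>L\<close>.\<close>

lemma S_bound: "\<exists>K>0. \<forall>L\<ge>1. S L \<le> K * L"
proof -
  have "compact (Z ` of_real ` {1..2})"
    by (intro compact_continuous_image holomorphic_on_imp_continuous_on holomorphic_on_subset[OF Z_holomorphic] continuous_intros) auto
  then have "bounded (Z ` of_real ` {1..2})" by (rule compact_imp_bounded)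
  then obtain B where B: "B > 0" "\<And>x. x \<in> {1..2::real} \<Longrightarrow> norm (Z (of_real x)) \<le> B"
    by (auto simp: bounded_pos)
  have "S L \<le> (exp 1 * B * 2) * L" if L: "L \<ge> 1" for L
  proof -
    have "S L \<le> (\<Sum>M\<in>Ints L. exp 1 * exp (- (1 + 1 / L) * Lam M))"
      unfolding S_def
    proof (rule sum_mono)
      fix M assume "M \<in> Ints L"
      then have "Lam M / L \<le> 1" using L by (simp add: Ints_def)
      then show "exp (- Lam M) \<le> exp 1 * exp (- (1 + 1 / L) * Lam M)"
        unfolding exp_add[symmetric] by (simp add: algebra_simps)
    qed
    also have "\<dots> \<le> exp 1 * norm (zeta (of_real (1 + 1 / L)))"
      unfolding sum_distrib_left[symmetric] using L by (intro mult_left_mono S_le_zeta) auto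
    also have "zeta (of_real (1 + 1 / L)) = Z (of_real (1 + 1 / L)) * of_real ((1 + 1 / L) * L)"
      using L by (simp add: zeta_def)
    also have "norm \<dots> = norm (Z (of_real (1 + 1 / L))) * ((1 + 1 / L) * L)"
      unfolding norm_mult norm_of_real using L by (simp add: abs_mult)
    also have "\<dots> \<le> B * (2 * L)"
      using L less_imp_le[OF B(1)] by (intro mult_mono B(2) mult_right_mono) (auto simp: field_simps)
    finally show ?thesis by (simp add: algebra_simps)
  qed
  then show ?thesis using B by (intro exI[of _ "exp 1 * B * 2"]) auto
qed

text \<open>The crude bound \<open>W L \<le> S L\<close> makes \<open>L * a L\<close> at most a
  multiple of \<open>S L\<close>, hence of \<open>L\<close>.\<close>

lemma a_bounded: "\<exists>K>0. \<forall>L. a L \<le> K"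
proof -
  obtain K where K: "K > 0" "\<And>L. 1 \<le> L \<Longrightarrow> S L \<le> K * L" using S_bound by blast
  have K_psi: "0 \<le> K_psi" using C0_nonneg by (simp add: K_psi_def)
  have "a L \<le> Nc 1 + (K_psi + 3) * K" for L
  proof (cases "1 \<le> L")
    case True
    have "L * a L \<le> S L + (K_psi + 2) * W L" using L_a_minus_S[of L] by linarith
    also have "\<dots> \<le> S L + (K_psi + 2) * S L" using K_psi by (intro add_left_mono mult_left_mono W_le_S) auto
    also have "\<dots> = (K_psi + 3) * S L" by (simp add: algebra_simps)
    also have "\<dots> \<le> (K_psi + 3) * (K * L)" using K_psi True by (intro mult_left_mono K) auto
    finally have "L * a L \<le> L * ((K_psi + 3) * K)" by (simp add: algebra_simps)
    then have "a L \<le> (K_psi + 3) * K" using True by simp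
    then show ?thesis by (simp add: Nc_def)
  next
    case False
    have "a L \<le> Nc 1"
    proof (cases "L < 0")
      case True
      then show ?thesis by (simp add: a_def Nc_def Nc_neg)
    next
      case L: False
      have "a L \<le> Nc L * 1" unfolding a_def using L by (intro mult_left_mono) (auto simp: Nc_def)
      then show ?thesis using Nc_mono[of L 1] False by simp
    qed
    then show ?thesis using K_psi K by (simp add: add_increasing2)
  qed
  moreover have "0 < Nc 1 + (K_psi + 3) * K" using K_psi K(1) by (intro add_nonneg_pos) (auto simp: Nc_def)
  ultimately show ?thesis by blast
qed

text \<open>With \<open>a\<close> bounded, so that \<open>Nc v\<close> is at most a multiple of
  \<open>exp v\<close>, partial summation improves the estimate of \<open>W\<close> from the order
  \<open>L\<close>, which \<open>W_le_S\<close> gives, to a constant.\<close>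

lemma W_bounded: "\<exists>K>0. \<forall>L\<ge>0. W L \<le> K"
proof -
  obtain K where K: "K > 0" "\<And>L. a L \<le> K" using a_bounded by blast
  have "W L \<le> 4 * K" if L: "L \<ge> 0" for L
  proof -
    have N: "Nc v \<le> K * exp v" for v
      using K(2)[of v] by (simp add: a_def exp_minus field_simps)
    have 1: "((\<lambda>v. Nc v *\<^sub>R (3/4 * exp (3/4 * (L - v)))) has_integral
        (\<Sum>M\<in>Ints L. integral {Lam M..L} (\<lambda>v. 3/4 * exp (3/4 * (L - v))))) {0..L}"
      by (intro Nc_has_integral continuous_intros)
    have int: "integral {c..L} (\<lambda>v. 3/4 * exp (3/4 * (L - v))) = exp (3/4 * (L - c)) - 1" if "c \<le> L" for c
    proof -
      have "((\<lambda>v. 3/4 * exp (3/4 * (L - v))) has_integral - exp (3/4 * (L - L)) - - exp (3/4 * (L - c))) {c..L}"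
        using that by (intro fundamental_theorem_of_calculus)
          (auto intro!: derivative_eq_intros simp flip: has_real_derivative_iff_has_vector_derivative)
      from integral_unique[OF this] show ?thesis by simp
    qed
    have 2: "((\<lambda>v. K * exp v * (3/4 * exp (3/4 * (L - v)))) has_integral 3 * K * exp L - 3 * K * exp (3/4 * L)) {0..L}"
    proof -
      have "((\<lambda>v. 3/4 * K * exp (3/4 * L) * exp (v / 4)) has_integral
          3 * K * exp (3/4 * L) * exp (L / 4) - 3 * K * exp (3/4 * L) * exp (0 / 4)) {0..L}"
        using L by (intro fundamental_theorem_of_calculus[of 0 L "\<lambda>v. 3 * K * exp (3/4 * L) * exp (v / 4)"])
          (auto intro!: derivative_eq_intros simp flip: has_real_derivative_iff_has_vector_derivative)
      moreover have "3 * K * exp (3/4 * L) * exp (L / 4) = 3 * K * exp L"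
        unfolding mult.assoc exp_add[symmetric] by simp
      moreover have "K * exp v * (3/4 * exp (3/4 * (L - v))) = 3/4 * K * exp (3/4 * L) * exp (v / 4)" for v
      proof -
        have "exp v * exp (3/4 * (L - v)) = exp (3/4 * L) * exp (v / 4)"
          unfolding exp_add[symmetric] by (simp add: field_simps)
        then have "3/4 * K * (exp v * exp (3/4 * (L - v))) = 3/4 * K * (exp (3/4 * L) * exp (v / 4))"
          by (simp only:)
        then show ?thesis by (simp only: mult_ac)
      qed
      ultimately show ?thesis by (simp only: div_0 exp_zero mult_1_right)
    qed
    have "(\<Sum>M\<in>Ints L. exp (3/4 * (L - Lam M))) - Nc L =
        (\<Sum>M\<in>Ints L. integral {Lam M..L} (\<lambda>v. 3/4 * exp (3/4 * (L - v))))"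
    proof -
      have "(\<Sum>M\<in>Ints L. integral {Lam M..L} (\<lambda>v. 3/4 * exp (3/4 * (L - v)))) =
          (\<Sum>M\<in>Ints L. exp (3/4 * (L - Lam M)) - 1)"
        by (intro sum.cong refl int) (auto simp: Ints_def)
      then show ?thesis by (simp only: sum_subtractf) (simp add: Nc_def)
    qed
    also have "\<dots> \<le> 3 * K * exp L - 3 * K * exp (3/4 * L)"
      using 1 2 by (rule has_integral_le) (auto intro!: mult_right_mono N)
    also have "\<dots> \<le> 3 * K * exp L" using K(1) by simp
    finally have "(\<Sum>M\<in>Ints L. exp (3/4 * (L - Lam M))) \<le> 4 * K * exp L" using N[of L] by linarith
    then have "exp (- L) * (\<Sum>M\<in>Ints L. exp (3/4 * (L - Lam M))) \<le> exp (- L) * (4 * K * exp L)"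
      by (intro mult_left_mono) auto
    also have "exp (- L) * (4 * K * exp L) = 4 * K" by (simp add: exp_minus field_simps)
    also have "exp (- L) * (\<Sum>M\<in>Ints L. exp (3/4 * (L - Lam M))) = W L"
      unfolding W_def sum_distrib_left exp_add[symmetric] by (intro sum.cong) (auto simp: field_simps)
    finally show ?thesis .
  qed
  then show ?thesis using K by (intro exI[of _ "4 * K"]) auto
qed

text \<open>\<open>S\<close> has jumps; subtracting \<open>a\<close> removes them. By partial
  summation \<open>U\<close> is the primitive of \<open>a\<close> that vanishes at 0, and it
  satisfies \<open>L * a L = U L\<close> up to a constant, a differential equation for
  \<open>U\<close>.\<close>

definition U :: "real \<Rightarrow> real" where "U L = S L - a L"

lemma L_a_minus_U: "\<exists>K>0. \<forall>L\<ge>0. \<bar>L * a L - U L\<bar> \<le> K"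
proof -
  obtain K where K: "K > 0" "\<And>L. a L \<le> K" using a_bounded by blast
  obtain K' where K': "K' > 0" "\<And>L. 0 \<le> L \<Longrightarrow> W L \<le> K'" using W_bounded by blast
  have K_psi: "0 \<le> K_psi" using C0_nonneg by (simp add: K_psi_def)
  have "\<bar>L * a L - U L\<bar> \<le> (K_psi + 2) * K' + K" if "0 \<le> L" for L
  proof -
    have "(K_psi + 2) * W L \<le> (K_psi + 2) * K'" using K_psi that by (intro mult_left_mono K') auto
    then show ?thesis using L_a_minus_S[of L] K(2)[of L] a_nonneg[of L] unfolding U_def by linarith
  qed
  then show ?thesis using K_psi K K' by (intro exI[of _ "(K_psi + 2) * K' + K"]) (auto intro!: add_nonneg_pos mult_nonneg_nonneg)
qed

lemma U_eq_max:
  assumes "L \<le> X" shows "U L = (\<Sum>M\<in>Ints X. max 0 (exp (- Lam M) - exp (- L)))"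
proof -
  have "U L = (\<Sum>M\<in>Ints L. exp (- Lam M) - exp (- L))"
    by (simp add: U_def S_def a_def Nc_def sum_subtractf)
  also have "\<dots> = (\<Sum>M\<in>Ints L. max 0 (exp (- Lam M) - exp (- L)))"
    by (intro sum.cong) (auto simp: Ints_def max_def)
  also have "\<dots> = (\<Sum>M\<in>Ints X. max 0 (exp (- Lam M) - exp (- L)))"
    by (intro sum.mono_neutral_left finite_Ints Ints_mono[OF assms]) (auto simp: Ints_def)
  finally show ?thesis .
qed

lemma U_has_derivative:
  assumes "x < X" "x \<notin> Lam ` Ints X"
  shows "(U has_real_derivative a x) (at x)"
proof -
  have d: "((\<lambda>L. max 0 (exp (- Lam M) - exp (- L))) has_real_derivative (if Lam M \<le> x then exp (- x) else 0)) (at x)"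
    if M: "M \<in> Ints X" for M
  proof (cases "Lam M < x")
    case True
    have "((\<lambda>L. exp (- Lam M) - exp (- L)) has_real_derivative exp (- x)) (at x)"
      by (auto intro!: derivative_eq_intros)
    then have "((\<lambda>L. max 0 (exp (- Lam M) - exp (- L))) has_real_derivative exp (- x)) (at x)"
      by (rule DERIV_cong_ev[THEN iffD1, rotated -1])
        (use True eventually_gt_at_top in \<open>auto intro!: eventually_mono[OF eventually_nhds_in_open[of "{Lam M<..}" x]]\<close>)
    then show ?thesis using True by simp
  next
    case False
    then have lt: "x < Lam M" using assms(2) M by (metis image_eqI linorder_neqE_linordered_idom)
    have "((\<lambda>L. 0) has_real_derivative 0) (at x)" by simp
    then have "((\<lambda>L. max 0 (exp (- Lam M) - exp (- L))) has_real_derivative 0) (at x)"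
      by (rule DERIV_cong_ev[THEN iffD1, rotated -1])
        (use lt in \<open>auto intro!: eventually_mono[OF eventually_nhds_in_open[of "{..<Lam M}" x]]\<close>)
    then show ?thesis using lt by simp
  qed
  have "((\<lambda>L. \<Sum>M\<in>Ints X. max 0 (exp (- Lam M) - exp (- L))) has_real_derivative
      (\<Sum>M\<in>Ints X. if Lam M \<le> x then exp (- x) else 0)) (at x)"
    by (intro DERIV_sum d)
  moreover have "{M \<in> Ints X. Lam M \<le> x} = Ints x" using assms(1) by (auto simp: Ints_def)
  then have "(\<Sum>M\<in>Ints X. if Lam M \<le> x then exp (- x) else 0) = a x"
    by (simp add: sum.inter_filter[symmetric] a_def Nc_def)
  ultimately have "((\<lambda>L. \<Sum>M\<in>Ints X. max 0 (exp (- Lam M) - exp (- L))) has_real_derivative a x) (at x)" by simp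
  then show ?thesis
    by (rule DERIV_cong_ev[THEN iffD1, rotated -1])
      (use assms in \<open>auto intro!: eventually_mono[OF eventually_nhds_in_open[of "{..<X}" x]] U_eq_max[symmetric]\<close>)
qed

text \<open>Outside the finitely many jump points the derivative of \<open>U v / v\<close> is
  \<open>(v * a v - U v) / v^2\<close>, which is of order \<open>1 / v^2\<close>.\<close>

lemma U_div_diff_bound: "\<exists>K>0. \<forall>L1 L2. 1 \<le> L1 \<longrightarrow> L1 \<le> L2 \<longrightarrow> \<bar>U L2 / L2 - U L1 / L1\<bar> \<le> K / L1"
proof -
  obtain K where K: "K > 0" "\<And>L. 0 \<le> L \<Longrightarrow> \<bar>L * a L - U L\<bar> \<le> K" using L_a_minus_U by blast
  have "\<bar>U L2 / L2 - U L1 / L1\<bar> \<le> K / L1" if L: "1 \<le> L1" "L1 \<le> L2" for L1 L2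
  proof -
    have cont: "continuous_on {L1..L2} (\<lambda>v. U v / v)"
    proof -
      have "continuous_on {L1..L2} U"
        by (subst continuous_on_cong[OF refl U_eq_max[of _ L2]]) (auto intro!: continuous_intros)
      then show ?thesis using L by (intro continuous_intros) auto
    qed
    have 1: "((\<lambda>v. (a v * v - U v) / v\<^sup>2) has_integral U L2 / L2 - U L1 / L1) {L1..L2}"
    proof (rule fundamental_theorem_of_calculus_interior_strong[of "Lam ` Ints L2"])
      fix x assume x: "x \<in> {L1<..<L2} - Lam ` Ints L2"
      then have "(U has_real_derivative a x) (at x)" by (intro U_has_derivative) auto
      then have "((\<lambda>v. U v / v) has_real_derivative (a x * x - U x) / x\<^sup>2) (at x)"
        using x L by (auto intro!: derivative_eq_intros simp: power2_eq_square)
      then show "((\<lambda>v. U v / v) has_vector_derivative (a x * x - U x) / x\<^sup>2) (at x)"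
        by (simp add: has_real_derivative_iff_has_vector_derivative)
    qed (use L cont in auto)
    have 2: "((\<lambda>v. K / v\<^sup>2) has_integral (- (K / L2)) - (- (K / L1))) {L1..L2}"
      using L by (intro fundamental_theorem_of_calculus)
        (auto intro!: derivative_eq_intros simp: power2_eq_square simp flip: has_real_derivative_iff_has_vector_derivative)
    have "norm (integral {L1..L2} (\<lambda>v. (a v * v - U v) / v\<^sup>2)) \<le> integral {L1..L2} (\<lambda>v. K / v\<^sup>2)"
    proof (rule integral_norm_bound_integral)
      fix v assume v: "v \<in> {L1..L2}"
      have "\<bar>a v * v - U v\<bar> \<le> K" using K(2)[of v] v L by (simp add: mult.commute)
      then show "norm ((a v * v - U v) / v\<^sup>2) \<le> K / v\<^sup>2"
        by (simp add: abs_divide divide_right_mono)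
    qed (use 1 2 in auto)
    then have "\<bar>U L2 / L2 - U L1 / L1\<bar> \<le> K / L1 - K / L2"
      using integral_unique[OF 1] integral_unique[OF 2] by simp
    moreover have "0 \<le> K / L2" using K L by simp
    ultimately show ?thesis by linarith
  qed
  then show ?thesis using K by blast
qed

text \<open>\<open>U L / L\<close> is Cauchy and differs from \<open>a L\<close> by a multiple of
  \<open>1 / L\<close>. This elementary argument yields the existence of the density but not its
  value.\<close>

lemma a_convergent: "\<exists>r. (a \<longlongrightarrow> r) at_top"
proof -
  obtain K where K: "K > 0" "\<And>L1 L2. 1 \<le> L1 \<Longrightarrow> L1 \<le> L2 \<Longrightarrow> \<bar>U L2 / L2 - U L1 / L1\<bar> \<le> K / L1"
    using U_div_diff_bound by blast
  obtain K' where K': "K' > 0" "\<And>L. 0 \<le> L \<Longrightarrow> \<bar>L * a L - U L\<bar> \<le> K'" using L_a_minus_U by blast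
  define G where "G L = U L / L" for L
  have "Cauchy (\<lambda>n. G (real (Suc n)))"
  proof (rule CauchyI')
    fix e :: real assume e: "e > 0"
    obtain n0 :: nat where n0: "K / e < real n0" using reals_Archimedean2 by blast
    show "\<exists>M. \<forall>m\<ge>M. \<forall>n>m. dist (G (real (Suc m))) (G (real (Suc n))) < e"
    proof (intro exI[of _ n0] allI impI)
      fix m n assume mn: "n0 \<le> m" "m < n"
      have "\<bar>G (real (Suc n)) - G (real (Suc m))\<bar> \<le> K / real (Suc m)"
        unfolding G_def using mn by (intro K) auto
      moreover have "K < e * real (Suc m)" using n0 mn(1) e by (simp add: divide_less_eq mult.commute) 
        (smt (verit, best) mult_left_mono of_nat_le_iff)
      then have "K / real (Suc m) < e" by (simp add: divide_less_eq)
      ultimately show "dist (G (real (Suc m))) (G (real (Suc n))) < e" by (simp add: dist_real_def abs_minus_commute)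
    qed
  qed
  then obtain g where g: "(\<lambda>n. G (real (Suc n))) \<longlonglongrightarrow> g"
    using real_Cauchy_convergent convergent_def by blast
  have Gg: "\<bar>g - G L\<bar> \<le> K / L" if L: "L \<ge> 1" for L
  proof (rule tendsto_upperbound)
    show "(\<lambda>n. \<bar>G (real (Suc n)) - G L\<bar>) \<longlonglongrightarrow> \<bar>g - G L\<bar>"
      by (intro tendsto_intros g)
    show "\<forall>\<^sub>F n in sequentially. \<bar>G (real (Suc n)) - G L\<bar> \<le> K / L"
      using eventually_ge_at_top[of "nat \<lceil>L\<rceil>"]
    proof eventually_elim
      case (elim n)
      then show ?case unfolding G_def using L by (intro K) linarith+
    qed
  qed simp
  have "\<bar>a L - g\<bar> \<le> (K + K') / L" if L: "L \<ge> 1" for L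
  proof -
    have "\<bar>a L - G L\<bar> = \<bar>L * a L - U L\<bar> / L"
      using L by (simp add: G_def field_simps flip: abs_divide[of _ L, simplified])
    also have "\<dots> \<le> K' / L" using K'(2)[of L] L by (simp add: divide_right_mono)
    finally show ?thesis using Gg[OF L] by (simp add: add_divide_distrib)
  qed
  then have "\<forall>\<^sub>F L in at_top. norm (a L - g) \<le> (K + K') / L"
    by (intro eventually_at_top_linorderI[of 1]) simp
  moreover have "((\<lambda>L. (K + K') / L) \<longlongrightarrow> 0) at_top" by real_asymp
  ultimately have "((\<lambda>L. a L - g) \<longlongrightarrow> 0) at_top" by (rule Lim_null_comparison)
  then show ?thesis using LIM_zero_iff by blast
qed

end

section \<open>Identification of the density\<close>

context beurling_sample begin

lemma laplace_a:
  assumes s: "Re s > 1"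
  shows "((\<lambda>X. integral {0..X} (\<lambda>v. of_real (a v) * exp (- (s - 1) * of_real v))) \<longlongrightarrow> zeta s / s) at_top"
proof -
  have s0: "s \<noteq> 0" using s by auto
  obtain K where K: "K > 0" "\<And>L. a L \<le> K" using a_bounded by blast
  have eq: "integral {0..X} (\<lambda>v. of_real (a v) * exp (- (s - 1) * of_real v)) =
      (\<Sum>M\<in>Ints X. exp (- s * of_real (Lam M))) / s - of_real (a X) * exp (- (s - 1) * of_real X) / s" for X
  proof -
    have e: "of_real (a v) * exp (- (s - 1) * of_real v) = Nc v *\<^sub>R exp (- s * of_real v)" for v
      by (simp add: a_def scaleR_conv_of_real mult.assoc exp_of_real[symmetric] exp_add[symmetric] algebra_simps)
    have int: "integral {c..X} (\<lambda>v. exp (- s * of_real v)) = exp (- s * of_real c) / s - exp (- s * of_real X) / s"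
      if "c \<le> X" for c
    proof -
      have "((\<lambda>v. exp (- s * of_real v)) has_integral (- exp (- s * of_real X) / s) - (- exp (- s * of_real c) / s)) {c..X}"
        using s0 that by (intro fundamental_theorem_of_calculus)
          (auto intro!: derivative_eq_intros has_vector_derivative_real_field)
      from integral_unique[OF this] show ?thesis by simp
    qed
    have "integral {0..X} (\<lambda>v. Nc v *\<^sub>R exp (- s * of_real v)) =
        (\<Sum>M\<in>Ints X. integral {Lam M..X} (\<lambda>v. exp (- s * of_real v)))"
      by (intro integral_unique Nc_has_integral continuous_intros)
    also have "\<dots> = (\<Sum>M\<in>Ints X. exp (- s * of_real (Lam M)) / s - exp (- s * of_real X) / s)"
      by (intro sum.cong refl int) (auto simp: Ints_def)
    also have "\<dots> = (\<Sum>M\<in>Ints X. exp (- s * of_real (Lam M))) / s - of_real (a X) * exp (- (s - 1) * of_real X) / s"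
      unfolding e by (simp add: sum_subtractf sum_divide_distrib Nc_def scaleR_conv_of_real)
    finally show ?thesis unfolding e .
  qed
  have "((\<lambda>X. of_real (a X) * exp (- (s - 1) * of_real X)) \<longlongrightarrow> 0) at_top"
  proof (rule Lim_null_comparison)
    have "norm (of_real (a X) * exp (- (s - 1) * of_real X)) \<le> K * exp (- (Re s - 1) * X)" for X
      using K(2)[of X] a_nonneg[of X] by (simp add: norm_mult mult_right_mono)
    then show "\<forall>\<^sub>F X in at_top. norm (of_real (a X) * exp (- (s - 1) * of_real X)) \<le> K * exp (- (Re s - 1) * X)"
      by simp
    show "((\<lambda>X. K * exp (- (Re s - 1) * X)) \<longlongrightarrow> 0) at_top" using s by real_asymp
  qed
  then have "((\<lambda>X. (\<Sum>M\<in>Ints X. exp (- s * of_real (Lam M))) / s -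
      of_real (a X) * exp (- (s - 1) * of_real X) / s) \<longlongrightarrow> zeta s / s - 0 / s) at_top"
    using s0 by (intro tendsto_intros sum_Ints_tendsto s) auto
  then show ?thesis unfolding eq by simp
qed

lemma a_integrable: "(\<lambda>v. a v * exp (- \<eta> * v)) integrable_on {0..X}"
proof -
  have "(\<lambda>v. Nc v *\<^sub>R exp (- (1 + \<eta>) * v)) integrable_on {0..X}"
    by (rule has_integral_integrable, rule Nc_has_integral) (intro continuous_intros)
  then show ?thesis by (simp add: a_def exp_add[symmetric] mult.assoc algebra_simps)
qed

text \<open>Abelian estimate: \<open>a - r\<close> is bounded by \<open>B\<close> up to
  \<open>L0\<close> and by \<open>e\<close> afterwards, and the Laplace transform of the constant
  \<open>r\<close> is \<open>r / \<eta>\<close>.\<close>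

lemma laplace_diff_bound:
  assumes r: "\<And>L. 0 \<le> L \<Longrightarrow> \<bar>a L - r\<bar> \<le> B" "\<And>L. L0 \<le> L \<Longrightarrow> \<bar>a L - r\<bar> \<le> e"
    and \<eta>: "0 < \<eta>" and L0: "0 \<le> L0" and e: "0 \<le> e"
  shows "norm (zeta (of_real (1 + \<eta>)) / of_real (1 + \<eta>) - of_real (r / \<eta>)) \<le> B * L0 + e / \<eta>"
proof -
  define I where "I X = integral {0..X} (\<lambda>v. a v * exp (- \<eta> * v))" for X
  have B: "0 \<le> B" using r(1)[of 0] by simp
  have exp_int: "((\<lambda>v. c * exp (- \<eta> * v)) has_integral c * (1 - exp (- \<eta> * X)) / \<eta>) {0..X}" if "0 \<le> X" for X c
  proof -
    have "((\<lambda>v. c * exp (- \<eta> * v)) has_integral (- c * exp (- \<eta> * X) / \<eta>) - (- c * exp (- \<eta> * 0) / \<eta>)) {0..X}"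
      using \<eta> that by (intro fundamental_theorem_of_calculus[of 0 X "\<lambda>v. - c * exp (- \<eta> * v) / \<eta>"])
        (auto intro!: derivative_eq_intros simp flip: has_real_derivative_iff_has_vector_derivative)
    then show ?thesis by (simp add: right_diff_distrib diff_divide_distrib)
  qed
  have bound: "\<bar>I X - r * (1 - exp (- \<eta> * X)) / \<eta>\<bar> \<le> B * L0 + e / \<eta>" if X: "L0 \<le> X" for X
  proof -
    have X0: "0 \<le> X" using X L0 by simp
    have i1: "(\<lambda>v. a v * exp (- \<eta> * v) - r * exp (- \<eta> * v)) integrable_on {0..X}"
      using a_integrable exp_int[OF X0, of r] by (intro integrable_diff) auto
    have ind: "((\<lambda>v. if v \<in> {0..L0} then B else 0) has_integral B * L0) {0..X}"
      using has_integral_const_real[of B 0 L0] L0 X by (subst has_integral_restrict) (auto simp: mult.commute)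
    have "I X - r * (1 - exp (- \<eta> * X)) / \<eta> = integral {0..X} (\<lambda>v. a v * exp (- \<eta> * v) - r * exp (- \<eta> * v))"
      unfolding I_def using exp_int[OF X0, of r] a_integrable
      by (subst integral_diff) (auto simp: has_integral_iff)
    also have "norm \<dots> \<le> integral {0..X} (\<lambda>v. (if v \<in> {0..L0} then B else 0) + e * exp (- \<eta> * v))"
    proof (rule integral_norm_bound_integral[OF i1])
      show "(\<lambda>v. (if v \<in> {0..L0} then B else 0) + e * exp (- \<eta> * v)) integrable_on {0..X}"
        using ind exp_int[OF X0, of e] by (intro integrable_add) blast+
      fix v assume v: "v \<in> {0..X}"
      have "norm (a v * exp (- \<eta> * v) - r * exp (- \<eta> * v)) = \<bar>a v - r\<bar> * exp (- \<eta> * v)"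
        by (simp add: abs_mult flip: left_diff_distrib)
      also have "\<dots> \<le> (if v \<in> {0..L0} then B else 0) + e * exp (- \<eta> * v)"
      proof (cases "v \<in> {0..L0}")
        case True
        have "exp (- \<eta> * v) \<le> 1" using \<eta> v by simp
        then have "\<bar>a v - r\<bar> * exp (- \<eta> * v) \<le> B * 1" using r(1)[of v] v B by (intro mult_mono) auto
        moreover have "0 \<le> e * exp (- \<eta> * v)" using e by simp
        ultimately show ?thesis using True by (simp only: if_True)
      next
        case False
        then show ?thesis using r(2)[of v] v by (simp add: mult_right_mono)
      qed
      finally show "norm (a v * exp (- \<eta> * v) - r * exp (- \<eta> * v)) \<le> (if v \<in> {0..L0} then B else 0) + e * exp (- \<eta> * v)" .
    qed
    also have "\<dots> = B * L0 + e * (1 - exp (- \<eta> * X)) / \<eta>"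
      using has_integral_add[OF ind exp_int[OF X0, of e]] by (rule integral_unique)
    also have "\<dots> \<le> B * L0 + e / \<eta>" using \<eta> e by (simp add: divide_right_mono mult_left_le)
    finally show ?thesis by simp
  qed
  have lim: "((\<lambda>X. of_real (I X) :: complex) \<longlongrightarrow> zeta (of_real (1 + \<eta>)) / of_real (1 + \<eta>)) at_top"
  proof -
    have "integral {0..X} (\<lambda>v. of_real (a v) * exp (- (of_real (1 + \<eta>) - 1) * of_real v)) = (of_real (I X) :: complex)" for X
    proof -
      have "((\<lambda>v. of_real (a v * exp (- \<eta> * v)) :: complex) has_integral of_real (I X)) {0..X}"
        unfolding I_def by (intro has_integral_of_real integrable_integral a_integrable)
      then show ?thesis by (intro integral_unique) (simp add: exp_of_real[symmetric])
    qed
    then show ?thesis using laplace_a[of "of_real (1 + \<eta>)"] \<eta> by simp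
  qed
  have "((\<lambda>X. exp (- \<eta> * X)) \<longlongrightarrow> 0) at_top" using \<eta> by real_asymp
  then have "((\<lambda>X. r * (1 - exp (- \<eta> * X)) / \<eta>) \<longlongrightarrow> r * (1 - 0) / \<eta>) at_top"
    using \<eta> by (intro tendsto_intros) auto
  then have lim2: "((\<lambda>X. r * (1 - exp (- \<eta> * X)) / \<eta>) \<longlongrightarrow> r / \<eta>) at_top" by simp
  have "((\<lambda>X. norm (of_real (I X) - of_real (r * (1 - exp (- \<eta> * X)) / \<eta>) :: complex)) \<longlongrightarrow>
      norm (zeta (of_real (1 + \<eta>)) / of_real (1 + \<eta>) - of_real (r / \<eta>))) at_top"
    by (intro tendsto_norm tendsto_diff lim tendsto_of_real lim2)
  then show ?thesis
  proof (rule tendsto_upperbound)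
    show "\<forall>\<^sub>F X in at_top. norm (of_real (I X) - of_real (r * (1 - exp (- \<eta> * X)) / \<eta>) :: complex) \<le> B * L0 + e / \<eta>"
      using eventually_ge_at_top[of L0]
    proof eventually_elim
      case (elim X)
      then show ?case using bound[OF elim] unfolding of_real_diff[symmetric] norm_of_real by simp
    qed
  qed simp
qed

definition rho :: real where "rho = Re (Z 1)"

text \<open>Multiply the Abelian estimate by \<eta> and let \<eta> tend to 0: the part up to
  \<open>L0\<close> disappears and the left side tends to the distance of \<open>Z 1\<close> from
  the limit of \<open>a\<close>. As the limit is known to exist, no Tauberian theorem
  enters.\<close>

lemma density: "(a \<longlongrightarrow> rho) at_top" "Z 1 = of_real rho"
proof -
  obtain r where r: "(a \<longlongrightarrow> r) at_top" using a_convergent by blast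
  obtain K where K: "K > 0" "\<And>L. a L \<le> K" using a_bounded by blast
  define B where "B = K + \<bar>r\<bar>"
  have B: "\<bar>a L - r\<bar> \<le> B" for L using K(2)[of L] a_nonneg[of L] unfolding B_def by linarith
  have "norm (Z 1 - of_real r) \<le> e" if e: "e > 0" for e
  proof -
    have "\<forall>\<^sub>F L in at_top. \<bar>a L - r\<bar> < e" using tendstoD[OF r e] by (simp add: dist_real_def)
    then obtain L1 where L1: "\<And>L. L1 \<le> L \<Longrightarrow> \<bar>a L - r\<bar> < e" by (auto simp: eventually_at_top_linorder)
    define L0 where "L0 = max 0 L1"
    have *: "norm (Z (of_real (1 + \<eta>)) - of_real r) \<le> \<eta> * (B * L0) + e" if \<eta>: "0 < \<eta>" for \<eta>
    proof -
      have "norm (zeta (of_real (1 + \<eta>)) / of_real (1 + \<eta>) - of_real (r / \<eta>)) \<le> B * L0 + e / \<eta>"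
        by (rule laplace_diff_bound) (use B L1 \<eta> e in \<open>auto simp: L0_def intro: less_imp_le\<close>)
      also have "zeta (of_real (1 + \<eta>)) / of_real (1 + \<eta>) - of_real (r / \<eta>) = (Z (of_real (1 + \<eta>)) - of_real r) / of_real \<eta>"
        using \<eta> by (simp add: zeta_def divide_simps del: of_real_add) (simp add: algebra_simps)
      finally show ?thesis using \<eta> by (simp add: norm_divide divide_le_eq algebra_simps)
    qed
    have "isCont Z 1"
      using holomorphic_on_imp_continuous_on[OF Z_holomorphic]
      by (rule continuous_on_interior) (subst interior_open[OF open_halfspace_Re_gt], simp)
    then have "((\<lambda>\<eta>. Z (of_real (1 + \<eta>))) \<longlongrightarrow> Z 1) (at_right 0)"
      by (intro isCont_tendsto_compose[where g = Z]) (auto intro!: tendsto_eq_intros)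
    then have "((\<lambda>\<eta>. norm (Z (of_real (1 + \<eta>)) - of_real r)) \<longlongrightarrow> norm (Z 1 - of_real r)) (at_right 0)"
      by (intro tendsto_intros)
    moreover have "((\<lambda>\<eta>. \<eta> * (B * L0) + e) \<longlongrightarrow> 0 * (B * L0) + e) (at_right 0)"
      by (intro tendsto_intros)
    moreover have "\<forall>\<^sub>F \<eta> in at_right 0. norm (Z (of_real (1 + \<eta>)) - of_real r) \<le> \<eta> * (B * L0) + e"
      using * by (auto simp: eventually_at_right_field intro: exI[of _ 1])
    ultimately show ?thesis by (intro tendsto_le[of "at_right 0"]) auto
  qed
  then have "norm (Z 1 - of_real r) \<le> 0" by (rule field_le_epsilon) simp
  then have Z1: "Z 1 = of_real r" by simp
  then have "r = rho" by (simp add: rho_def)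
  with r Z1 show "(a \<longlongrightarrow> rho) at_top" "Z 1 = of_real rho" by simp_all
qed

text \<open>As a limit of \<open>a\<close> it is nonnegative, and \<open>Z 1\<close> is an
  exponential.\<close>

lemma rho_pos: "0 < rho"
proof -
  have "0 \<le> rho" by (rule tendsto_lowerbound[OF density(1)]) (auto simp: a_nonneg)
  moreover have "rho \<noteq> 0" using density(2) Z_nonzero[of 1] by auto
  ultimately show ?thesis by simp
qed

text \<open>\<open>zeta s / s\<close> is \<open>Z s / (s - 1)\<close>; subtracting the polar part
  leaves a removable singularity at 1, filled by \<open>deriv Z 1\<close>. This permits circles
  about 2 of radius larger than 1.\<close>

definition F :: "complex \<Rightarrow> complex" where
  "F s = (if s = 1 then deriv Z 1 else Z s / (s - 1) - Z 1 / (s - 1))"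

lemma F_holomorphic: "F holomorphic_on {s. 3/5 < Re s}"
  unfolding F_def by (rule pole_theorem_open[OF Z_holomorphic open_halfspace_Re_gt]) auto

lemma F_eq: "s \<noteq> 0 \<Longrightarrow> s \<noteq> 1 \<Longrightarrow> F s = zeta s / s - of_real rho / (s - 1)"
  by (simp add: F_def density zeta_def)

end

section \<open>Taylor coefficients as integrals against Gamma densities\<close>

definition gamma_ker :: "nat \<Rightarrow> real \<Rightarrow> real" where
  "gamma_ker n L = L ^ n * exp (- L) * indicat_real {0..} L / fact n"

lemma gamma_ker_nonneg: "0 \<le> gamma_ker n L"
  by (auto simp: gamma_ker_def indicator_def)

lemma gamma_ker_has_integral: "has_bochner_integral lborel (gamma_ker n) 1"
  using has_bochner_integral_divide_zero[OF has_bochner_integral_I0i_power_exp_m'[of n], of "fact n"]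
  by (simp add: gamma_ker_def[abs_def])

lemma gamma_ker_integrable [simp]: "integrable lborel (gamma_ker n)"
  and gamma_ker_integral [simp]: "integral\<^sup>L lborel (gamma_ker n) = 1"
  using gamma_ker_has_integral[of n] by (auto simp: has_bochner_integral_iff)

text \<open>\<open>(2 * L)^n / fact n\<close> is one term of the series of
  \<open>exp (2 * L)\<close>. This crude concentration bound suffices for \<open>L\<close> up to
  \<open>n / 2\<close>, because \<open>exp (1/2) < 2\<close>.\<close>

lemma gamma_ker_le: "gamma_ker n L * 2 ^ n \<le> exp L" if "0 \<le> L"
proof -
  have "(2 * L) ^ n / fact n \<le> exp (2 * L)"
  proof -
    have "(2 * L) ^ n / fact n \<le> (\<Sum>k. (2 * L) ^ k / fact k)"
      using sum_le_suminf[OF summable_exp[of "2 * L"], of "{n}"] that by (simp add: field_simps)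
    then show ?thesis by (simp add: exp_def field_simps scaleR_conv_of_real)
  qed
  then have "(2 * L) ^ n / fact n * exp (- L) \<le> exp (2 * L) * exp (- L)" by (intro mult_right_mono) auto
  then show ?thesis using that by (simp add: gamma_ker_def power_mult_distrib field_simps flip: exp_add)
qed

context beurling_sample begin

lemma a_measurable [measurable]: "a \<in> borel_measurable borel"
proof -
  have [measurable]: "Nc \<in> borel_measurable borel"
    by (rule borel_measurable_mono) (auto intro!: monoI Nc_mono)
  show ?thesis unfolding a_def[abs_def] by measurable
qed

lemma a_diff_bounded: "\<exists>B>0. \<forall>L. \<bar>a L - rho\<bar> \<le> B"
proof -
  obtain K where K: "K > 0" "\<And>L. a L \<le> K" using a_bounded by blast
  have "\<bar>a L - rho\<bar> \<le> K + rho" for L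
    using K(2)[of L] a_nonneg[of L] rho_pos by linarith
  moreover have "0 < K + rho" using K rho_pos by simp
  ultimately show ?thesis by blast
qed

definition coef :: "nat \<Rightarrow> real \<Rightarrow> complex" where
  "coef n t = (LINT L|lborel. of_real ((a L - rho) * gamma_ker n L) * exp (- \<i> * of_real (t * L)))"

lemma gamma_ker_measurable [measurable]: "gamma_ker n \<in> borel_measurable borel"
  unfolding gamma_ker_def[abs_def] by measurable

lemma coef_integrable: "integrable lborel (\<lambda>L. of_real ((a L - rho) * gamma_ker n L) * exp (- \<i> * of_real (t * L)))"
proof -
  obtain B where B: "B > 0" "\<And>L. \<bar>a L - rho\<bar> \<le> B" using a_diff_bounded by blast
  show ?thesis
  proof (rule Bochner_Integration.integrable_bound)
    show "integrable lborel (\<lambda>L. B * gamma_ker n L)" by simp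
    show "AE L in lborel. norm (of_real ((a L - rho) * gamma_ker n L) * exp (- \<i> * of_real (t * L))) \<le> norm (B * gamma_ker n L)"
    proof (intro always_eventually allI)
      fix L
      have "norm (of_real ((a L - rho) * gamma_ker n L) * exp (- \<i> * of_real (t * L))) = \<bar>a L - rho\<bar> * gamma_ker n L"
        using gamma_ker_nonneg[of n L] by (simp only: norm_mult norm_of_real norm_exp_eq_Re) (simp add: abs_mult)
      also have "\<dots> \<le> B * gamma_ker n L" by (intro mult_right_mono B gamma_ker_nonneg)
      finally show "norm (of_real ((a L - rho) * gamma_ker n L) * exp (- \<i> * of_real (t * L))) \<le> norm (B * gamma_ker n L)" by simp
    qed
  qed measurable
qed

text \<open>Expand \<open>exp (- w * L)\<close> under the Laplace integral at 2 + it. The kernels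
  have mass 1, so the \<open>n\<close>-th term is at most \<open>B * norm w ^ n\<close> and
  integration term by term is allowed. The resulting integral is identified with \<open>F\<close> by
  truncating at \<open>X\<close> and using \<open>laplace_a\<close>.\<close>

lemma F_power_series:
  assumes w: "norm w < 1"
  shows "(\<lambda>n. (- 1) ^ n * coef n t * w ^ n) sums F (2 + \<i> * of_real t + w)"
proof -
  define s where "s = 2 + \<i> * of_real t + w"
  have "\<bar>Re w\<bar> < 1" using abs_Re_le_cmod[of w] w by linarith
  then have Re: "Re s > 1" by (simp add: s_def)
  then have ne: "s \<noteq> 0" "s \<noteq> 1" by auto
  obtain B where B: "B > 0" "\<And>L. \<bar>a L - rho\<bar> \<le> B" using a_diff_bounded by blast
  define fi where "fi n L = of_real ((a L - rho) * gamma_ker n L) * exp (- \<i> * of_real (t * L)) * (- w) ^ n" for n L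
  define g where "g L = indicat_real {0..} L *\<^sub>R (of_real (a L - rho) * exp (- (s - 1) * of_real L))" for L
  have int: "integrable lborel (fi n)" for n
    unfolding fi_def by (intro integrable_mult_left coef_integrable)
  have sums: "(\<lambda>n. fi n L) sums g L" and abs: "summable (\<lambda>n. norm (fi n L))" for L
  proof -
    have eq: "fi n L = g L * exp (w * of_real L) * ((of_real L * (- w)) ^ n /\<^sub>R fact n)" for n
    proof -
      have "of_real (exp (- L)) * exp (- \<i> * of_real (t * L)) = exp (- (s - 1) * of_real L) * exp (w * of_real L)"
        unfolding exp_of_real[symmetric] exp_add[symmetric] by (simp add: s_def algebra_simps)
      moreover have p: "(of_real L * (- w)) ^ n = of_real L ^ n * (- w) ^ n" by (rule power_mult_distrib)
      ultimately show ?thesis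
        unfolding fi_def g_def gamma_ker_def p
        by (simp add: scaleR_conv_of_real power_mult_distrib divide_simps mult_ac)
    qed
    have "(\<lambda>n. g L * exp (w * of_real L) * ((of_real L * (- w)) ^ n /\<^sub>R fact n)) sums
        (g L * exp (w * of_real L) * exp (of_real L * (- w)))"
      by (intro sums_mult exp_converges)
    also have "g L * exp (w * of_real L) * exp (of_real L * (- w)) = g L"
      by (simp add: mult.assoc flip: exp_add)
    finally show "(\<lambda>n. fi n L) sums g L" unfolding eq .
    show "summable (\<lambda>n. norm (fi n L))"
      unfolding eq norm_mult[of "g L * exp (w * of_real L)"] by (intro summable_mult summable_norm_exp)
  qed
  have norm_int: "(LINT L|lborel. norm (fi n L)) \<le> B * norm w ^ n" for n
  proof -
    have "(LINT L|lborel. norm (fi n L)) \<le> (LINT L|lborel. B * norm w ^ n * gamma_ker n L)"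
    proof (rule integral_mono)
      show "integrable lborel (\<lambda>L. norm (fi n L))" using int by (rule integrable_norm)
      show "integrable lborel (\<lambda>L. B * norm w ^ n * gamma_ker n L)" by simp
      fix L
      have "norm (fi n L) = \<bar>a L - rho\<bar> * gamma_ker n L * norm w ^ n"
        using gamma_ker_nonneg[of n L] unfolding fi_def norm_mult norm_of_real norm_exp_eq_Re
        by (simp add: norm_power abs_mult)
      also have "\<dots> \<le> B * gamma_ker n L * norm w ^ n"
        using B(2)[of L] gamma_ker_nonneg[of n L] by (intro mult_right_mono) auto
      finally show "norm (fi n L) \<le> B * norm w ^ n * gamma_ker n L" by (simp add: mult_ac)
    qed
    then show ?thesis by simp
  qed
  have summ: "summable (\<lambda>n. LINT L|lborel. norm (fi n L))"
  proof (rule summable_comparison_test')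
    show "summable (\<lambda>n. B * norm w ^ n)" using w by (intro summable_mult summable_geometric) auto
    show "norm (LINT L|lborel. norm (fi n L)) \<le> B * norm w ^ n" for n using norm_int[of n] by simp
  qed
  have "(\<lambda>n. integral\<^sup>L lborel (fi n)) sums (LINT L|lborel. (\<Sum>n. fi n L))"
    by (rule sums_integral) (auto intro: int abs summ)
  moreover have "integral\<^sup>L lborel (fi n) = (- 1) ^ n * coef n t * w ^ n" for n
    unfolding fi_def coef_def by (subst integral_mult_left_zero) (simp add: power_minus[of w])
  moreover have suminf: "(\<Sum>n. fi n L) = g L" for L using sums by (simp add: sums_iff)
  ultimately have main: "(\<lambda>n. (- 1) ^ n * coef n t * w ^ n) sums (LINT L|lborel. g L)" by simp
  have g_int: "integrable lborel g"
    using integrable_suminf[of lborel fi] int abs summ unfolding suminf by simp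
  have lim1: "((\<lambda>X. LINT L|lborel. indicat_real {..X} L *\<^sub>R g L) \<longlongrightarrow> integral\<^sup>L lborel g) at_top"
    using g_int by (intro tendsto_integral_at_top) auto
  have trunc: "(LINT L|lborel. indicat_real {..X} L *\<^sub>R g L) =
      integral {0..X} (\<lambda>v. of_real (a v) * exp (- (s - 1) * of_real v)) - of_real rho * (1 - exp (- (s - 1) * of_real X)) / (s - 1)"
    if X: "0 \<le> X" for X
  proof -
    define h where "h v = of_real (a v - rho) * exp (- (s - 1) * of_real v)" for v
    have ind: "indicat_real {..X} L *\<^sub>R g L = indicat_real {0..X} L *\<^sub>R h L" for L
      by (auto simp: g_def h_def indicator_def)
    have "set_integrable lborel {0..X} h"
      unfolding set_integrable_def ind[symmetric] using g_int by (intro integrable_mult_indicator) auto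
    note hk = set_borel_integral_eq_integral[OF this]
    have e: "((\<lambda>v. of_real rho * exp (- (s - 1) * of_real v)) has_integral of_real rho * (1 - exp (- (s - 1) * of_real X)) / (s - 1)) {0..X}"
    proof -
      define c where "c = s - 1"
      have "c \<noteq> 0" using ne by (simp add: c_def)
      then have "((\<lambda>v. of_real rho * exp (- c * of_real v)) has_integral
          (- of_real rho * exp (- c * of_real X) / c) - (- of_real rho * exp (- c * of_real 0) / c)) {0..X}"
        using X by (intro fundamental_theorem_of_calculus[of 0 X "\<lambda>v. - of_real rho * exp (- c * of_real v) / c"])
          (auto intro!: derivative_eq_intros has_vector_derivative_real_field)
      then show ?thesis unfolding c_def[symmetric] by (simp add: right_diff_distrib diff_divide_distrib)
    qed
    have "((\<lambda>v. h v + of_real rho * exp (- (s - 1) * of_real v)) has_integral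
        integral {0..X} h + of_real rho * (1 - exp (- (s - 1) * of_real X)) / (s - 1)) {0..X}"
      by (intro has_integral_add e integrable_integral hk(1))
    then have "integral {0..X} (\<lambda>v. of_real (a v) * exp (- (s - 1) * of_real v)) =
        integral {0..X} h + of_real rho * (1 - exp (- (s - 1) * of_real X)) / (s - 1)"
      by (intro integral_unique) (simp add: h_def algebra_simps)
    then show ?thesis using hk(2) unfolding set_lebesgue_integral_def ind by simp
  qed
  have "((\<lambda>X. exp (- (s - 1) * of_real X)) \<longlongrightarrow> 0) at_top"
  proof (rule Lim_null_comparison)
    show "\<forall>\<^sub>F X in at_top. norm (exp (- (s - 1) * of_real X)) \<le> exp (- (Re s - 1) * X)" by simp
    show "((\<lambda>X. exp (- (Re s - 1) * X)) \<longlongrightarrow> 0) at_top" using Re by real_asymp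
  qed
  then have "((\<lambda>X. integral {0..X} (\<lambda>v. of_real (a v) * exp (- (s - 1) * of_real v)) - of_real rho * (1 - exp (- (s - 1) * of_real X)) / (s - 1)) \<longlongrightarrow>
      zeta s / s - of_real rho * (1 - 0) / (s - 1)) at_top"
    using ne by (intro tendsto_intros laplace_a Re) auto
  then have "((\<lambda>X. LINT L|lborel. indicat_real {..X} L *\<^sub>R g L) \<longlongrightarrow> zeta s / s - of_real rho * (1 - 0) / (s - 1)) at_top"
    by (rule Lim_transform_eventually) (use trunc in \<open>auto intro!: eventually_mono[OF eventually_ge_at_top[of 0]]\<close>)
  then have "integral\<^sup>L lborel g = zeta s / s - of_real rho * (1 - 0) / (s - 1)"
    by (rule tendsto_unique[OF trivial_limit_at_top_linorder lim1])
  then have "integral\<^sup>L lborel g = F s" using F_eq[OF ne] by simp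
  then show ?thesis using main unfolding s_def by simp
qed

lemma deriv_F_eq_coef:
  "(deriv ^^ n) F (2 + \<i> * of_real t) / fact n = (- 1) ^ n * coef n t"
proof -
  define s0 where "s0 = 2 + \<i> * of_real t"
  have "s0 \<in> {s. 3/5 < Re s}" by (simp add: s0_def)
  then have "F analytic_on {s0}"
    using F_holomorphic open_halfspace_Re_gt by (metis analytic_at)
  then have 1: "(\<lambda>x. F (s0 + x)) has_fps_expansion fps_expansion F s0"
    by (rule analytic_at_imp_has_fps_expansion)
  have 2: "(\<lambda>x. F (s0 + x)) has_fps_expansion Abs_fps (\<lambda>n. (- 1) ^ n * coef n t)"
  proof (rule has_fps_expansionI)
    have "\<forall>\<^sub>F u in nhds (0::complex). u \<in> ball 0 1"
      by (intro eventually_nhds_in_open) auto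
    then show "\<forall>\<^sub>F u in nhds 0. (\<lambda>n. Abs_fps (\<lambda>n. (- 1) ^ n * coef n t) $ n * u ^ n) sums F (s0 + u)"
    proof eventually_elim
      case (elim u)
      then show ?case using F_power_series[of u t] by (simp add: s0_def)
    qed
  qed
  have "fps_expansion F s0 $ n = Abs_fps (\<lambda>n. (- 1) ^ n * coef n t) $ n"
    using fps_expansion_unique_complex[OF 1 2] by simp
  then show ?thesis by (simp add: fps_expansion_def s0_def)
qed

text \<open>The radius stays below 7/5 = 2 - 3/5 so that the disc remains in the half-plane where
  \<open>F\<close> is holomorphic.\<close>

lemma norm_coef_le_Cauchy:
  assumes r: "0 < r" "r < 7/5" and B: "\<And>s. norm (s - (2 + \<i> * of_real t)) = r \<Longrightarrow> norm (F s) \<le> B"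
  shows "norm (coef n t) \<le> B / r ^ n"
proof -
  define s0 where "s0 = 2 + \<i> * of_real t"
  have sub: "cball s0 r \<subseteq> {s. 3/5 < Re s}"
  proof
    fix s assume "s \<in> cball s0 r"
    then have "\<bar>Re (s0 - s)\<bar> \<le> r" using abs_Re_le_cmod[of "s0 - s"] by (simp add: dist_norm)
    then have "2 - Re s \<le> r" by (simp add: s0_def)
    then have "3/5 < Re s" using r by linarith
    then show "s \<in> {s. 3/5 < Re s}" by blast
  qed
  have "norm ((deriv ^^ n) F s0) \<le> fact n * B / r ^ n"
  proof (rule Cauchy_inequality)
    show "F holomorphic_on ball s0 r"
      using F_holomorphic by (rule holomorphic_on_subset) (use sub ball_subset_cball in blast)
    show "continuous_on (cball s0 r) F"
      by (rule holomorphic_on_imp_continuous_on, rule holomorphic_on_subset[OF F_holomorphic sub])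
    show "norm (F x) \<le> B" if "norm (s0 - x) = r" for x
      using B[of x] that by (simp add: s0_def norm_minus_commute)
  qed (use r in auto)
  then have "norm ((deriv ^^ n) F s0 / fact n) \<le> B / r ^ n"
    by (simp add: norm_divide divide_le_eq mult.commute)
  then show ?thesis
    using deriv_F_eq_coef[of n t] by (simp add: s0_def norm_mult norm_power)
qed

text \<open>\<open>F\<close> has no pole at 1, so a circle of radius larger than 1 about the real
  point 2 is available, and the coefficients there decay exponentially.\<close>

lemma norm_coef_0_le: "\<exists>B>0. \<forall>n. norm (coef n 0) \<le> B / (13/10) ^ n"
proof -
  have "sphere 2 (13/10) \<subseteq> {s. 3/5 < Re s}"
  proof
    fix s :: complex assume "s \<in> sphere 2 (13/10)"
    then have "\<bar>Re (2 - s)\<bar> \<le> 13/10" using abs_Re_le_cmod[of "2 - s"] by (simp add: dist_norm)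
    then have "Re (2 - s) \<le> 13/10" by linarith
    then have "2 - Re s \<le> 13/10" by simp
    then have "3/5 < Re s" by linarith
    then show "s \<in> {s. 3/5 < Re s}" by blast
  qed
  then have "compact (F ` sphere 2 (13/10))"
    by (intro compact_continuous_image holomorphic_on_imp_continuous_on holomorphic_on_subset[OF F_holomorphic]) auto
  then have "bounded (F ` sphere 2 (13/10))" by (rule compact_imp_bounded)
  then obtain B where B: "B > 0" "\<And>s. s \<in> sphere 2 (13/10) \<Longrightarrow> norm (F s) \<le> B"
    by (auto simp: bounded_pos)
  have "norm (coef n 0) \<le> B / (13/10) ^ n" for n
  proof (rule norm_coef_le_Cauchy)
    fix s :: complex assume "norm (s - (2 + \<i> * of_real 0)) = 13/10"
    then show "norm (F s) \<le> B" by (intro B) (simp add: dist_norm norm_minus_commute)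
  qed auto
  then show ?thesis using B by blast
qed

text \<open>The one-sided bound on $a - \rho$ is turned into a bound for the Taylor coefficients of $F$
  at $2 + it$ by comparison with those at the real point $2$.\<close>

lemma norm_coef_le_one_sided:
  fixes sg :: real
  assumes sg: "\<bar>sg\<bar> = 1" and Y: "0 \<le> Y" and h: "0 \<le> h"
    and B: "\<And>L. \<bar>a L - rho\<bar> \<le> B" and one: "\<And>L. Y \<le> L \<Longrightarrow> sg * (a L - rho) \<le> h"
  shows "norm (coef n t) \<le> 2 * (B * Y * exp Y / 2 ^ n + h) + norm (coef n 0)"
proof -
  have B0: "0 \<le> B" using B[of 0] by simp
  \<comment> \<open>Majorant of \<open>sg * (a L - rho) * gamma_ker n L\<close>: up to
    \<open>Y\<close> from the trivial bound \<open>B\<close> and \<open>gamma_ker_le\<close>, beyond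
    \<open>Y\<close> from the one-sided hypothesis.\<close>
  define Em where "Em L = B * (exp Y / 2 ^ n) * indicat_real {0..Y} L + h * gamma_ker n L" for L
  have "integrable lborel (indicat_real {0..Y})" by (rule integrable_real_indicator) (auto simp: Y)
  then have Em_int: "integrable lborel Em"
    unfolding Em_def by (intro Bochner_Integration.integrable_add integrable_mult_right) auto
  have Em_val: "integral\<^sup>L lborel Em = B * (exp Y / 2 ^ n) * Y + h"
    unfolding Em_def using Y by (subst Bochner_Integration.integral_add) auto
  have y_int: "integrable lborel (\<lambda>L. (a L - rho) * gamma_ker n L)"
    using coef_integrable[of n 0] integrable_Re by fastforce
  have Em: "sg * (a L - rho) * gamma_ker n L \<le> Em L" "0 \<le> Em L" for L
  proof -
    have Em': "h * gamma_ker n L \<le> Em L" using B0 by (simp add: Em_def)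
    show "0 \<le> Em L" unfolding Em_def using B0 h gamma_ker_nonneg[of n L] by (auto intro!: add_nonneg_nonneg)
    show "sg * (a L - rho) * gamma_ker n L \<le> Em L"
    proof (cases "L \<in> {0..Y}")
      case True
      have "sg = 1 \<or> sg = - 1" using sg by linarith
      then have "sg * (a L - rho) \<le> B" using B[of L] by auto
      then have "sg * (a L - rho) * gamma_ker n L \<le> B * gamma_ker n L" by (intro mult_right_mono gamma_ker_nonneg)
      also have "gamma_ker n L \<le> exp L / 2 ^ n" using gamma_ker_le[of L n] True by (simp add: pos_le_divide_eq)
      also have "\<dots> \<le> exp Y / 2 ^ n" using True by (simp add: divide_right_mono)
      finally have "sg * (a L - rho) * gamma_ker n L \<le> B * (exp Y / 2 ^ n)" using B0 by (simp add: mult_left_mono)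
      moreover have "Em L = B * (exp Y / 2 ^ n) + h * gamma_ker n L" using True by (simp add: Em_def)
      ultimately show ?thesis using mult_nonneg_nonneg[OF h gamma_ker_nonneg[of n L]] by linarith
    next
      case False
      show ?thesis
      proof (cases "L < 0")
        case True
        then have "gamma_ker n L = 0" by (simp add: gamma_ker_def)
        then show ?thesis using Em' by simp
      next
        case L: False
        then have "sg * (a L - rho) * gamma_ker n L \<le> h * gamma_ker n L"
          using False by (intro mult_right_mono gamma_ker_nonneg one) auto
        then show ?thesis using Em' by simp
      qed
    qed
  qed
  have "norm (coef n t) \<le> (LINT L|lborel. norm (of_real ((a L - rho) * gamma_ker n L) * exp (- \<i> * of_real (t * L))))"
    unfolding coef_def by (rule integral_norm_bound)
  also have "\<dots> = (LINT L|lborel. \<bar>(a L - rho) * gamma_ker n L\<bar>)"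
    by (simp only: norm_mult norm_of_real norm_exp_eq_Re) simp
  \<comment> \<open>If \<open>sg * y \<le> E\<close> and \<open>0 \<le> E\<close>, then
    \<open>\<bar>y\<bar> \<le> 2 * E - sg * y\<close>; the integral of \<open>y\<close> carries no
    oscillating factor and is \<open>coef n 0\<close>.\<close>
  also have "\<dots> \<le> (LINT L|lborel. 2 * Em L - sg * ((a L - rho) * gamma_ker n L))"
  proof (rule integral_mono)
    show "integrable lborel (\<lambda>L. \<bar>(a L - rho) * gamma_ker n L\<bar>)" using y_int by (rule integrable_abs)
    show "integrable lborel (\<lambda>L. 2 * Em L - sg * ((a L - rho) * gamma_ker n L))" using Em_int y_int by simp
    fix L
    have "\<bar>(a L - rho) * gamma_ker n L\<bar> = \<bar>sg * ((a L - rho) * gamma_ker n L)\<bar>" using sg by (simp add: abs_mult)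
    then show "\<bar>(a L - rho) * gamma_ker n L\<bar> \<le> 2 * Em L - sg * ((a L - rho) * gamma_ker n L)"
      using Em[of L] by (simp add: mult.assoc)
  qed
  also have "\<dots> = 2 * integral\<^sup>L lborel Em - sg * (LINT L|lborel. (a L - rho) * gamma_ker n L)"
    using Em_int y_int by simp
  also have "(LINT L|lborel. (a L - rho) * gamma_ker n L) = Re (coef n 0)"
  proof -
    have "coef n 0 = (LINT L|lborel. of_real ((a L - rho) * gamma_ker n L))" by (simp add: coef_def)
    also have "\<dots> = of_real (LINT L|lborel. (a L - rho) * gamma_ker n L)" by (rule integral_of_real[OF y_int])
    finally show ?thesis by simp
  qed
  finally have "norm (coef n t) \<le> 2 * integral\<^sup>L lborel Em - sg * Re (coef n 0)" .
  moreover have "- (sg * Re (coef n 0)) \<le> norm (coef n 0)"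
  proof -
    have "- (sg * Re (coef n 0)) \<le> \<bar>sg * Re (coef n 0)\<bar>" by linarith
    also have "\<dots> = \<bar>Re (coef n 0)\<bar>" using sg by (simp add: abs_mult)
    also have "\<dots> \<le> norm (coef n 0)" by (rule abs_Re_le_cmod)
    finally show ?thesis .
  qed
  ultimately have "norm (coef n t) \<le> 2 * integral\<^sup>L lborel Em + norm (coef n 0)" by linarith
  then show ?thesis unfolding Em_val by (simp add: mult_ac)
qed

end

section \<open>Growth of the zeta function\<close>

text \<open>Model for the sum of p to the power -(1 - \<delta>) over primes up to
  \<open>exp V\<close>; its size is about
  \<open>exp (\<delta> * V) / (\<delta> * V)\<close>.\<close>

definition wgt_mgf :: "real \<Rightarrow> real \<Rightarrow> real" where
  "wgt_mgf \<delta> V = integral {0..V} (\<lambda>v. exp (- (1 - \<delta>) * v) * wgt v)"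

lemma wgt_mgf_integrable: "(\<lambda>v. exp (- (1 - \<delta>) * v) * wgt v) integrable_on {c..d}"
  by (intro integrable_continuous_interval continuous_intros)

lemma wgt_mgf_mono: "V \<le> V' \<Longrightarrow> wgt_mgf \<delta> V \<le> wgt_mgf \<delta> V'"
  unfolding wgt_mgf_def by (intro integral_subset_le wgt_mgf_integrable) auto

lemma exp_wgt_le: "0 < v \<Longrightarrow> exp (- (1 - \<delta>) * v) * wgt v \<le> exp (\<delta> * v) / v"
proof -
  assume "0 < v"
  then have "exp (- (1 - \<delta>) * v) * wgt v \<le> exp (- (1 - \<delta>) * v) * (exp v / v)"
    by (intro mult_left_mono wgt_le_divide) auto
  also have "\<dots> = exp (- (1 - \<delta>) * v) * exp v / v" by simp
  also have "exp (- (1 - \<delta>) * v) * exp v = exp (\<delta> * v)" by (simp add: algebra_simps flip: exp_add)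
  finally show ?thesis .
qed

lemma wgt_mgf_le_trivial:
  assumes "0 \<le> \<delta>" "1 \<le> Y" shows "wgt_mgf \<delta> Y \<le> exp (\<delta> * Y) * (1 + ln Y)"
proof -
  let ?g = "\<lambda>v. exp (- (1 - \<delta>) * v) * wgt v"
  have "wgt_mgf \<delta> Y = integral {0..1} ?g + integral {1..Y} ?g"
    unfolding wgt_mgf_def using assms
    by (intro Henstock_Kurzweil_Integration.integral_combine[symmetric] wgt_mgf_integrable) auto
  also have "integral {0..1} ?g \<le> integral {0..1::real} (\<lambda>_. exp (\<delta> * Y))"
  proof (intro integral_le wgt_mgf_integrable)
    fix v :: real assume v: "v \<in> {0..1}"
    have "?g v \<le> exp (- (1 - \<delta>) * v) * exp v" using v by (intro mult_left_mono wgt_le_exp) auto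
    also have "\<dots> = exp (\<delta> * v)" by (simp add: algebra_simps flip: exp_add)
    also have "\<dots> \<le> exp (\<delta> * Y)" using v assms by (auto intro!: mult_left_mono)
    finally show "?g v \<le> exp (\<delta> * Y)" .
  qed auto
  also have "integral {1..Y} ?g \<le> integral {1..Y} (\<lambda>v. exp (\<delta> * Y) / v)"
  proof (intro integral_le wgt_mgf_integrable)
    show "(\<lambda>v. exp (\<delta> * Y) / v) integrable_on {1..Y}"
      by (intro integrable_continuous_interval continuous_intros) auto
    fix v assume v: "v \<in> {1..Y}"
    have "?g v \<le> exp (\<delta> * v) / v" using v by (intro exp_wgt_le) auto
    also have "\<dots> \<le> exp (\<delta> * Y) / v" using v assms by (auto intro!: divide_right_mono mult_left_mono)
    finally show "?g v \<le> exp (\<delta> * Y) / v" .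
  qed
  also have "integral {1..Y} (\<lambda>v. exp (\<delta> * Y) / v) = exp (\<delta> * Y) * ln Y"
  proof -
    have "((\<lambda>v. exp (\<delta> * Y) / v) has_integral exp (\<delta> * Y) * ln Y - exp (\<delta> * Y) * ln 1) {1..Y}"
      using assms by (intro fundamental_theorem_of_calculus)
        (auto intro!: derivative_eq_intros simp flip: has_real_derivative_iff_has_vector_derivative)
    from integral_unique[OF this] show ?thesis by simp
  qed
  finally show ?thesis by (simp add: algebra_simps)
qed

lemma integral_exp_div:
  fixes c \<delta> Y V :: real
  assumes "c \<noteq> 0" "Y \<le> V" "0 < \<delta>"
  shows "((\<lambda>v. exp (\<delta> * v) / c) has_integral (exp (\<delta> * V) - exp (\<delta> * Y)) / (\<delta> * c)) {Y..V}"
proof -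
  have "((\<lambda>v. exp (\<delta> * v) / c) has_integral exp (\<delta> * V) / (\<delta> * c) - exp (\<delta> * Y) / (\<delta> * c)) {Y..V}"
    using assms by (intro fundamental_theorem_of_calculus[of Y V "\<lambda>v. exp (\<delta> * v) / (\<delta> * c)"])
      (auto intro!: derivative_eq_intros simp flip: has_real_derivative_iff_has_vector_derivative)
  then show ?thesis by (simp add: diff_divide_distrib)
qed

text \<open>Split at \<open>Y\<close>: below, the trivial bound; above,
  \<open>1 / v \<le> 1 / Y\<close>, which loses only the factor \<open>V / Y\<close>.\<close>

lemma wgt_mgf_le:
  assumes "0 < \<delta>" "1 \<le> Y" "Y \<le> V"
  shows "wgt_mgf \<delta> V \<le> exp (\<delta> * Y) * (1 + ln Y) + exp (\<delta> * V) / (\<delta> * Y)"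
proof -
  let ?g = "\<lambda>v. exp (- (1 - \<delta>) * v) * wgt v"
  have "wgt_mgf \<delta> V = wgt_mgf \<delta> Y + integral {Y..V} ?g"
    unfolding wgt_mgf_def using assms
    by (intro Henstock_Kurzweil_Integration.integral_combine[symmetric] wgt_mgf_integrable) auto
  also have "integral {Y..V} ?g \<le> integral {Y..V} (\<lambda>v. exp (\<delta> * v) / Y)"
  proof (intro integral_le wgt_mgf_integrable)
    show "(\<lambda>v. exp (\<delta> * v) / Y) integrable_on {Y..V}"
      using assms by (intro integrable_continuous_interval continuous_intros) auto
    fix v assume v: "v \<in> {Y..V}"
    have "?g v \<le> exp (\<delta> * v) / v" using v assms by (intro exp_wgt_le) auto
    also have "\<dots> \<le> exp (\<delta> * v) / Y" using v assms by (intro divide_left_mono) auto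
    finally show "?g v \<le> exp (\<delta> * v) / Y" .
  qed
  also have "\<dots> = (exp (\<delta> * V) - exp (\<delta> * Y)) / (\<delta> * Y)"
    using assms by (intro integral_unique integral_exp_div) auto
  also have "\<dots> \<le> exp (\<delta> * V) / (\<delta> * Y)" using assms by (intro divide_right_mono) auto
  also note wgt_mgf_le_trivial[of \<delta> Y]
  finally show ?thesis using assms by simp
qed

lemma wgt_mgf_ge:
  assumes "0 < \<delta>" "1 \<le> Y" "Y \<le> V"
  shows "(1 - exp (- Y)) * ((exp (\<delta> * V) - exp (\<delta> * Y)) / (\<delta> * V)) \<le> wgt_mgf \<delta> V"
proof -
  let ?g = "\<lambda>v. exp (- (1 - \<delta>) * v) * wgt v"
  have "(1 - exp (- Y)) * ((exp (\<delta> * V) - exp (\<delta> * Y)) / (\<delta> * V)) =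
      integral {Y..V} (\<lambda>v. (1 - exp (- Y)) * (exp (\<delta> * v) / V))"
    using assms by (intro integral_unique[symmetric] has_integral_mult_right integral_exp_div) auto
  also have "\<dots> \<le> integral {Y..V} ?g"
  proof (intro integral_le wgt_mgf_integrable)
    show "(\<lambda>v. (1 - exp (- Y)) * (exp (\<delta> * v) / V)) integrable_on {Y..V}"
      using assms by (intro integrable_continuous_interval continuous_intros) auto
    fix v assume v: "v \<in> {Y..V}"
    have "(1 - exp (- Y)) * (exp (\<delta> * v) / V) \<le> (1 - exp (- v)) * (exp (\<delta> * v) / v)"
      using v assms by (intro mult_mono divide_left_mono) auto
    also have "\<dots> = ?g v"
    proof -
      have "?g v = (exp (- (1 - \<delta>) * v) * exp v) * ((1 - exp (- v)) / v)"
        using v assms by (simp add: wgt_def exp_minus field_simps)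
      also have "exp (- (1 - \<delta>) * v) * exp v = exp (\<delta> * v)" by (simp add: algebra_simps flip: exp_add)
      finally show ?thesis by simp
    qed
    finally show "(1 - exp (- Y)) * (exp (\<delta> * v) / V) \<le> ?g v" .
  qed
  also have "\<dots> \<le> wgt_mgf \<delta> V"
    unfolding wgt_mgf_def using assms by (intro integral_subset_le wgt_mgf_integrable) auto
  finally show ?thesis .
qed

text \<open>Normalised by \<open>exp (delta \<kappa> T * T) = exp \<kappa> * T\<close>. The value
  \<kappa> = 0 gives the point where \<open>F\<close> is large, \<kappa> = 1/4 and -1/4 the two
  circles of comparison.\<close>

definition delta :: "real \<Rightarrow> real \<Rightarrow> real" where "delta \<kappa> T = (ln T + \<kappa>) / T"

lemma less_mult_ratio_iff:
  fixes x q :: real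
  assumes "0 < L" "0 < T"
  shows "x * L / T < q \<longleftrightarrow> x < q * (T / L)" "q < x * L / T \<longleftrightarrow> q * (T / L) < x"
  using assms by (simp_all add: pos_divide_less_eq pos_less_divide_eq mult.commute)

lemma wgt_mgf_upper_asymp:
  "\<forall>\<^sub>F T in at_top. wgt_mgf (delta \<kappa> T) (T + ln T) \<le> (201/200) * exp \<kappa> * (T / ln T)"
proof -
  \<comment> \<open>A split point close to the end costs only the factor 500/499 < 201/200, while
    the part below \<open>Y\<close> is of order \<open>T\<close> to the power 499/500 up to
    logarithms.\<close>
  define Y where "Y T = (499/500) * (T + ln T)" for T :: real
  have lim: "((\<lambda>T. (exp (delta \<kappa> T * Y T) * (1 + ln (Y T)) + exp (delta \<kappa> T * (T + ln T)) / (delta \<kappa> T * Y T)) * ln T / T) \<longlongrightarrow>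
      exp \<kappa> / (499/500)) at_top"
    unfolding Y_def delta_def by real_asymp
  have "exp \<kappa> / (499/500) < (201/200) * exp \<kappa>" by simp
  from order_tendstoD(2)[OF lim this]
  have "\<forall>\<^sub>F T in at_top. (exp (delta \<kappa> T * Y T) * (1 + ln (Y T)) + exp (delta \<kappa> T * (T + ln T)) / (delta \<kappa> T * Y T)) * ln T / T < (201/200) * exp \<kappa>" .
  moreover have "\<forall>\<^sub>F T in at_top. 0 < delta \<kappa> T" unfolding delta_def by real_asymp
  moreover have "\<forall>\<^sub>F T in at_top. 1 \<le> Y T" unfolding Y_def by real_asymp
  ultimately show ?thesis
    using eventually_gt_at_top[of 1]
  proof eventually_elim
    case (elim T)
    have lnT: "0 < ln T" using elim by simp
    have "wgt_mgf (delta \<kappa> T) (T + ln T) \<le> exp (delta \<kappa> T * Y T) * (1 + ln (Y T)) + exp (delta \<kappa> T * (T + ln T)) / (delta \<kappa> T * Y T)"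
      by (rule wgt_mgf_le) (use elim lnT in \<open>auto simp: Y_def\<close>)
    also have "\<dots> \<le> (201/200) * exp \<kappa> * (T / ln T)"
      using elim(1,4) lnT by (subst (asm) less_mult_ratio_iff) auto
    finally show ?case .
  qed
qed

lemma wgt_mgf_lower_asymp: "\<forall>\<^sub>F T in at_top. (199/200) * (T / ln T) \<le> wgt_mgf (delta 0 T) T"
proof -
  have lim: "((\<lambda>T. (1 - exp (- (T / 2))) * ((exp (delta 0 T * T) - exp (delta 0 T * (T / 2))) / (delta 0 T * T)) * ln T / T) \<longlongrightarrow> 1) at_top"
    unfolding delta_def by real_asymp
  have "((199/200) :: real) < 1" by simp
  from order_tendstoD(1)[OF lim this] show ?thesis
    using eventually_gt_at_top[of 2]
  proof eventually_elim
    case (elim T)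
    have lnT: "0 < ln T" using elim by simp
    have "(199/200) * (T / ln T) \<le> (1 - exp (- (T / 2))) * ((exp (delta 0 T * T) - exp (delta 0 T * (T / 2))) / (delta 0 T * T))"
      using elim(1,2) lnT by (subst (asm) less_mult_ratio_iff) auto
    also have "\<dots> \<le> wgt_mgf (delta 0 T) T"
      by (rule wgt_mgf_ge) (use elim lnT in \<open>auto simp: delta_def\<close>)
    finally show ?case .
  qed
qed

text \<open>The primes below the square root of \<tau>, whose phases are not controlled, carry only
  about \<open>sqrt T * ln T\<close>.\<close>

lemma wgt_mgf_small_asymp: "\<forall>\<^sub>F T in at_top. wgt_mgf (delta 0 T) (T / 2 + 4) \<le> (1/1000) * (T / ln T)"
proof -
  have "\<forall>\<^sub>F T in at_top. exp (delta 0 T * (T / 2 + 4)) * (1 + ln (T / 2 + 4)) \<le> (1/1000) * (T / ln T)"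
    unfolding delta_def by real_asymp
  then show ?thesis
    using eventually_gt_at_top[of 2]
  proof eventually_elim
    case (elim T)
    have "wgt_mgf (delta 0 T) (T / 2 + 4) \<le> exp (delta 0 T * (T / 2 + 4)) * (1 + ln (T / 2 + 4))"
      by (rule wgt_mgf_le_trivial) (use elim in \<open>auto simp: delta_def\<close>)
    then show ?case using elim by simp
  qed
qed

context beurling_sample begin

lemma sum_C1_le: "(\<Sum>j<m. Ln_const * exp (- (6/5) * l j)) \<le> K_tail"
proof -
  have "(\<Sum>j<m. Ln_const * exp (- (6/5) * l j)) \<le> (\<Sum>j<m. bnd j)"
    unfolding bnd_def using C0_nonneg E_nonneg[of "1/10"] by (intro sum_mono) auto
  also have "\<dots> \<le> K_tail"
    unfolding K_tail_def by (intro sum_le_suminf summable_bnd) (auto simp: bnd_nonneg)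
  finally show ?thesis .
qed

lemma sum_exp_l_le_bfun:
  assumes "0 \<le> \<sigma>" shows "(\<Sum>j<m. exp (- \<sigma> * l j)) \<le> 1 + wgt_mgf (1 - \<sigma>) (lam m)"
  using sum_exp_l_le[OF assms, of m] integral_exp_f_le[of "lam m" \<sigma>] unfolding wgt_mgf_def by simp

lemma sum_exp_l_ge_bfun:
  assumes "3/5 \<le> \<sigma>" shows "wgt_mgf (1 - \<sigma>) (lam m) - 10 * C0 - 1 \<le> (\<Sum>j<m. exp (- \<sigma> * l j))"
proof -
  have i1: "(\<lambda>v. exp (- \<sigma> * v) * wgt v) integrable_on {0..lam m}"
    by (intro integrable_continuous_interval continuous_intros)
  have i2: "(\<lambda>v. exp (- \<sigma> * v) * f v) integrable_on {0..lam m}"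
    by (intro integrable_continuous_interval continuous_intros cont_f) auto
  have "wgt_mgf (1 - \<sigma>) (lam m) - integral {0..lam m} (\<lambda>v. exp (- \<sigma> * v) * f v) =
      integral {0..lam m} (\<lambda>v. exp (- \<sigma> * v) * wgt v - exp (- \<sigma> * v) * f v)"
    unfolding wgt_mgf_def using i1 i2 by (simp add: integral_diff)
  also have "\<dots> \<le> integral {0..lam m} (\<lambda>v. C0 * exp (- (1/10) * v))"
  proof (rule integral_le)
    show "(\<lambda>v. exp (- \<sigma> * v) * wgt v - exp (- \<sigma> * v) * f v) integrable_on {0..lam m}"
      using i1 i2 by (rule integrable_diff)
    show "(\<lambda>v. C0 * exp (- (1/10) * v)) integrable_on {0..lam m}"
      by (intro integrable_continuous_interval continuous_intros)
    fix v assume "v \<in> {0..lam m}"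
    then have v: "0 \<le> v" by simp
    have "exp (- \<sigma> * v) \<le> exp (- (3/5) * v)"
      unfolding exp_le_cancel_iff by (rule mult_right_mono) (use assms v in auto)
    then have "exp (- \<sigma> * v) * (wgt v - f v) \<le> exp (- (3/5) * v) * (C0 * exp (v / 2))"
      using f_le[OF v] v by (intro mult_mono f_close) auto
    also have "\<dots> = C0 * exp (- (1/10) * v)" by (simp flip: exp_add)
    finally show "exp (- \<sigma> * v) * wgt v - exp (- \<sigma> * v) * f v \<le> C0 * exp (- (1/10) * v)"
      by (simp add: algebra_simps)
  qed
  also have "\<dots> = C0 * integral {0..lam m} (\<lambda>v. exp (- (1/10) * v))" by simp
  also have "\<dots> \<le> C0 * (1 / (1/10))"
    using C0_nonneg by (intro mult_left_mono integral_exp_le) auto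
  finally show ?thesis using sum_exp_l_ge[of \<sigma> m] assms by simp
qed

lemma norm_z_sq_le:
  assumes "3/5 \<le> \<sigma>" "\<sigma> \<le> Re s"
  shows "norm (- Ln (1 - exp (- s * of_real (l j))) - exp (- s * of_real (l j))) \<le> Ln_const * exp (- (6/5) * l j)"
proof -
  have n: "norm (exp (- s * of_real (l j))) \<le> exp (- (3/5) * l j)"
    using norm_exp_l[of "3/5" s j] assms by simp
  have "norm (- Ln (1 - exp (- s * of_real (l j))) - exp (- s * of_real (l j))) \<le> Ln_const * (norm (exp (- s * of_real (l j))))\<^sup>2"
    by (rule norm_Ln_1_minus_le) (use n exp_l_le(1)[of j] in linarith)
  also have "(norm (exp (- s * of_real (l j))))\<^sup>2 \<le> (exp (- (3/5) * l j))\<^sup>2"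
    using n by (intro power_mono) auto
  also have "\<dots> = exp (- (6/5) * l j)" by (simp add: power2_eq_square flip: exp_add)
  finally show ?thesis using Ln_const_pos by (simp add: mult_left_mono)
qed

text \<open>Take absolute values in \<open>Z_eq\<close> with \<open>J = m\<close>; the cut-off
  \<open>m\<close> remains to be chosen.\<close>

lemma zeta_upper:
  assumes \<sigma>: "3/5 \<le> \<sigma>" "\<sigma> \<le> Re s" and b: "0 < b" "b \<le> \<bar>Im s\<bar>"
  shows "norm (zeta s) \<le> exp (wgt_mgf (1 - \<sigma>) (lam m) + 1 + 2 * K_tail +
    norm s * exp (- \<sigma> * lam m) / \<sigma> + exp ((1 - \<sigma>) * lam m) / b)"
proof -
  let ?A = "\<Sum>j<m. - Ln (1 - exp (- s * of_real (l j)))"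
  have "norm ?A \<le> (\<Sum>j<m. exp (- \<sigma> * l j) + Ln_const * exp (- (6/5) * l j))"
  proof (rule sum_norm_le)
    fix j
    have "norm (- Ln (1 - exp (- s * of_real (l j)))) \<le>
        norm (- Ln (1 - exp (- s * of_real (l j))) - exp (- s * of_real (l j))) + norm (exp (- s * of_real (l j)))"
      by (metis diff_add_cancel norm_triangle_ineq)
    then show "norm (- Ln (1 - exp (- s * of_real (l j)))) \<le> exp (- \<sigma> * l j) + Ln_const * exp (- (6/5) * l j)"
      using norm_z_sq_le[OF \<sigma>, of j] norm_exp_l[OF \<sigma>(2), of j] by linarith
  qed
  also have "\<dots> \<le> 1 + wgt_mgf (1 - \<sigma>) (lam m) + K_tail"
    using sum_exp_l_le_bfun[of \<sigma> m] sum_C1_le[of m] \<sigma> by (simp add: sum.distrib)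
  finally have A: "norm ?A \<le> 1 + wgt_mgf (1 - \<sigma>) (lam m) + K_tail" .
  have B: "norm (\<Sum>j. R (j + m) s) \<le> norm s * exp (- \<sigma> * lam m) / \<sigma> + K_tail"
    by (rule norm_R_tail[OF \<sigma>])
  have "norm (rem m s) \<le> exp ((1 - Re s) * lam m) / b"
    by (rule norm_rem_le) (use b in auto)
  also have "\<dots> \<le> exp ((1 - \<sigma>) * lam m) / b"
    using b \<sigma> by (auto intro!: divide_right_mono mult_right_mono)
  finally have C: "norm (rem m s) \<le> exp ((1 - \<sigma>) * lam m) / b" .
  have "norm (zeta s) = exp (Re (?A + (\<Sum>j. R (j + m) s) + rem m s))"
    unfolding zeta_def by (subst Z_eq[where J = m]) (use \<sigma> b in auto)
  also have "Re (?A + (\<Sum>j. R (j + m) s) + rem m s) \<le> norm (?A + (\<Sum>j. R (j + m) s) + rem m s)"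
    by (rule complex_Re_le_cmod)
  also have "\<dots> \<le> norm ?A + norm (\<Sum>j. R (j + m) s) + norm (rem m s)"
    by (intro order_trans[OF norm_triangle_ineq] add_right_mono norm_triangle_ineq)
  also have "\<dots> \<le> wgt_mgf (1 - \<sigma>) (lam m) + 1 + 2 * K_tail + norm s * exp (- \<sigma> * lam m) / \<sigma> + exp ((1 - \<sigma>) * lam m) / b"
    using A B C by linarith
  finally show ?thesis by simp
qed

text \<open>For resonant primes the term \<open>exp (- s * l j)\<close> is real and positive, so the
  trivial upper bound is attained. A prime below \<open>H\<close> may count with the opposite sign
  and loses twice its size. The 4 in \<open>H + 4\<close> is two cell lengths, each at most
  2.\<close>

lemma zeta_lower:
  assumes \<sigma>: "3/5 \<le> \<sigma>" "Re s = \<sigma>" and b: "0 < b" "b \<le> \<bar>Im s\<bar>" and H: "0 \<le> H"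
    and res: "\<And>j. j < m \<Longrightarrow> H \<le> lam j \<Longrightarrow> exp (- \<i> * of_real (Im s * l j)) = 1"
  shows "exp (wgt_mgf (1 - \<sigma>) (lam m) - 10 * C0 - 3 - 2 * K_tail - 2 * wgt_mgf (1 - \<sigma>) (H + 4) -
    norm s * exp (- \<sigma> * lam m) / \<sigma> - exp ((1 - \<sigma>) * lam m) / b) \<le> norm (zeta s)"
proof -
  let ?A = "\<Sum>j<m. - Ln (1 - exp (- s * of_real (l j)))"
  have trm: "exp (- \<sigma> * l j) - 2 * (if lam j < H then exp (- \<sigma> * l j) else 0) - Ln_const * exp (- (6/5) * l j) \<le>
      Re (- Ln (1 - exp (- s * of_real (l j))))" if "j < m" for j
  proof -
    let ?z = "exp (- s * of_real (l j))"
    have z: "exp (- \<sigma> * l j) - 2 * (if lam j < H then exp (- \<sigma> * l j) else 0) \<le> Re ?z"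
    proof (cases "lam j < H")
      case True
      then show ?thesis using norm_exp_l[of \<sigma> s j] abs_Re_le_cmod[of ?z] \<sigma> by (simp only: if_True) linarith
    next
      case False
      have "?z = of_real (exp (- \<sigma> * l j)) * exp (- \<i> * of_real (Im s * l j))"
        unfolding exp_of_real[symmetric] exp_add[symmetric] using \<sigma>(2) complex_eq[of s]
        by (metis (no_types, opaque_lifting) distrib_right minus_add_distrib mult.assoc mult_minus_left of_real_minus of_real_mult)
      also have "\<dots> = of_real (exp (- \<sigma> * l j))" using res[OF that] False by simp
      finally show ?thesis using False by simp
    qed
    have "Re ?z - Re (- Ln (1 - ?z)) \<le> norm (?z - (- Ln (1 - ?z)))"
      using complex_Re_le_cmod[of "?z - (- Ln (1 - ?z))"] by simp
    also have "\<dots> = norm (- Ln (1 - ?z) - ?z)" by (rule norm_minus_commute)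
    also have "\<dots> \<le> Ln_const * exp (- (6/5) * l j)" by (rule norm_z_sq_le) (use \<sigma> in auto)
    finally show ?thesis using z by linarith
  qed
  have nonres: "(\<Sum>j<m. if lam j < H then exp (- \<sigma> * l j) else 0) \<le> 1 + wgt_mgf (1 - \<sigma>) (H + 4)"
  proof -
    have "(\<Sum>j<m. if lam j < H then exp (- \<sigma> * l j) else 0) = (\<Sum>j\<in>{j. j < m \<and> lam j < H}. exp (- \<sigma> * l j))"
      by (subst sum.inter_filter[symmetric]) (auto intro!: sum.cong)
    also have "\<dots> \<le> (\<Sum>j<J (H + 2). exp (- \<sigma> * l j))"
    proof (intro sum_mono2)
      show "{j. j < m \<and> lam j < H} \<subseteq> {..<J (H + 2)}"
      proof
        fix j assume "j \<in> {j. j < m \<and> lam j < H}"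
        then have "l j \<le> H + 2" using l_le[of j] lam_diff_le[of j] by simp
        then show "j \<in> {..<J (H + 2)}" by (simp add: l_le_iff)
      qed
    qed auto
    also have "\<dots> \<le> 1 + wgt_mgf (1 - \<sigma>) (lam (J (H + 2)))"
      using \<sigma> by (intro sum_exp_l_le_bfun) auto
    also have "wgt_mgf (1 - \<sigma>) (lam (J (H + 2))) \<le> wgt_mgf (1 - \<sigma>) (H + 4)"
      using lam_le_of_J(1)[of "H + 2"] H by (intro wgt_mgf_mono) auto
    finally show ?thesis by simp
  qed
  have "(\<Sum>j<m. exp (- \<sigma> * l j) - 2 * (if lam j < H then exp (- \<sigma> * l j) else 0) - Ln_const * exp (- (6/5) * l j)) \<le> Re ?A"
    unfolding Re_sum by (intro sum_mono trm) auto
  also have "(\<Sum>j<m. exp (- \<sigma> * l j) - 2 * (if lam j < H then exp (- \<sigma> * l j) else 0) - Ln_const * exp (- (6/5) * l j)) =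
      (\<Sum>j<m. exp (- \<sigma> * l j)) - 2 * (\<Sum>j<m. if lam j < H then exp (- \<sigma> * l j) else 0) - (\<Sum>j<m. Ln_const * exp (- (6/5) * l j))"
    by (simp only: sum_subtractf sum_distrib_left)
  finally have A: "wgt_mgf (1 - \<sigma>) (lam m) - 10 * C0 - 3 - 2 * wgt_mgf (1 - \<sigma>) (H + 4) - K_tail \<le> Re ?A"
    using nonres sum_exp_l_ge_bfun[OF \<sigma>(1), of m] sum_C1_le[of m] by linarith
  have B: "norm (\<Sum>j. R (j + m) s) \<le> norm s * exp (- \<sigma> * lam m) / \<sigma> + K_tail"
    by (rule norm_R_tail) (use \<sigma> in auto)
  have C: "norm (rem m s) \<le> exp ((1 - \<sigma>) * lam m) / b"
    using norm_rem_le[of b s m] b \<sigma> by simp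
  have "norm (zeta s) = exp (Re (?A + (\<Sum>j. R (j + m) s) + rem m s))"
    unfolding zeta_def by (subst Z_eq[where J = m]) (use \<sigma> b in auto)
  moreover have "Re ?A - norm (\<Sum>j. R (j + m) s) - norm (rem m s) \<le> Re (?A + (\<Sum>j. R (j + m) s) + rem m s)"
    using abs_Re_le_cmod[of "\<Sum>j. R (j + m) s"] abs_Re_le_cmod[of "rem m s"] unfolding plus_complex.sel by linarith
  ultimately show ?thesis using A B C by simp
qed

lemma lam_bracket:
  assumes "0 \<le> V" obtains m where "lam m \<le> V" "V - 2 \<le> lam m" "\<And>j. j < m \<Longrightarrow> lam (Suc j) \<le> V"
proof -
  have "\<exists>m. V < lam m"
  proof -
    have "\<forall>\<^sub>F m in sequentially. V < lam m" using lam_at_top by (simp add: filterlim_at_top_dense)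
    then show ?thesis by (auto simp: eventually_sequentially)
  qed
  define n where "n = (LEAST m. V < lam m)"
  have n: "V < lam n" unfolding n_def using \<open>\<exists>m. V < lam m\<close> by (rule LeastI_ex)
  then have "n \<noteq> 0" using assms lam_0 by (metis not_less)
  then obtain m where m: "n = Suc m" by (cases n) auto
  have "lam m \<le> V" using not_less_Least[of m "\<lambda>m. V < lam m"] m unfolding n_def by auto
  moreover have "V - 2 \<le> lam m" using lam_diff_le[of m] n m by simp
  moreover have "lam (Suc j) \<le> V" if "j < m" for j
    using lam_mono[of "Suc j" m] that \<open>lam m \<le> V\<close> by simp
  ultimately show ?thesis using that by blast
qed

text \<open>With the cut-off \<open>ln T\<close> beyond \<open>T\<close> the second term is bounded,
  since \<open>exp (delta \<kappa> T * T)\<close> is of order \<open>T\<close> and cancels the gain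
  \<open>1 / T\<close>; the last term tends to 0. Here \<open>2 * exp T\<close> bounds
  \<open>norm s\<close> and \<open>exp T / 2\<close> the height.\<close>

lemma tail_terms_asymp:
  "\<forall>\<^sub>F T in at_top. K + 2 * exp T * exp (- (1 - delta \<kappa> T) * (T + ln T - ln 10 - 2)) / (1 - delta \<kappa> T) +
     exp (delta \<kappa> T * (T + ln T)) / (exp T / 2) \<le> (1/500) * (T / ln T)"
  unfolding delta_def by real_asymp

lemma delta_asymp:
  "\<forall>\<^sub>F T in at_top. 0 < delta \<kappa> T" "\<forall>\<^sub>F T in at_top. delta \<kappa> T \<le> 1/10"
  "\<forall>\<^sub>F T in at_top. 0 \<le> T + ln T - ln 10 - 2 - (T :: real)"
  unfolding delta_def by real_asymp+

lemma tail_terms_le: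
  assumes d: "0 < d" "d \<le> 1/10" and T: "1 < T" and s: "norm s \<le> 2 * exp T"
    and V: "lam m \<le> T + ln T - ln 10" "T + ln T - ln 10 - 2 \<le> lam m"
  shows "norm s * exp (- (1 - d) * lam m) / (1 - d) + exp (d * lam m) / (exp T / 2) \<le>
     2 * exp T * exp (- (1 - d) * (T + ln T - ln 10 - 2)) / (1 - d) + exp (d * (T + ln T)) / (exp T / 2)"
proof (intro add_mono divide_right_mono mult_mono)
  show "exp (- (1 - d) * lam m) \<le> exp (- (1 - d) * (T + ln T - ln 10 - 2))"
    using mult_left_mono[OF V(2), of "1 - d"] d by simp
  have "(0::real) \<le> ln 10" by simp
  then have "lam m \<le> T + ln T" using V(1) by linarith
  then show "exp (d * lam m) \<le> exp (d * (T + ln T))" using d by simp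
qed (use d s in auto)

text \<open>Uniform in \<open>s\<close>, because Cauchy's estimate needs a whole circle around the
  height \<open>exp T\<close>. The cut-off is the same as in the lower bound.\<close>

lemma zeta_upper_asymp:
  "\<forall>\<^sub>F T in at_top. \<forall>s. 1 - delta \<kappa> T \<le> Re s \<longrightarrow> norm s \<le> 2 * exp T \<longrightarrow> exp T / 2 \<le> \<bar>Im s\<bar> \<longrightarrow>
     norm (zeta s) \<le> exp (((201/200) * exp \<kappa> + (1/500)) * (T / ln T))"
  using tail_terms_asymp[of "1 + 2 * K_tail" \<kappa>] delta_asymp(1)[of \<kappa>] delta_asymp(2)[of \<kappa>] delta_asymp(3)
    wgt_mgf_upper_asymp[of \<kappa>] eventually_gt_at_top[of 1]
proof eventually_elim
  case (elim T)
  define d where "d = delta \<kappa> T"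
  have V0: "0 \<le> T + ln T - ln 10" using elim by linarith
  obtain m where m: "lam m \<le> T + ln T - ln 10" "T + ln T - ln 10 - 2 \<le> lam m"
    using lam_bracket[OF V0] by metis
  show ?case
  proof (intro allI impI)
    fix s assume s: "1 - delta \<kappa> T \<le> Re s" "norm s \<le> 2 * exp T" "exp T / 2 \<le> \<bar>Im s\<bar>"
    have "norm (zeta s) \<le> exp (wgt_mgf (1 - (1 - d)) (lam m) + 1 + 2 * K_tail +
        norm s * exp (- (1 - d) * lam m) / (1 - d) + exp ((1 - (1 - d)) * lam m) / (exp T / 2))"
      by (rule zeta_upper) (use s elim in \<open>auto simp: d_def\<close>)
    also have "\<dots> \<le> exp (((201/200) * exp \<kappa> + (1/500)) * (T / ln T))"
    proof -
      have "(0::real) \<le> ln 10" by simp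
      then have "wgt_mgf d (lam m) \<le> wgt_mgf d (T + ln T)" using m by (intro wgt_mgf_mono) linarith
      also have "\<dots> \<le> (201/200) * exp \<kappa> * (T / ln T)" using elim by (simp add: d_def)
      finally have "wgt_mgf d (lam m) \<le> (201/200) * exp \<kappa> * (T / ln T)" .
      moreover have "norm s * exp (- (1 - d) * lam m) / (1 - d) + exp (d * lam m) / (exp T / 2) \<le>
          2 * exp T * exp (- (1 - d) * (T + ln T - ln 10 - 2)) / (1 - d) + exp (d * (T + ln T)) / (exp T / 2)"
        by (rule tail_terms_le) (use elim s m in \<open>auto simp: d_def\<close>)
      moreover have "1 + 2 * K_tail + 2 * exp T * exp (- (1 - d) * (T + ln T - ln 10 - 2)) / (1 - d) +
          exp (d * (T + ln T)) / (exp T / 2) \<le> (1/500) * (T / ln T)"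
        using elim(1) unfolding d_def .
      ultimately show ?thesis unfolding exp_le_cancel_iff distrib_right by (simp only: diff_diff_eq2 add_diff_cancel_left')
    qed
    finally show "norm (zeta s) \<le> exp (((201/200) * exp \<kappa> + (1/500)) * (T / ln T))" .
  qed
qed

end

text \<open>\<open>T k\<close> is the logarithm of the \<open>k\<close>-th value \<tau>. The window
  starts at half of it, so that windows of a sparse sequence do not overlap, and ends where cells
  become too short to contain a lattice point for certain.\<close>

locale resonant_sample = beurling_sample +
  fixes T :: "nat \<Rightarrow> real"
  assumes T_at_top: "filterlim T at_top sequentially"
    and resonant: "\<And>k j. T k / 2 \<le> lam j \<Longrightarrow> lam (Suc j) \<le> T k + ln (T k) - ln 10 \<Longrightarrow>
      exp (- \<i> * of_real (exp (T k) * l j)) = 1"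
begin

lemma zeta_lower_asymp:
  "\<forall>\<^sub>F k in sequentially. exp ((99/100) * (T k / ln (T k))) \<le>
     norm (zeta (Complex (1 - delta 0 (T k)) (exp (T k))))"
proof -
  \<comment> \<open>The asymptotic estimates concern a real variable; the statement is therefore
    first proved for real \<open>t\<close> and then composed with \<open>T\<close>.\<close>
  have "\<forall>\<^sub>F t in at_top. \<forall>k. T k = t \<longrightarrow> exp ((99/100) * (T k / ln (T k))) \<le>
     norm (zeta (Complex (1 - delta 0 (T k)) (exp (T k))))"
    using tail_terms_asymp[of "10 * C0 + 3 + 2 * K_tail" 0] delta_asymp(1)[of 0] delta_asymp(2)[of 0] delta_asymp(3)
      wgt_mgf_lower_asymp wgt_mgf_small_asymp eventually_gt_at_top[of 1]
  proof eventually_elim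
    case (elim t)
    show ?case
    proof (intro allI impI)
      fix k assume k: "T k = t"
      define d where "d = delta 0 t"
      define s where "s = Complex (1 - d) (exp t)"
      have V0: "0 \<le> t + ln t - ln 10" using elim by linarith
      obtain m where m: "lam m \<le> t + ln t - ln 10" "t + ln t - ln 10 - 2 \<le> lam m"
          "\<And>j. j < m \<Longrightarrow> lam (Suc j) \<le> t + ln t - ln 10"
        using lam_bracket[OF V0] by metis
      have norm_s: "norm s \<le> 2 * exp t"
      proof -
        have "norm s \<le> \<bar>1 - d\<bar> + \<bar>exp t\<bar>" unfolding s_def using cmod_le[of "Complex (1 - d) (exp t)"] by simp
        moreover have "1 \<le> exp t" using elim by simp
        ultimately show ?thesis using elim unfolding d_def by linarith
      qed
      have "exp (wgt_mgf (1 - (1 - d)) (lam m) - 10 * C0 - 3 - 2 * K_tail - 2 * wgt_mgf (1 - (1 - d)) (t / 2 + 4) -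
          norm s * exp (- (1 - d) * lam m) / (1 - d) - exp ((1 - (1 - d)) * lam m) / (exp t / 2)) \<le> norm (zeta s)"
      proof (rule zeta_lower)
        fix j assume "j < m" "t / 2 \<le> lam j"
        then show "exp (- \<i> * of_real (Im s * l j)) = 1"
          using resonant[of k j] m(3)[of j] k by (simp add: s_def)
      qed (use elim in \<open>auto simp: s_def d_def\<close>)
      moreover have "(99/100) * (t / ln t) \<le> wgt_mgf d (lam m) - 10 * C0 - 3 - 2 * K_tail - 2 * wgt_mgf d (t / 2 + 4) -
          norm s * exp (- (1 - d) * lam m) / (1 - d) - exp (d * lam m) / (exp t / 2)"
      proof -
        have "(199/200) * (t / ln t) \<le> wgt_mgf d t" using elim by (simp add: d_def)
        also have "\<dots> \<le> wgt_mgf d (lam m)" using m(2) elim by (intro wgt_mgf_mono) linarith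
        finally have "(199/200) * (t / ln t) \<le> wgt_mgf d (lam m)" .
        moreover have "wgt_mgf d (t / 2 + 4) \<le> (1/1000) * (t / ln t)" using elim by (simp add: d_def)
        moreover have "norm s * exp (- (1 - d) * lam m) / (1 - d) + exp (d * lam m) / (exp t / 2) \<le>
            2 * exp t * exp (- (1 - d) * (t + ln t - ln 10 - 2)) / (1 - d) + exp (d * (t + ln t)) / (exp t / 2)"
          by (rule tail_terms_le) (use elim norm_s m in \<open>auto simp: d_def\<close>)
        moreover have "10 * C0 + 3 + 2 * K_tail + 2 * exp t * exp (- (1 - d) * (t + ln t - ln 10 - 2)) / (1 - d) +
            exp (d * (t + ln t)) / (exp t / 2) \<le> (1/500) * (t / ln t)"
          using elim(1) unfolding d_def .
        moreover have "0 \<le> t / ln t" using elim by simp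
        ultimately show ?thesis by linarith
      qed
      ultimately show "exp ((99/100) * (T k / ln (T k))) \<le> norm (zeta (Complex (1 - delta 0 (T k)) (exp (T k))))"
        unfolding k s_def[symmetric] d_def[symmetric]
        by (simp only: diff_diff_eq2 add_diff_cancel_left') (meson exp_le_cancel_iff order_trans)
    qed
  qed
  then have "\<forall>\<^sub>F k in sequentially. \<forall>k'. T k' = T k \<longrightarrow> exp ((99/100) * (T k' / ln (T k'))) \<le>
     norm (zeta (Complex (1 - delta 0 (T k')) (exp (T k'))))"
    using T_at_top by (rule eventually_compose_filterlim)
  then show ?thesis by eventually_elim blast
qed

end

section \<open>Oscillation\<close>

text \<open>Accurate enough that \<open>(201/200) * exp (1/4) + 1/500\<close> stays below 1.294 and
  the analogue for -1/4 below 0.7865.\<close>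

lemma exp_quarter: "exp (1/4 :: real) \<le> 257/200" "exp (- (1/4) :: real) \<le> 1561/2000"
proof -
  have "exp (1/4 :: real) ^ 4 = exp 1" by (simp flip: exp_of_nat_mult)
  also have "\<dots> < 272/100" by (rule e_less_272)
  also have "\<dots> \<le> (257/200) ^ 4" by (simp add: power4_eq_xxxx)
  finally show "exp (1/4 :: real) \<le> 257/200"
    by (meson less_imp_le power_less_imp_less_base zero_le_divide_iff zero_le_numeral)
  have "1 + 1/4 + (1/4)\<^sup>2 / 2 \<le> exp (1/4 :: real)" by (rule exp_lower_Taylor_quadratic) simp
  then have "exp (- (1/4) :: real) \<le> 1 / (1 + 1/4 + (1/4)\<^sup>2 / 2)"
    unfolding exp_minus inverse_eq_divide by (intro divide_left_mono) (auto simp: power2_eq_square)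
  then show "exp (- (1/4) :: real) \<le> 1561/2000" by (simp add: power2_eq_square)
qed

context beurling_sample begin

text \<open>The circle about \<open>2 + \<i> * exp t\<close> stays to the right of
  \<open>1 - delta \<kappa> t\<close>, where \<open>zeta_upper_asymp\<close> applies; dividing by
  \<open>s\<close>, of order \<open>exp t\<close>, gives the factor
  \<open>exp (- t)\<close>.\<close>

lemma F_circle_asymp:
  assumes C: "(201/200) * exp \<kappa> + 1/500 \<le> C"
  shows "\<forall>\<^sub>F t in at_top. \<forall>s. norm (s - (2 + \<i> * of_real (exp t))) = 1 + delta \<kappa> t \<longrightarrow>
    norm (F s) \<le> 2 * (1 + rho) * exp (- t) * exp (C * (t / ln t))"
  using zeta_upper_asymp[of \<kappa>] delta_asymp(1)[of \<kappa>] delta_asymp(2)[of \<kappa>] eventually_gt_at_top[of "3 :: real"]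
proof eventually_elim
  case (elim t)
  have e4: "4 \<le> exp t" using exp_ge_add_one_self[of t] elim by linarith
  have C0: "0 \<le> C" using C by (smt (verit, best) exp_gt_zero divide_nonneg_nonneg mult_nonneg_nonneg)
  show ?case
  proof (intro allI impI)
    fix s assume s: "norm (s - (2 + \<i> * of_real (exp t))) = 1 + delta \<kappa> t"
    have "\<bar>Re s - 2\<bar> \<le> 1 + delta \<kappa> t" using abs_Re_le_cmod[of "s - (2 + \<i> * of_real (exp t))"] s by simp
    then have Re: "1 - delta \<kappa> t \<le> Re s" by linarith
    have "\<bar>Im s - exp t\<bar> \<le> 1 + delta \<kappa> t" using abs_Im_le_cmod[of "s - (2 + \<i> * of_real (exp t))"] s by simp
    then have Im: "exp t / 2 \<le> Im s" using elim e4 by linarith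
    have "norm s \<le> norm (s - (2 + \<i> * of_real (exp t))) + norm (2 + \<i> * of_real (exp t))"
      by (metis diff_add_cancel norm_triangle_ineq)
    also have "norm (2 + \<i> * of_real (exp t)) \<le> 2 + exp t"
      using norm_triangle_ineq[of 2 "\<i> * of_real (exp t)"] by (simp add: norm_mult)
    finally have ns: "norm s \<le> 2 * exp t" using s elim e4 by linarith
    have e0: "0 < exp t" by simp
    have low: "exp t / 2 \<le> norm s" "exp t / 2 \<le> norm (s - 1)"
      using abs_Im_le_cmod[of s] abs_Im_le_cmod[of "s - 1"] Im by auto
    have ne: "s \<noteq> 0" "s \<noteq> 1" using low e0 by auto
    have "norm (zeta s) \<le> exp (((201/200) * exp \<kappa> + (1/500)) * (t / ln t))"
      using elim(1) Re ns abs_ge_self[of "Im s"] Im by (meson order_trans)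
    also have "\<dots> \<le> exp (C * (t / ln t))"
      unfolding exp_le_cancel_iff using C elim by (intro mult_right_mono) auto
    finally have z: "norm (zeta s) \<le> exp (C * (t / ln t))" .
    have one: "1 \<le> exp (C * (t / ln t))" using C0 elim by simp
    have "norm (F s) \<le> norm (zeta s / s) + norm (of_real rho / (s - 1))"
      unfolding F_eq[OF ne] by (rule norm_triangle_ineq4)
    also have "norm (zeta s / s) \<le> exp (C * (t / ln t)) / (exp t / 2)"
      unfolding norm_divide using z low by (intro frac_le) auto
    also have "norm (of_real rho / (s - 1)) \<le> (rho * exp (C * (t / ln t))) / (exp t / 2)"
    proof -
      have "rho \<le> rho * exp (C * (t / ln t))" using rho_pos one by simp
      then show ?thesis unfolding norm_divide using low rho_pos by (intro frac_le) auto
    qed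
    also have "exp (C * (t / ln t)) / (exp t / 2) + (rho * exp (C * (t / ln t))) / (exp t / 2) =
        2 * (1 + rho) * exp (- t) * exp (C * (t / ln t))"
      by (simp add: exp_minus field_simps)
    finally show "norm (F s) \<le> 2 * (1 + rho) * exp (- t) * exp (C * (t / ln t))" by simp
  qed
qed

lemma F_le_sum_coef:
  assumes d: "0 < d" "d < 2/5" and summ: "summable (\<lambda>n. norm (coef n t) * (1 + d) ^ n)"
  shows "norm (F (Complex (1 - d) t)) \<le> (\<Sum>n. norm (coef n t) * (1 + d) ^ n)"
proof -
  define s0 where "s0 = 2 + \<i> * of_real t"
  have eq: "Complex (1 - d) t - s0 = - of_real (1 + d)" by (simp add: s0_def complex_eq_iff)
  have "ball s0 (7/5) \<subseteq> {s. 3/5 < Re s}"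
  proof
    fix s assume "s \<in> ball s0 (7/5)"
    then have "\<bar>Re (s0 - s)\<bar> < 7/5" using abs_Re_le_cmod[of "s0 - s"] by (simp add: dist_norm)
    then have "Re (s0 - s) < 7/5" by linarith
    then have "2 - Re s < 7/5" by (simp add: s0_def)
    then have "3/5 < Re s" by linarith
    then show "s \<in> {s. 3/5 < Re s}" by blast
  qed
  then have "F holomorphic_on ball s0 (7/5)" by (rule holomorphic_on_subset[OF F_holomorphic])
  moreover have "Complex (1 - d) t \<in> ball s0 (7/5)"
  proof -
    have "norm (s0 - Complex (1 - d) t) = 1 + d"
      unfolding norm_minus_commute[of s0] eq norm_minus_cancel norm_of_real using d by simp
    then show ?thesis using d by (simp add: dist_norm)
  qed
  ultimately have "(\<lambda>n. (deriv ^^ n) F s0 / fact n * (Complex (1 - d) t - s0) ^ n) sums F (Complex (1 - d) t)"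
    by (rule holomorphic_power_series)
  then have sums: "(\<lambda>n. (- 1) ^ n * coef n t * (- of_real (1 + d)) ^ n) sums F (Complex (1 - d) t)"
    unfolding eq unfolding s0_def deriv_F_eq_coef .
  have nrm: "norm ((- 1) ^ n * coef n t * (- of_real (1 + d)) ^ n) = norm (coef n t) * (1 + d) ^ n" for n
    by (simp only: norm_mult norm_power norm_minus_cancel norm_one norm_of_real power_one mult_1_left)
      (use d in simp)
  have "norm (F (Complex (1 - d) t)) = norm (\<Sum>n. (- 1) ^ n * coef n t * (- of_real (1 + d)) ^ n)"
    using sums by (simp add: sums_iff)
  also have "\<dots> \<le> (\<Sum>n. norm (coef n t) * (1 + d) ^ n)"
    by (rule norm_suminf_le) (use summ nrm in auto)
  finally show ?thesis .
qed

end

text \<open>At most \<open>X + 1\<close> indices are bounded by \<open>A\<close> each; the rest is a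
  geometric series with \<open>1 / (1 - exp (- \<theta>)) \<le> 1 + 1 / \<theta>\<close>.\<close>

lemma suminf_le_split:
  fixes c :: "nat \<Rightarrow> real"
  assumes X: "0 \<le> X" and \<theta>: "0 < \<theta>" and A: "0 \<le> A" and nn: "\<And>n. 0 \<le> c n"
    and small: "\<And>n. real n \<le> X \<Longrightarrow> c n \<le> A"
    and large: "\<And>n. X < real n \<Longrightarrow> c n \<le> M * exp (- \<theta> * real n)"
  shows "summable c" "suminf c \<le> (X + 1) * A + M * exp (- \<theta> * X) * (1 + 1 / \<theta>)"
proof -
  define N where "N = Suc (nat \<lfloor>X\<rfloor>)"
  have N: "X < real N" "real N \<le> X + 1" unfolding N_def using X by linarith+
  have less: "real n \<le> X" if "n < N" for n
    using that X unfolding N_def by linarith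
  have M: "0 \<le> M"
  proof -
    have "0 \<le> M * exp (- \<theta> * real N)" using nn[of N] large[OF N(1)] by linarith
    then show ?thesis by (simp add: zero_le_mult_iff)
  qed
  define q where "q = exp (- \<theta>)"
  have q: "0 < q" "q < 1" using \<theta> by (auto simp: q_def)
  have ql: "c (n + N) \<le> M * exp (- \<theta> * X) * q ^ n" for n
  proof -
    have "c (n + N) \<le> M * exp (- \<theta> * real (n + N))" using N by (intro large) simp
    also have "\<dots> \<le> M * (exp (- \<theta> * X) * q ^ n)"
    proof (rule mult_left_mono[OF _ M])
      have "\<theta> * X \<le> \<theta> * real N" using N \<theta> by simp
      then have "- \<theta> * real (n + N) \<le> - \<theta> * X + real n * - \<theta>" by (simp add: algebra_simps)
      then have "exp (- \<theta> * real (n + N)) \<le> exp (- \<theta> * X + real n * - \<theta>)" by (simp only: exp_le_cancel_iff)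
      also have "\<dots> = exp (- \<theta> * X) * q ^ n" unfolding q_def exp_add exp_of_nat_mult ..
      finally show "exp (- \<theta> * real (n + N)) \<le> exp (- \<theta> * X) * q ^ n" .
    qed
    finally show ?thesis by (simp add: mult.assoc)
  qed
  have geo: "(\<lambda>n. M * exp (- \<theta> * X) * q ^ n) sums (M * exp (- \<theta> * X) * (1 / (1 - q)))"
    using q by (intro sums_mult geometric_sums) auto
  have sm: "summable (\<lambda>n. c (n + N))"
  proof (rule summable_comparison_test')
    show "summable (\<lambda>n. M * exp (- \<theta> * X) * q ^ n)" using geo by (rule sums_summable)
    show "norm (c (n + N)) \<le> M * exp (- \<theta> * X) * q ^ n" for n using ql[of n] nn[of "n + N"] by simp
  qed
  then show s: "summable c" by (simp only: summable_iff_shift)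
  have "suminf c = (\<Sum>n. c (n + N)) + (\<Sum>n<N. c n)" by (rule suminf_split_initial_segment[OF s])
  also have "(\<Sum>n. c (n + N)) \<le> M * exp (- \<theta> * X) * (1 / (1 - q))"
    using suminf_le[OF ql sm] geo by (simp add: sums_iff)
  also have "1 / (1 - q) \<le> 1 + 1 / \<theta>"
  proof -
    have "1 + \<theta> \<le> exp \<theta>" by (rule exp_ge_add_one_self)
    then have "q \<le> 1 / (1 + \<theta>)" using \<theta> unfolding q_def exp_minus inverse_eq_divide
      by (intro divide_left_mono) auto
    then have "\<theta> / (1 + \<theta>) \<le> 1 - q" using \<theta> by (simp add: field_simps)
    then have "1 / (1 - q) \<le> 1 / (\<theta> / (1 + \<theta>))" using \<theta> q by (intro divide_left_mono) (auto intro!: mult_pos_pos)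
    also have "\<dots> = 1 + 1 / \<theta>" using \<theta> by (simp add: field_simps)
    finally show ?thesis .
  qed
  also have "(\<Sum>n<N. c n) \<le> (X + 1) * A"
  proof -
    have "(\<Sum>n<N. c n) \<le> (\<Sum>n<N. A)" by (intro sum_mono small less) auto
    also have "\<dots> = real N * A" by simp
    also have "\<dots> \<le> (X + 1) * A" using N A by (intro mult_right_mono) auto
    finally show ?thesis .
  qed
  finally show "suminf c \<le> (X + 1) * A + M * exp (- \<theta> * X) * (1 + 1 / \<theta>)"
    using M by (simp add: mult_left_mono)
qed

context resonant_sample begin

text \<open>At the resonant heights \<open>zeta_lower_asymp\<close> applies; dividing by
  \<open>norm s \<le> 2 * exp t\<close> and removing the polar term gives exactly the stated
  threshold.\<close>

lemma F_not_small:
  assumes "\<forall>\<^sub>F t in at_top. norm (F (Complex (1 - delta 0 t) (exp t))) <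
     exp (99/100 * (t / ln t)) / (2 * exp t) - rho / exp t"
  shows False
proof -
  have "\<forall>\<^sub>F k in sequentially. norm (F (Complex (1 - delta 0 (T k)) (exp (T k)))) <
      exp (99/100 * (T k / ln (T k))) / (2 * exp (T k)) - rho / exp (T k)"
    using eventually_compose_filterlim[OF assms T_at_top] by simp
  moreover have "\<forall>\<^sub>F k in sequentially. 0 < delta 0 (T k) \<and> delta 0 (T k) \<le> 1/10 \<and> 1 < T k"
    using eventually_compose_filterlim[OF delta_asymp(1)[of 0] T_at_top]
      eventually_compose_filterlim[OF delta_asymp(2)[of 0] T_at_top]
      eventually_compose_filterlim[OF eventually_gt_at_top[of 1] T_at_top] by eventually_elim simp
  ultimately have "\<forall>\<^sub>F k in sequentially. False"
    using zeta_lower_asymp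
  proof eventually_elim
    case (elim k)
    define t where "t = T k"
    define s where "s = Complex (1 - delta 0 t) (exp t)"
    have e: "1 \<le> exp t" using elim by (simp add: t_def)
    have ns: "norm s \<le> 2 * exp t"
    proof -
      have "norm s \<le> \<bar>1 - delta 0 t\<bar> + \<bar>exp t\<bar>" unfolding s_def using cmod_le[of "Complex (1 - delta 0 t) (exp t)"] by simp
      then show ?thesis using elim(2) e unfolding t_def by linarith
    qed
    have n1: "exp t \<le> norm (s - 1)" using abs_Im_le_cmod[of "s - 1"] by (simp add: s_def)
    have n0: "exp t \<le> norm s" using abs_Im_le_cmod[of s] by (simp add: s_def)
    have ne: "s \<noteq> 0" "s \<noteq> 1" using n0 n1 e by auto
    have "exp (99/100 * (t / ln t)) / (2 * exp t) \<le> norm (zeta s / s)"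
      unfolding norm_divide using elim(3) ns ne by (intro frac_le) (auto simp: s_def t_def)
    moreover have "norm (of_real rho / (s - 1)) \<le> rho / exp t"
      unfolding norm_divide using n1 rho_pos by (intro frac_le) auto
    moreover have "norm (zeta s / s) - norm (of_real rho / (s - 1)) \<le> norm (F s)"
      unfolding F_eq[OF ne] by (rule norm_triangle_ineq2)
    ultimately show False using elim(1) unfolding s_def t_def by linarith
  qed
  then show False by simp
qed

end

text \<open>With $\delta = \ln t / t$, moving the circle from $\delta$ to $\delta \pm 1/(4t)$ multiplies
  $\tau^\delta$ by $e^{\pm 1/4}$; the constants work because
  $4 (1 - e^{-1/4}) > 4/5$, $4 (e^{1/4} - 1) < 5/4$ and $2 \sqrt 2 \sqrt{4/5} > 5/2 > 1 + 5/4$.\<close>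

definition n_lo :: "real \<Rightarrow> real" where "n_lo t = 4/5 * t\<^sup>2 / ln t"
definition n_hi :: "real \<Rightarrow> real" where "n_hi t = 5/4 * t\<^sup>2 / ln t"
text \<open>Half of \<open>n_lo\<close>: for \<open>n\<close> from \<open>n_lo\<close> on, the part
  of the kernel below this point is negligible by \<open>gamma_ker_le\<close>. Using
  \<open>n / 2\<close> in place of the true centre \<open>n\<close> is affordable with the constant
  \<open>2 * sqrt 2\<close>.\<close>

definition L_lo :: "real \<Rightarrow> real" where "L_lo t = 2/5 * t\<^sup>2 / ln t"

lemma saddle_asymp:
  "\<forall>\<^sub>F t in at_top. exp (- (2 * sqrt 2) * sqrt (L_lo t * ln (L_lo t))) \<le> exp (- (5/2) * t)"
proof -
  have lim: "((\<lambda>t. L_lo t * ln (L_lo t) / t\<^sup>2) \<longlongrightarrow> 4/5) at_top"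
    unfolding L_lo_def by real_asymp
  \<comment> \<open>\<open>2 * sqrt 2 * sqrt q\<close> reaches 5/2 exactly at
    \<open>q = 25/32\<close>; the limit is 4/5 because \<open>ln (L_lo t)\<close> is asymptotic to
    \<open>2 * ln t\<close>.\<close>
  have "(25/32 :: real) < 4/5" by simp
  from order_tendstoD(1)[OF lim this] show ?thesis
    using eventually_gt_at_top[of 1]
  proof eventually_elim
    case (elim t)
    have "2 * (5/4 * t)\<^sup>2 \<le> 2 * (2 * (L_lo t * ln (L_lo t)))"
      using elim by (simp add: power2_eq_square field_simps)
    then have "sqrt ((5/4 * t)\<^sup>2) \<le> sqrt (2 * (L_lo t * ln (L_lo t)))"
      by (intro real_sqrt_le_mono) simp
    then have "5/4 * t \<le> sqrt 2 * sqrt (L_lo t * ln (L_lo t))"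
      using elim by (simp add: real_sqrt_mult)
    then show ?case by simp
  qed
qed

text \<open>Every exponential factor carries the same $e^{-t}$, so only the exponents of order
  $t / \ln t$ have to be compared.\<close>

lemma exp_compare:
  assumes K: "0 < K" and q: "q < 99/100" and E: "\<forall>\<^sub>F t in at_top. E t \<le> - t + q * (t / ln t)"
    and G: "\<forall>\<^sub>F t in at_top. G t \<le> (5/4 * t\<^sup>2 / ln t + 1) * (1 + 5 * t)"
  shows "\<forall>\<^sub>F t in at_top. K * G t * exp (E t) \<le> exp (- t) * exp (99/100 * (t / ln t)) / (16 :: real)"
proof -
  have "0 < 99/100 - q" using q by simp
  then have "\<forall>\<^sub>F t in at_top. K * ((5/4 * t\<^sup>2 / ln t + 1) * (1 + 5 * t)) \<le> exp ((99/100 - q) * (t / ln t)) / 16"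
    using K by real_asymp
  then show ?thesis using E G
  proof eventually_elim
    case (elim t)
    have "K * G t * exp (E t) \<le> exp ((99/100 - q) * (t / ln t)) / 16 * exp (- t + q * (t / ln t))"
      using order_trans[OF mult_left_mono[OF elim(3) less_imp_le[OF K]] elim(1)] elim(2)
      by (intro mult_mono[of _ _ "exp (E t)"]) (simp_all only: exp_le_cancel_iff exp_ge_zero, simp)
    also have "\<dots> = exp (- t) * exp (99/100 * (t / ln t)) / 16"
      by (simp add: algebra_simps flip: exp_add)
    finally show ?case .
  qed
qed

text \<open>Low indices, from the inner circle: \<open>n_lo t / (4 * t)\<close> is
  \<open>1/5 * (t / ln t)\<close>, and 1573/2000 + 1/5 is below 99/100.\<close>

lemma total_asymp1:
  assumes "0 < K"
  shows "\<forall>\<^sub>F t in at_top. K * ((n_hi t + 1) * (exp (- t) * exp (1573/2000 * (t / ln t)) * exp (n_lo t / (4 * t)))) \<le>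
    exp (- t) * exp (99/100 * (t / ln t)) / 16"
proof -
  have "\<forall>\<^sub>F t in at_top. K * (n_hi t + 1) * exp (- t + 1573/2000 * (t / ln t) + n_lo t / (4 * t)) \<le>
      exp (- t) * exp (99/100 * (t / ln t)) / 16"
  proof (rule exp_compare[OF assms])
    show "\<forall>\<^sub>F t in at_top. - t + 1573/2000 * (t / ln t) + n_lo t / (4 * t) \<le> - t + 1973/2000 * (t / ln t)"
      using eventually_gt_at_top[of 1] by eventually_elim (simp add: n_lo_def power2_eq_square field_simps)
    show "\<forall>\<^sub>F t in at_top. n_hi t + 1 \<le> (5/4 * t\<^sup>2 / ln t + 1) * (1 + 5 * t)"
      unfolding n_hi_def by real_asymp
  qed simp
  then show ?thesis by (simp only: exp_add mult.assoc)
qed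

text \<open>Middle indices, part of the kernel below \<open>L_lo\<close>: the exponent is (0.4 -
  0.408) times \<open>t^2 / ln t\<close>, which is negative and of larger order than
  \<open>t\<close>.\<close>

lemma total_asymp2:
  assumes "0 < K"
  shows "\<forall>\<^sub>F t in at_top. K * ((n_hi t + 1) * (L_lo t * exp (L_lo t) * exp (- (51/100) * n_lo t))) \<le>
    exp (- t) * exp (99/100 * (t / ln t)) / 16"
proof -
  have "\<forall>\<^sub>F t in at_top. K * ((n_hi t + 1) * (L_lo t * exp (- (8/1000) * t\<^sup>2 / ln t))) \<le> exp (- t) * exp (99/100 * (t / ln t)) / 16"
    unfolding n_hi_def L_lo_def using assms by real_asymp
  moreover have "exp (L_lo t) * exp (- (51/100) * n_lo t) = exp (- (8/1000) * t\<^sup>2 / ln t)" for t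
    unfolding exp_add[symmetric] n_lo_def L_lo_def by (simp add: algebra_simps)
  ultimately show ?thesis by (simp only: mult.assoc)
qed

text \<open>Middle indices, part from the one-sided hypothesis: \<open>delta 0 t * n_hi t\<close> is
  \<open>5/4 * t\<close>, so the total exponent -5/4 beats the factor
  \<open>exp (- t)\<close>.\<close>

lemma total_asymp3:
  assumes "0 < K"
  shows "\<forall>\<^sub>F t in at_top. K * ((n_hi t + 1) * (exp (- (5/2) * t) * exp (delta 0 t * n_hi t))) \<le>
    exp (- t) * exp (99/100 * (t / ln t)) / 16"
proof -
  have "\<forall>\<^sub>F t in at_top. K * ((n_hi t + 1) * exp (- (5/4) * t)) \<le> exp (- t) * exp (99/100 * (t / ln t)) / 16"
    unfolding n_hi_def using assms by real_asymp
  then show ?thesis using eventually_gt_at_top[of 1]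
  proof eventually_elim
    case (elim t)
    have "exp (- (5/2) * t) * exp (delta 0 t * n_hi t) = exp (- (5/4) * t)"
      unfolding exp_add[symmetric] n_hi_def delta_def using elim by (simp add: power2_eq_square)
    then show ?case using elim by simp
  qed
qed

text \<open>Middle indices, contribution of the coefficients at the real point 2.\<close>

lemma total_asymp4:
  assumes "0 < K"
  shows "\<forall>\<^sub>F t in at_top. K * ((n_hi t + 1) * exp (- (3/20) * n_lo t)) \<le>
    exp (- t) * exp (99/100 * (t / ln t)) / 16"
  unfolding n_lo_def n_hi_def using assms by real_asymp

text \<open>High indices, from the outer circle: the geometric decay gains at least 5/16 / 1.01
  times \<open>t / ln t\<close>, which brings 1.294 below 0.988; the last factor is the one of the
  geometric series.\<close>

lemma total_asymp5:
  assumes "0 < K"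
  shows "\<forall>\<^sub>F t in at_top. K * (exp (- t) * exp (1294/1000 * (t / ln t)) * exp (- (1 / (4 * t * (1 + delta (1/4) t))) * n_hi t) *
      (1 + 1 / (1 / (4 * t * (1 + delta (1/4) t))))) \<le>
    exp (- t) * exp (99/100 * (t / ln t)) / 16"
proof -
  define E where "E t = - t + 1294/1000 * (t / ln t) + - (1 / (4 * t * (1 + delta (1/4) t))) * n_hi t" for t
  have d: "\<forall>\<^sub>F t in at_top. 0 < delta (1/4) t \<and> delta (1/4) t \<le> 1/100"
    unfolding delta_def by (intro eventually_conj) real_asymp+
  have "\<forall>\<^sub>F t in at_top. K * (1 + 1 / (1 / (4 * t * (1 + delta (1/4) t)))) * exp (E t) \<le>
      exp (- t) * exp (99/100 * (t / ln t)) / 16"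
  proof (rule exp_compare[OF assms])
    show "\<forall>\<^sub>F t in at_top. 1 + 1 / (1 / (4 * t * (1 + delta (1/4) t))) \<le> (5/4 * t\<^sup>2 / ln t + 1) * (1 + 5 * t)"
      unfolding delta_def by real_asymp
    show "\<forall>\<^sub>F t in at_top. E t \<le> - t + 988/1000 * (t / ln t)"
      using d eventually_gt_at_top[of 1]
    proof eventually_elim
      case (elim t)
      define c where "c = 1 + delta (1/4) t"
      have "1 / (4 * t * c) * n_hi t = (t * (5/4 * (t / ln t))) / (t * (4 * c))"
        by (simp add: n_hi_def power2_eq_square mult_ac)
      also have "\<dots> = (5/4 * (t / ln t)) / (4 * c)"
        by (rule mult_divide_mult_cancel_left) (use elim in simp)
      finally have "1 / (4 * t * c) * n_hi t = 5/16 * (t / ln t) / c" by simp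
      moreover have "5/16 * (t / ln t) / (101/100) \<le> 5/16 * (t / ln t) / c"
        using elim by (intro divide_left_mono) (auto simp: c_def)
      moreover have "0 < t / ln t" using elim by simp
      ultimately show ?case unfolding E_def c_def by simp
    qed
  qed simp
  then show ?thesis unfolding E_def by (simp only: exp_add mult_ac)
qed

lemma total_asymp6: "\<forall>\<^sub>F t in at_top. K * exp (- t) \<le> exp (- t) * exp (99/100 * (t / ln t)) / (16 :: real)"
proof -
  have "\<forall>\<^sub>F t in at_top. K \<le> exp (99/100 * (t / ln t)) / (16 :: real)" by real_asymp
  then show ?thesis
  proof eventually_elim
    case (elim t)
    then have "exp (- t) * K \<le> exp (- t) * (exp (99/100 * (t / ln t)) / 16)" by (intro mult_left_mono) auto
    then show ?case by (simp add: mult.commute)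
  qed
qed

context resonant_sample begin

lemma coef_eventually_small:
  fixes sg :: real
  assumes sg: "\<bar>sg\<bar> = 1"
    and one: "\<forall>\<^sub>F L in at_top. sg * (a L - rho) \<le> exp (- (2 * sqrt 2) * sqrt (L * ln L))"
  shows "\<forall>\<^sub>F t in at_top. \<forall>n. norm (coef n (exp t)) \<le> 2 * (1 + rho) * exp (- t) * exp (1573/2000 * (t / ln t)) / (1 + delta (- (1/4)) t) ^ n \<and>
     norm (coef n (exp t)) \<le> 2 * (1 + rho) * exp (- t) * exp (1294/1000 * (t / ln t)) / (1 + delta (1/4) t) ^ n"
    "\<exists>B>0. \<exists>CF>0. \<forall>\<^sub>F t in at_top. \<forall>n. norm (coef n (exp t)) \<le>
       2 * (B * L_lo t * exp (L_lo t) / 2 ^ n + exp (- (5/2) * t)) + CF / (13/10) ^ n"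
proof -
  have c1: "(201/200) * exp (- (1/4)) + 1/500 \<le> (1573/2000 :: real)" using exp_quarter(2) by simp
  have c2: "(201/200) * exp (1/4) + 1/500 \<le> (1294/1000 :: real)" using exp_quarter(1) by simp
  show "\<forall>\<^sub>F t in at_top. \<forall>n. norm (coef n (exp t)) \<le> 2 * (1 + rho) * exp (- t) * exp (1573/2000 * (t / ln t)) / (1 + delta (- (1/4)) t) ^ n \<and>
     norm (coef n (exp t)) \<le> 2 * (1 + rho) * exp (- t) * exp (1294/1000 * (t / ln t)) / (1 + delta (1/4) t) ^ n"
    using F_circle_asymp[OF c1] F_circle_asymp[OF c2] delta_asymp(1)[of "1/4"] delta_asymp(1)[of "- (1/4)"]
      delta_asymp(2)[of "1/4"] delta_asymp(2)[of "- (1/4)"]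
  proof eventually_elim
    case (elim t)
    show ?case
      using elim by (intro allI conjI norm_coef_le_Cauchy) auto
  qed
  obtain B where B: "B > 0" "\<And>L. \<bar>a L - rho\<bar> \<le> B" using a_diff_bounded by blast
  obtain CF where CF: "CF > 0" "\<And>n. norm (coef n 0) \<le> CF / (13/10) ^ n" using norm_coef_0_le by blast
  obtain L0 where L0: "\<And>L. L0 \<le> L \<Longrightarrow> sg * (a L - rho) \<le> exp (- (2 * sqrt 2) * sqrt (L * ln L))"
    using one by (auto simp: eventually_at_top_linorder)
  have "\<forall>\<^sub>F t in at_top. L0 \<le> L_lo t" unfolding L_lo_def by real_asymp
  moreover have "\<forall>\<^sub>F t in at_top. 1 \<le> L_lo t" unfolding L_lo_def by real_asymp
  ultimately have "\<forall>\<^sub>F t in at_top. \<forall>n. norm (coef n (exp t)) \<le>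
       2 * (B * L_lo t * exp (L_lo t) / 2 ^ n + exp (- (5/2) * t)) + CF / (13/10) ^ n"
    using saddle_asymp
  proof eventually_elim
    case (elim t)
    show ?case
    proof
      fix n
      have "norm (coef n (exp t)) \<le> 2 * (B * L_lo t * exp (L_lo t) / 2 ^ n + exp (- (5/2) * t)) + norm (coef n 0)"
      proof (rule norm_coef_le_one_sided[OF sg])
        fix L assume L: "L_lo t \<le> L"
        have "sg * (a L - rho) \<le> exp (- (2 * sqrt 2) * sqrt (L * ln L))" using L elim by (intro L0) simp
        also have "\<dots> \<le> exp (- (2 * sqrt 2) * sqrt (L_lo t * ln (L_lo t)))"
        proof -
          have "L_lo t * ln (L_lo t) \<le> L * ln L" using L elim by (intro mult_mono) auto
          then show ?thesis by simp
        qed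
        also have "\<dots> \<le> exp (- (5/2) * t)" by (rule elim)
        finally show "sg * (a L - rho) \<le> exp (- (5/2) * t)" .
      qed (use elim B in auto)
      then show "norm (coef n (exp t)) \<le> 2 * (B * L_lo t * exp (L_lo t) / 2 ^ n + exp (- (5/2) * t)) + CF / (13/10) ^ n"
        using CF(2)[of n] by linarith
    qed
  qed
  then show "\<exists>B>0. \<exists>CF>0. \<forall>\<^sub>F t in at_top. \<forall>n. norm (coef n (exp t)) \<le>
       2 * (B * L_lo t * exp (L_lo t) / 2 ^ n + exp (- (5/2) * t)) + CF / (13/10) ^ n"
    using B CF by blast
qed

lemma pow_ratio_le_exp:
  assumes "0 < q" "q \<le> p" "(p - q) / q \<le> e"
  shows "(p / q) ^ n \<le> exp (e * real n)"
proof -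
  have "p / q = 1 + (p - q) / q" using assms by (simp add: field_simps)
  also have "\<dots> \<le> exp ((p - q) / q)" by (rule exp_ge_add_one_self)
  also have "\<dots> \<le> exp e" using assms by simp
  finally have "(p / q) ^ n \<le> exp e ^ n" using assms by (intro power_mono) auto
  then show ?thesis by (simp only: exp_of_nat2_mult)
qed

lemma pow_ratio_le_exp_neg:
  assumes "0 < p" "p \<le> q" "e \<le> (q - p) / q"
  shows "(p / q) ^ n \<le> exp (- e * real n)"
proof -
  have "p / q = 1 + - ((q - p) / q)" using assms by (simp add: field_simps)
  also have "\<dots> \<le> exp (- ((q - p) / q))" by (rule exp_ge_add_one_self)
  also have "\<dots> \<le> exp (- e)" using assms by simp
  finally have "(p / q) ^ n \<le> exp (- e) ^ n" using assms by (intro power_mono) auto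
  then show ?thesis by (simp only: exp_of_nat2_mult)
qed

text \<open>The Taylor coefficients at $2 + i\tau$ with index below \<open>n_lo t\<close> or above \<open>n_hi t\<close> are controlled by
  Cauchy's estimate on slightly smaller and slightly larger circles than the one through
  $1 - \delta + i\tau$; only the indices in between need the one-sided hypothesis.\<close>

theorem no_one_sided_bound:
  fixes sg :: real
  assumes sg: "\<bar>sg\<bar> = 1"
    and one: "\<forall>\<^sub>F L in at_top. sg * (a L - rho) \<le> exp (- (2 * sqrt 2) * sqrt (L * ln L))"
  shows False
proof -
  obtain B CF where BC: "B > 0" "CF > 0" "\<forall>\<^sub>F t in at_top. \<forall>n. norm (coef n (exp t)) \<le>
       2 * (B * L_lo t * exp (L_lo t) / 2 ^ n + exp (- (5/2) * t)) + CF / (13/10) ^ n"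
    using coef_eventually_small(2)[OF sg one] by blast
  have r: "0 < 2 * (1 + rho)" using rho_pos by simp
  have "\<forall>\<^sub>F t in at_top. norm (F (Complex (1 - delta 0 t) (exp t))) <
     exp (99/100 * (t / ln t)) / (2 * exp t) - rho / exp t"
    using coef_eventually_small(1)[OF sg one] BC(3) delta_asymp(1)[of 0] delta_asymp(2)[of 0]
      delta_asymp(1)[of "- (1/4)"] eventually_gt_at_top[of "1 :: real"]
      total_asymp1[OF r] total_asymp2[of "2 * B", OF mult_pos_pos[OF zero_less_numeral BC(1)]]
      total_asymp3[of 2, OF zero_less_numeral] total_asymp4[of CF, OF BC(2)]
      total_asymp5[OF r] total_asymp6[of rho]
  proof eventually_elim
    case (elim t)
    define d where "d = delta 0 t"
    define d1 where "d1 = delta (1/4) t"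
    define d2 where "d2 = delta (- (1/4)) t"
    define W where "W = exp (- t) * exp (99/100 * (t / ln t))"
    define M1 where "M1 = 2 * (1 + rho) * exp (- t) * exp (1294/1000 * (t / ln t))"
    define M2 where "M2 = 2 * (1 + rho) * exp (- t) * exp (1573/2000 * (t / ln t))"
    \<comment> \<open>Bound for the middle indices: kernel below \<open>L_lo\<close>, one-sided
      hypothesis beyond it, and the coefficients at the real point.\<close>
    define Q where "Q = 2 * B * L_lo t * exp (L_lo t) * exp (- (51/100) * n_lo t) +
      2 * exp (- (5/2) * t) * exp (d * n_hi t) + CF * exp (- (3/20) * n_lo t)"
    \<comment> \<open>Since \<open>d1 - d = 1 / (4 * t)\<close>, this is
      \<open>1 - (1 + d) / (1 + d1)\<close>, the decay rate of the ratio of the two radii.\<close>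
    define \<theta> where "\<theta> = 1 / (4 * t * (1 + d1))"
    define c where "c n = norm (coef n (exp t)) * (1 + d) ^ n" for n
    have t: "1 < t" "0 < ln t" using elim by auto
    have d: "0 < d" "d \<le> 1/10" "0 < d2" using elim by (auto simp: d_def d2_def)
    have diffs: "d1 - d = 1 / (4 * t)" "d - d2 = 1 / (4 * t)"
      using t by (simp_all add: d_def d1_def d2_def delta_def field_simps)
    moreover have "0 < 1 / (4 * t)" using t by simp
    ultimately have dd: "d < d1" "d2 < d" by linarith+
    have M: "0 < M1" "0 < M2" using r by (simp_all add: M1_def M2_def)
    have X: "0 \<le> n_hi t" "0 \<le> n_lo t" "0 \<le> L_lo t" "L_lo t = n_lo t / 2" using t by (simp_all add: n_hi_def n_lo_def L_lo_def)
    have \<theta>: "0 < \<theta>" using t d dd by (simp add: \<theta>_def)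
    have c1: "norm (coef n (exp t)) \<le> M1 / (1 + d1) ^ n" and c2: "norm (coef n (exp t)) \<le> M2 / (1 + d2) ^ n"
      and c3: "norm (coef n (exp t)) \<le> 2 * (B * L_lo t * exp (L_lo t) / 2 ^ n + exp (- (5/2) * t)) + CF / (13/10) ^ n" for n
      using elim(1)[rule_format, of n] elim(2)[rule_format, of n] unfolding M1_def M2_def d1_def d2_def by auto
    have low: "c n \<le> M2 * exp (n_lo t / (4 * t))" if n: "real n \<le> n_lo t" for n
    proof -
      have "c n \<le> M2 / (1 + d2) ^ n * (1 + d) ^ n" unfolding c_def using d by (intro mult_right_mono c2) auto
      also have "\<dots> = M2 * ((1 + d) / (1 + d2)) ^ n" by (simp add: power_divide)
      also have "((1 + d) / (1 + d2)) ^ n \<le> exp (1 / (4 * t) * real n)"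
      proof (rule pow_ratio_le_exp)
        have "((1 + d) - (1 + d2)) / (1 + d2) = (1 / (4 * t)) / (1 + d2)" using diffs by simp
        also have "\<dots> \<le> (1 / (4 * t)) / 1" using d t by (intro divide_left_mono) auto
        finally show "((1 + d) - (1 + d2)) / (1 + d2) \<le> 1 / (4 * t)" by simp
      qed (use d dd in auto)
      also have "exp (1 / (4 * t) * real n) \<le> exp (n_lo t / (4 * t))" using n t by (simp add: divide_right_mono)
      finally show ?thesis using M by (simp add: mult_left_mono)
    qed
    have mid: "c n \<le> Q" if n: "n_lo t \<le> real n" "real n \<le> n_hi t" for n
    proof -
      \<comment> \<open>\<open>d \<le> 1/10\<close> gives the base 11/20, and
        \<open>exp (51/100) \<le> 20/11\<close>; the rate must exceed 1/2 to beat
        \<open>exp (L_lo t)\<close> with \<open>L_lo t = n_lo t / 2\<close>.\<close>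
      have e1: "((1 + d) / 2) ^ n \<le> exp (- (51/100) * n_lo t)"
      proof -
        have "exp (51/100) \<le> 1 + 51/100 + (51/100 :: real)\<^sup>2" by (rule exp_bound) auto
        then have "exp (51/100) \<le> (20/11 :: real)" by (simp add: power2_eq_square)
        then have "1 / (20/11) \<le> 1 / exp (51/100 :: real)" by (intro divide_left_mono) auto
        then have "(11/20 :: real) \<le> exp (- (51/100))" by (simp add: exp_minus inverse_eq_divide)
        then have "((1 + d) / 2) ^ n \<le> exp (- (51/100)) ^ n" using d by (intro power_mono) auto
        also have "\<dots> = exp (- (51/100) * real n)" by (rule exp_of_nat2_mult[symmetric])
        also have "\<dots> \<le> exp (- (51/100) * n_lo t)" using n by simp
        finally show ?thesis .
      qed
      \<comment> \<open>With \<open>d \<le> 1/10\<close> the ratio is at most 11/13, that is 1 -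
        2/13, and 2/13 exceeds 3/20.\<close>
      have e2: "((1 + d) / (13/10)) ^ n \<le> exp (- (3/20) * n_lo t)"
      proof -
        have "((1 + d) / (13/10)) ^ n \<le> exp (- (3/20) * real n)"
          by (rule pow_ratio_le_exp_neg) (use d in auto)
        also have "\<dots> \<le> exp (- (3/20) * n_lo t)" using n by simp
        finally show ?thesis .
      qed
      have e3: "(1 + d) ^ n \<le> exp (d * n_hi t)"
      proof -
        have "(1 + d) ^ n \<le> exp d ^ n" using d by (intro power_mono exp_ge_add_one_self) auto
        also have "\<dots> = exp (d * real n)" by (rule exp_of_nat2_mult[symmetric])
        also have "\<dots> \<le> exp (d * n_hi t)" using n d by simp
        finally show ?thesis .
      qed
      have "c n \<le> (2 * (B * L_lo t * exp (L_lo t) / 2 ^ n + exp (- (5/2) * t)) + CF / (13/10) ^ n) * (1 + d) ^ n"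
        unfolding c_def using d by (intro mult_right_mono c3) auto
      also have "\<dots> = 2 * B * L_lo t * exp (L_lo t) * ((1 + d) / 2) ^ n + 2 * exp (- (5/2) * t) * (1 + d) ^ n + CF * ((1 + d) / (13/10)) ^ n"
        by (simp only: power_divide) (simp add: field_simps)
      also have "\<dots> \<le> Q"
        unfolding Q_def using e1 e2 e3 BC X by (intro add_mono mult_left_mono) auto
      finally show ?thesis .
    qed
    have high: "c n \<le> M1 * exp (- \<theta> * real n)" for n
    proof -
      have "c n \<le> M1 / (1 + d1) ^ n * (1 + d) ^ n" unfolding c_def using d by (intro mult_right_mono c1) auto
      also have "\<dots> = M1 * ((1 + d) / (1 + d1)) ^ n" by (simp add: power_divide)
      also have "((1 + d) / (1 + d1)) ^ n \<le> exp (- \<theta> * real n)"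
      proof (rule pow_ratio_le_exp_neg)
        have "((1 + d1) - (1 + d)) / (1 + d1) = (1 / (4 * t)) / (1 + d1)" using diffs by simp
        then show "\<theta> \<le> ((1 + d1) - (1 + d)) / (1 + d1)" by (simp add: \<theta>_def)
      qed (use d dd in auto)
      finally show ?thesis using M by (simp add: mult_left_mono)
    qed
    have Q0: "0 \<le> Q" unfolding Q_def using BC X by (intro add_nonneg_nonneg mult_nonneg_nonneg) auto
    have all: "c n \<le> M2 * exp (n_lo t / (4 * t)) + Q" if "real n \<le> n_hi t" for n
      using low[of n] mid[of n] that Q0 M by (cases "real n \<le> n_lo t") (auto intro: add_increasing add_increasing2)
    have A0: "0 \<le> M2 * exp (n_lo t / (4 * t)) + Q" using M Q0 by simp
    have c0: "0 \<le> c n" for n using d by (simp add: c_def)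
    note split = suminf_le_split[OF X(1) \<theta> A0 c0 all high]
    have total: "norm (F (Complex (1 - d) (exp t))) \<le>
        (n_hi t + 1) * (M2 * exp (n_lo t / (4 * t)) + Q) + M1 * exp (- \<theta> * n_hi t) * (1 + 1 / \<theta>)"
      using F_le_sum_coef[of d "exp t"] split d unfolding c_def by linarith
    have b1: "(n_hi t + 1) * (M2 * exp (n_lo t / (4 * t))) \<le> W / 16"
      using elim(7) unfolding M2_def W_def by (simp only: mult_ac)
    have b2: "(n_hi t + 1) * (2 * B * L_lo t * exp (L_lo t) * exp (- (51/100) * n_lo t)) \<le> W / 16"
      using elim(8) unfolding W_def by (simp only: mult_ac)
    have b3: "(n_hi t + 1) * (2 * exp (- (5/2) * t) * exp (d * n_hi t)) \<le> W / 16"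
      using elim(9) unfolding W_def d_def by (simp only: mult_ac)
    have b4: "(n_hi t + 1) * (CF * exp (- (3/20) * n_lo t)) \<le> W / 16"
      using elim(10) unfolding W_def by (simp only: mult_ac)
    have b5: "M1 * exp (- \<theta> * n_hi t) * (1 + 1 / \<theta>) \<le> W / 16"
      using elim(11) unfolding W_def M1_def \<theta>_def d1_def by (simp only: mult_ac)
    have b6: "rho / exp t \<le> W / 16"
    proof -
      have "rho / exp t = rho * exp (- t)" by (simp add: exp_minus field_simps)
      then show ?thesis using elim(12) unfolding W_def by (simp only:)
    qed
    have W0: "0 < W" by (simp add: W_def)
    \<comment> \<open>Five contributions to \<open>F\<close> and the polar term, each at most
      \<open>W / 16\<close>, stay below the threshold \<open>W / 2\<close>.\<close>
    have "(n_hi t + 1) * (M2 * exp (n_lo t / (4 * t)) + Q) \<le> W / 16 + W / 16 + W / 16 + W / 16"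
      unfolding Q_def distrib_left using b1 b2 b3 b4 by linarith
    moreover have "exp (99/100 * (t / ln t)) / (2 * exp t) = W / 2"
      by (simp add: W_def exp_minus field_simps)
    ultimately have "norm (F (Complex (1 - d) (exp t))) < exp (99/100 * (t / ln t)) / (2 * exp t) - rho / exp t"
      using total b5 b6 W0 by linarith
    then show ?case by (simp only: d_def)
  qed
  then show False by (rule F_not_small)
qed

end

section \<open>Construction of the systems\<close>

context beurling_sample begin

definition p :: "nat \<Rightarrow> real" where "p j = exp (l j)"

lemma beurling_primes_p: "beurling_primes p"
  unfolding beurling_primes_def
proof (intro conjI)
  show "mono p" by (auto simp: p_def intro!: monoI l_mono)
  show "1 < p 0" by (simp add: p_def)
  show "\<not> bdd_above (range p)"
  proof
    assume "bdd_above (range p)"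
    then obtain K where K: "\<And>j. p j \<le> K" by (auto simp: bdd_above_def)
    have "\<forall>\<^sub>F j in sequentially. K < l j" using l_at_top by (simp add: filterlim_at_top_dense)
    then obtain j where "K < l j" by (auto simp: eventually_sequentially)
    moreover have "l j < exp (l j)" using exp_ge_add_one_self[of "l j"] by linarith
    ultimately show False using K[of j] by (simp add: p_def)
  qed
qed

lemma prod_p: "(\<Prod>j\<in>#M. p j) = exp (Lam M)"
  by (induction M) (auto simp: p_def Lam_def exp_add)

lemma bN_p: "0 < x \<Longrightarrow> bN p x = x * a (ln x)"
proof -
  assume x: "0 < x"
  then have "{M. (\<Prod>j\<in>#M. p j) \<le> x} = Ints (ln x)"
    by (auto simp: prod_p Ints_def ln_ge_iff)
  then show ?thesis using x by (simp add: bN_def a_def Nc_def exp_minus)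
qed

lemma bpi_p: "0 < x \<Longrightarrow> bpi p x = J (ln x)"
  by (simp add: bpi_def J_def p_def ln_ge_iff)

lemma bN_density: "bN p \<sim>[at_top] (\<lambda>x. rho * x)"
proof (rule asymp_equivI')
  have "((\<lambda>x. a (ln x) / rho) \<longlongrightarrow> rho / rho) at_top"
    using rho_pos by (intro tendsto_divide tendsto_const filterlim_compose[OF density(1) ln_at_top]) auto
  then have "((\<lambda>x. a (ln x) / rho) \<longlongrightarrow> 1) at_top" using rho_pos by simp
  then show "((\<lambda>x. bN p x / (rho * x)) \<longlongrightarrow> 1) at_top"
    by (rule Lim_transform_eventually)
      (use bN_p in \<open>auto intro!: eventually_mono[OF eventually_gt_at_top[of 0]]\<close>)
qed

lemma J_close: assumes "0 \<le> Y" shows "\<bar>real (J Y) - integral {0..Y} f\<bar> \<le> 1"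
proof -
  have mono: "integral {0..c} f \<le> integral {0..d} f" if "c \<le> d" for c d
    using that by (intro integral_subset_le f_integrable) (auto intro: f_nonneg)
  have "integral {0..Y} f \<le> integral {0..lam (Suc (J Y))} f"
    using lam_le_of_J(2)[OF assms] by (intro mono) simp
  then have "integral {0..Y} f \<le> real (J Y) + 1" by (simp add: integral_f_lam)
  moreover have "real (J Y) - 1 \<le> integral {0..Y} f"
  proof (cases "J Y")
    case 0
    have "0 \<le> integral {0..Y} f" using mono[OF assms] by simp
    then show ?thesis using 0 by simp
  next
    case (Suc n)
    have "integral {0..lam n} f \<le> integral {0..Y} f" by (intro mono lam_le_of_J(3)[OF assms Suc])
    then show ?thesis using Suc by (simp add: integral_f_lam)
  qed
  ultimately show ?thesis by linarith
qed

lemma bpi_close: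
  assumes "1 \<le> x" shows "\<bar>bpi p x - integral {0..ln x} f\<bar> \<le> 1"
  using J_close[of "ln x"] bpi_p[of x] assms by simp

end

context resonant_sample begin

text \<open>A limit superior that is at most 0 makes the quotient eventually smaller than 1, which
  is already the one-sided bound excluded above; \<open>sg\<close> covers both directions.\<close>

lemma one_sided_false:
  fixes sg c :: real
  assumes sg: "\<bar>sg\<bar> = 1" and c: "2 * sqrt 2 < c"
    and ev: "\<forall>\<^sub>F x in at_top. sg * ((bN p x - rho * x) / (x * exp (- c * sqrt (ln x * ln (ln x))))) < 1"
  shows False
proof (rule no_one_sided_bound[OF sg])
  have "\<forall>\<^sub>F L in at_top. sg * ((bN p (exp L) - rho * exp L) / (exp L * exp (- c * sqrt (ln (exp L) * ln (ln (exp L)))))) < 1"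
    using eventually_compose_filterlim[OF ev exp_at_top] by simp
  then show "\<forall>\<^sub>F L in at_top. sg * (a L - rho) \<le> exp (- (2 * sqrt 2) * sqrt (L * ln L))"
    using eventually_ge_at_top[of 1]
  proof eventually_elim
    case (elim L)
    define e where "e = exp (- c * sqrt (L * ln L))"
    have e: "0 < e" by (simp add: e_def)
    have "(bN p (exp L) - rho * exp L) / (exp L * e) = (a L - rho) / e"
      using e by (simp add: bN_p field_simps)
    then have "sg * (a L - rho) / e < 1" using elim by (simp add: e_def)
    then have "sg * (a L - rho) < e" using e by (simp add: divide_less_eq)
    also have "e \<le> exp (- (2 * sqrt 2) * sqrt (L * ln L))"
      unfolding e_def exp_le_cancel_iff using c elim by (intro mult_right_mono) auto
    finally show ?case by simp
  qed
qed

lemma Omega_pm_bN: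
  assumes c: "2 * sqrt 2 < c"
  shows "Omega_pm (\<lambda>x. bN p x - rho * x) (\<lambda>x. x * exp (- c * sqrt (ln x * ln (ln x))))"
  unfolding Omega_pm_def
proof (intro conjI; rule ccontr)
  let ?q = "\<lambda>x. (bN p x - rho * x) / (x * exp (- c * sqrt (ln x * ln (ln x))))"
  assume "\<not> 0 < Limsup at_top (\<lambda>x. ereal (?q x))"
  then have "Limsup at_top (\<lambda>x. ereal (?q x)) \<le> 0" by (simp only: not_less)
  also have "(0 :: ereal) < 1" by simp
  finally have "Limsup at_top (\<lambda>x. ereal (?q x)) < 1" .
  then have "\<forall>\<^sub>F x in at_top. ereal (?q x) < 1" by (rule Limsup_lessD)
  then have "\<forall>\<^sub>F x in at_top. 1 * ?q x < 1" by simp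
  then show False using one_sided_false[of 1 c] c by simp
next
  let ?q = "\<lambda>x. (bN p x - rho * x) / (x * exp (- c * sqrt (ln x * ln (ln x))))"
  assume "\<not> Liminf at_top (\<lambda>x. ereal (?q x)) < 0"
  then have ge: "0 \<le> Liminf at_top (\<lambda>x. ereal (?q x))" by (simp only: not_less)
  have "(- 1 :: ereal) < 0" by simp
  from less_le_trans[OF this ge] have "- 1 < Liminf at_top (\<lambda>x. ereal (?q x))" .
  then have "\<forall>\<^sub>F x in at_top. - 1 < ereal (?q x)" by (rule less_LiminfD)
  then have "\<forall>\<^sub>F x in at_top. - 1 * ?q x < 1"
  proof eventually_elim
    case (elim x)
    then have "- 1 < ?q x" by (simp add: one_ereal_def)
    then show ?case by linarith
  qed
  then show False using one_sided_false[of "- 1" c] c by simp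
qed

end

section \<open>Existence of resonant systems for a given density\<close>

lemma exists_lattice_point:
  fixes lo hi \<tau> :: real
  assumes "0 < \<tau>" "2 * pi / \<tau> \<le> hi - lo"
  shows "\<exists>v. lo < v \<and> v \<le> hi \<and> exp (- \<i> * of_real (\<tau> * v)) = 1"
proof -
  define n where "n = \<lfloor>\<tau> * hi / (2 * pi)\<rfloor>"
  define v where "v = 2 * pi * of_int n / \<tau>"
  have n: "of_int n \<le> \<tau> * hi / (2 * pi)" "\<tau> * hi / (2 * pi) < of_int n + 1"
    unfolding n_def by linarith+
  have "v \<le> hi" using n(1) assms by (simp add: v_def field_simps)
  moreover have "lo < v"
  proof -
    have "\<tau> * hi < 2 * pi * of_int n + 2 * pi" using n(2) by (simp add: field_simps)
    then have "hi < v + 2 * pi / \<tau>" using assms by (simp add: v_def field_simps)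
    then show ?thesis using assms by linarith
  qed
  moreover have "exp (- \<i> * of_real (\<tau> * v)) = 1"
  proof -
    have "- \<i> * of_real (\<tau> * v) = 2 * of_real pi * of_int (- n) * \<i>"
      using assms by (simp add: v_def)
    then show ?thesis using exp_integer_2pi[of "of_int (- n)"] by (simp add: mult_ac)
  qed
  ultimately show ?thesis by blast
qed

text \<open>The \<open>lam j\<close> are quantiles of \<open>f\<close>, obtained from the
  intermediate value theorem. A cell belongs to at most one window, so lattice points for different
  \<tau> never compete for the same prime.\<close>

theorem exists_resonant_sample:
  fixes f :: "real \<Rightarrow> real" and C0 :: real
  assumes f_cont: "continuous_on {0..} f"
    and f_ge: "\<And>v. 0 \<le> v \<Longrightarrow> 1/2 \<le> f v"
    and f_le: "\<And>v. 0 \<le> v \<Longrightarrow> f v \<le> wgt v"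
    and f_close: "\<And>v. 0 \<le> v \<Longrightarrow> wgt v - f v \<le> C0 * exp (v / 2)"
  shows "\<exists>lam l T. resonant_sample f C0 lam l T"
proof -
  define \<Phi> where "\<Phi> V = integral {0..V} f" for V
  have int: "f integrable_on {c..d}" if "0 \<le> c" for c d
    using that by (intro integrable_continuous_interval continuous_on_subset[OF f_cont]) auto
  have step: "\<Phi> d - \<Phi> c = integral {c..d} f" if "0 \<le> c" "c \<le> d" for c d
    unfolding \<Phi>_def using Henstock_Kurzweil_Integration.integral_combine[where a = 0 and c = c and b = d and f = f] int that by simp
  have growth: "(d - c) / 2 \<le> \<Phi> d - \<Phi> c" if "0 \<le> c" "c \<le> d" for c d
  proof -
    have "integral {c..d} (\<lambda>_. 1/2 :: real) \<le> integral {c..d} f"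
      using that f_ge by (intro integral_le int) auto
    then show ?thesis using step[OF that] that by simp
  qed
  have "\<exists>V\<ge>0. \<Phi> V = real j" for j
  proof -
    have "continuous_on {0..2 * real j} \<Phi>"
      unfolding \<Phi>_def by (intro indefinite_integral_continuous_1 int) auto
    moreover have "\<Phi> 0 \<le> real j" by (simp add: \<Phi>_def)
    moreover have "real j \<le> \<Phi> (2 * real j)" using growth[of 0 "2 * real j"] by (simp add: \<Phi>_def)
    ultimately have "\<exists>V\<ge>0. V \<le> 2 * real j \<and> \<Phi> V = real j" by (intro IVT') auto
    then show ?thesis by blast
  qed
  then obtain lam where lam: "\<And>j. 0 \<le> lam j" "\<And>j. \<Phi> (lam j) = real j" by metis
  have lam0: "lam 0 = 0" using growth[of 0 "lam 0"] lam[of 0] by (simp add: \<Phi>_def)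
  have lamS: "lam j < lam (Suc j)" for j
  proof (rule ccontr)
    assume "\<not> lam j < lam (Suc j)"
    then have "\<Phi> (lam (Suc j)) \<le> \<Phi> (lam j)"
      using growth[of "lam (Suc j)" "lam j"] lam(1)[of "Suc j"] by (simp add: not_less)
    then show False using lam(2) by simp
  qed
  have step1: "integral {lam j..lam (Suc j)} f = 1" for j
    using step[of "lam j" "lam (Suc j)"] lam lamS[of j] by simp
  \<comment> \<open>Window \<open>k\<close> lies between \<open>T k / 2\<close> and
    \<open>2 * T k\<close>, and the ratio 4 makes \<open>T (Suc k) / 2\<close> equal to
    \<open>2 * T k\<close>. The start value 16 secures \<open>ln 10 \<le> ln (T k)\<close>.\<close>
  define T where "T k = (16 * 4 ^ k :: real)" for k
  have T16: "16 \<le> T k" for k by (simp add: T_def)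
  have ln10: "ln 10 \<le> ln (T k)" "(0::real) \<le> ln 10" for k using T16[of k] by auto
  have lnT: "ln (T k) < T k" for k using T16[of k] ln_less_self[of "T k"] by simp
  define win where "win k j \<longleftrightarrow> T k / 2 \<le> lam j \<and> lam (Suc j) \<le> T k + ln (T k) - ln 10" for k j
  have disj: "k = k'" if "win k j" "win k' j" for k k' j
  proof -
    have False if "k < k'" "win k j" "win k' j" for k k'
    proof -
      have "T (Suc k) \<le> T k'" using that(1) unfolding T_def by (simp add: power_increasing flip: power_Suc)
      then have "2 * T k \<le> T k' / 2" by (simp add: T_def)
      then have "2 * T k \<le> lam j" using that(3) by (simp add: win_def)
      moreover have "lam j < 2 * T k" using that(2) lamS[of j] lnT[of k] ln10(2) unfolding win_def by linarith
      ultimately show False by simp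
    qed
    then show ?thesis using that by (metis linorder_neqE_nat)
  qed
  have pt: "\<exists>v. lam j < v \<and> v \<le> lam (Suc j) \<and> exp (- \<i> * of_real (exp (T k) * v)) = 1" if "win k j" for k j
  proof (rule exists_lattice_point)
    \<comment> \<open>At the top of the window the density is at most
      \<open>exp V / V \<le> exp (T k) / 10\<close>, so a cell has length at least
      \<open>10 / exp (T k)\<close>; the 10 is there to exceed \<open>2 * pi\<close>.\<close>
    define V where "V = T k + ln (T k) - ln 10"
    have V: "T k \<le> V" "lam (Suc j) \<le> V" using that ln10(1)[of k] unfolding V_def win_def by auto
    have V0: "0 < V" using V(1) T16[of k] by linarith
    have "1 \<le> integral {lam j..lam (Suc j)} (\<lambda>_. wgt V)"
      unfolding step1[of j, symmetric]
    proof (intro integral_le int lam(1))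
      fix v assume "v \<in> {lam j..lam (Suc j)}"
      then have "0 \<le> v" "v \<le> V" using lam(1)[of j] V by auto
      then show "f v \<le> wgt V" using f_le[of v] wgt_mono[of v V] by linarith
    qed auto
    also have "\<dots> = (lam (Suc j) - lam j) * wgt V" using lamS[of j] by simp
    also have "\<dots> \<le> (lam (Suc j) - lam j) * (exp (T k) / 10)"
    proof (intro mult_left_mono)
      have "wgt V \<le> exp V / V" by (rule wgt_le_divide[OF V0])
      also have "exp V = T k * exp (T k) / 10"
        unfolding V_def exp_add exp_diff using T16[of k] by simp
      also have "T k * exp (T k) / 10 / V \<le> T k * exp (T k) / 10 / T k"
        using V T16[of k] by (intro divide_left_mono) (auto intro!: mult_pos_pos)
      also have "\<dots> = exp (T k) / 10" using T16[of k] by simp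
      finally show "wgt V \<le> exp (T k) / 10" .
    qed (use lamS[of j] in simp)
    finally have "10 \<le> (lam (Suc j) - lam j) * exp (T k)" by simp
    moreover have "2 * pi \<le> 10" using pi_less_4 by simp
    ultimately show "2 * pi / exp (T k) \<le> lam (Suc j) - lam j" by (simp add: pos_divide_le_eq)
  qed simp
  have "\<exists>v. lam j < v \<and> v \<le> lam (Suc j) \<and> (\<forall>k. win k j \<longrightarrow> exp (- \<i> * of_real (exp (T k) * v)) = 1)" for j
  proof (cases "\<exists>k. win k j")
    case True
    then obtain k where k: "win k j" by blast
    then show ?thesis using pt[OF k] disj[OF _ k] by metis
  next
    case False
    then show ?thesis using lamS[of j] by blast
  qed
  then obtain l where l: "\<And>j. lam j < l j" "\<And>j. l j \<le> lam (Suc j)"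
    "\<And>j k. win k j \<Longrightarrow> exp (- \<i> * of_real (exp (T k) * l j)) = 1" by metis
  have "filterlim T at_top sequentially" unfolding T_def by real_asymp
  then have "resonant_sample f C0 lam l T"
    using assms lam0 lamS step1 l by unfold_locales (auto simp: win_def)
  then show ?thesis by blast
qed

text \<open>The classical zeta value at \<open>m + 2\<close>: the coefficient of \<open>v^m\<close>
  in the density below contains the sum of \<mu>(\<nu>) / \<nu>^(m+2), which is its
  reciprocal.\<close>

definition zeta_nat :: "nat \<Rightarrow> real" where "zeta_nat m = (\<Sum>n. 1 / real (Suc n) ^ (m + 2))"

lemma sum_inverse_squares_tail:
  assumes "1 \<le> N"
  shows "summable (\<lambda>n. 1 / real (Suc (n + N)) ^ (m + 2))"
    "(\<Sum>n. 1 / real (Suc (n + N)) ^ (m + 2)) \<le> 1 / (real (Suc N) ^ m * real N)"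
proof -
  have tel: "(\<lambda>n. (1 / real (n + N) - 1 / real (Suc n + N)) / real (Suc N) ^ m) sums (1 / real N / real (Suc N) ^ m)"
  proof -
    have "(\<lambda>n. 1 / real (n + N)) \<longlonglongrightarrow> 0" by real_asymp
    from sums_divide[OF telescope_sums'[OF this], of "real (Suc N) ^ m"] show ?thesis by simp
  qed
  have le: "1 / real (Suc (n + N)) ^ (m + 2) \<le> (1 / real (n + N) - 1 / real (Suc n + N)) / real (Suc N) ^ m" for n
  proof -
    define y where "y = real (n + N)"
    have y: "1 \<le> y" using assms by (simp add: y_def)
    have "1 / (y + 1) ^ (m + 2) = 1 / (y + 1)\<^sup>2 / (y + 1) ^ m" by (simp add: power_add power2_eq_square)
    also have "\<dots> \<le> (1 / y - 1 / (y + 1)) / (y + 1) ^ m"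
    proof (rule divide_right_mono)
      have "1 / (y + 1)\<^sup>2 \<le> 1 / (y * (y + 1))"
        using y by (intro divide_left_mono) (auto simp: power2_eq_square)
      also have "\<dots> = 1 / y - 1 / (y + 1)" using y by (simp add: field_simps)
      finally show "1 / (y + 1)\<^sup>2 \<le> 1 / y - 1 / (y + 1)" .
    qed (use y in auto)
    also have "\<dots> \<le> (1 / y - 1 / (y + 1)) / real (Suc N) ^ m"
    proof (rule divide_left_mono)
      show "real (Suc N) ^ m \<le> (y + 1) ^ m" by (intro power_mono) (auto simp: y_def)
      show "0 \<le> 1 / y - 1 / (y + 1)" using y by (simp add: field_simps)
    qed (use y in auto)
    finally show ?thesis by (simp add: y_def add_ac)
  qed
  show s: "summable (\<lambda>n. 1 / real (Suc (n + N)) ^ (m + 2))"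
    by (rule summable_comparison_test'[OF sums_summable[OF tel]]) (use le in auto)
  have "(\<Sum>n. 1 / real (Suc (n + N)) ^ (m + 2)) \<le> 1 / real N / real (Suc N) ^ m"
    using suminf_le[OF le s sums_summable[OF tel]] tel by (simp add: sums_iff)
  then show "(\<Sum>n. 1 / real (Suc (n + N)) ^ (m + 2)) \<le> 1 / (real (Suc N) ^ m * real N)" by (simp add: mult.commute)
qed

lemma zeta_nat_summable: "summable (\<lambda>n. 1 / real (Suc n) ^ (m + 2))"
  using sum_inverse_squares_tail(1)[of 1 m] summable_iff_shift[of "\<lambda>n. 1 / real (Suc n) ^ (m + 2)" 1] by simp

lemma zeta_nat_split:
  assumes "1 \<le> N"
  shows "(\<Sum>n<N. 1 / real (Suc n) ^ (m + 2)) \<le> zeta_nat m"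
    "zeta_nat m \<le> (\<Sum>n<N. 1 / real (Suc n) ^ (m + 2)) + 1 / (real (Suc N) ^ m * real N)"
proof -
  have "zeta_nat m = (\<Sum>n. 1 / real (Suc (n + N)) ^ (m + 2)) + (\<Sum>n<N. 1 / real (Suc n) ^ (m + 2))"
    unfolding zeta_nat_def by (rule suminf_split_initial_segment[OF zeta_nat_summable])
  then show "zeta_nat m \<le> (\<Sum>n<N. 1 / real (Suc n) ^ (m + 2)) + 1 / (real (Suc N) ^ m * real N)"
    using sum_inverse_squares_tail(2)[OF assms, of m] by simp
  show "(\<Sum>n<N. 1 / real (Suc n) ^ (m + 2)) \<le> zeta_nat m"
    unfolding zeta_nat_def by (intro sum_le_suminf zeta_nat_summable) auto
qed

lemma zeta_nat_bounds: "1 \<le> zeta_nat m" "zeta_nat m \<le> 1 + 1 / 2 ^ m" "zeta_nat m \<le> 2"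
proof -
  show "1 \<le> zeta_nat m" "zeta_nat m \<le> 1 + 1 / 2 ^ m" using zeta_nat_split[of 1 m] by simp_all
  moreover have "1 / 2 ^ m \<le> (1 :: real)" by simp
  ultimately show "zeta_nat m \<le> 2" by linarith
qed

lemma zeta_nat_pos: "0 < zeta_nat m"
  using zeta_nat_bounds(1)[of m] by linarith

text \<open>The density, on the logarithmic scale, of the Riemann--Gram_int function
  $\sum_\nu \frac{\mu(\nu)}{\nu} \mathrm{Li}(x^{1/\nu})$.\<close>

definition gram :: "real \<Rightarrow> real" where "gram v = (\<Sum>m. v ^ m / (fact (Suc m) * zeta_nat m))"

lemma summable_wgt: "summable (\<lambda>m. (v::real) ^ m / fact (Suc m))"
proof (rule summable_comparison_test')
  show "summable (\<lambda>m. \<bar>v\<bar> ^ m / fact m)" using summable_exp_generic[of "\<bar>v\<bar>"] by (simp add: divide_inverse mult.commute)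
  show "norm (v ^ m / fact (Suc m)) \<le> \<bar>v\<bar> ^ m / fact m" for m
    by (simp add: power_abs) (intro divide_left_mono, auto)
qed

lemma wgt_sums: "(\<lambda>m. v ^ m / fact (Suc m)) sums wgt v"
proof (cases "v = 0")
  case True
  have "(\<lambda>m. 0 ^ m / fact (Suc m)) sums (0 ^ 0 / fact (Suc 0) :: real)"
    by (rule sums_finite[of "{0}", simplified]) (auto simp: power_0_left)
  then show ?thesis using True by (simp add: wgt_def)
next
  case False
  have "(\<lambda>m. v ^ Suc m /\<^sub>R fact (Suc m)) sums (exp v - v ^ 0 /\<^sub>R fact 0)"
    using exp_converges[of v] by (subst sums_Suc_iff) simp
  then have "(\<lambda>m. v ^ Suc m / fact (Suc m) / v) sums ((exp v - 1) / v)"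
    by (intro sums_divide) (simp add: divide_inverse mult.commute)
  then show ?thesis using False by (simp add: wgt_def)
qed

lemma norm_gram_term: "\<bar>v ^ m / (fact (Suc m) * zeta_nat m)\<bar> \<le> \<bar>v\<bar> ^ m / fact (Suc m)"
proof -
  have "\<bar>v ^ m / (fact (Suc m) * zeta_nat m)\<bar> = \<bar>v\<bar> ^ m / fact (Suc m) / zeta_nat m"
    using zeta_nat_bounds(1)[of m] by (simp add: abs_mult power_abs)
  also have "\<dots> \<le> \<bar>v\<bar> ^ m / fact (Suc m) / 1"
    using zeta_nat_bounds(1)[of m] by (intro divide_left_mono) auto
  finally show ?thesis by simp
qed

lemma gram_summable: "summable (\<lambda>m. v ^ m / (fact (Suc m) * zeta_nat m))"
  by (rule summable_comparison_test'[OF summable_wgt[of "\<bar>v\<bar>"]]) (use norm_gram_term in auto)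

lemma gram_le: "0 \<le> v \<Longrightarrow> gram v \<le> wgt v"
proof -
  assume v: "0 \<le> v"
  have "v ^ m / (fact (Suc m) * zeta_nat m) \<le> v ^ m / fact (Suc m)" for m
    using order_trans[OF abs_ge_self norm_gram_term[of v m]] v by simp
  then show ?thesis
    unfolding gram_def using suminf_le[OF _ gram_summable[of v] summable_wgt[of v]] wgt_sums[of v] by (simp add: sums_iff)
qed

text \<open>The constant term \<open>1 / zeta_nat 0\<close> alone suffices; the bound 1/2 in
  \<open>beurling_sample\<close> accommodates this density.\<close>

lemma gram_ge: "0 \<le> v \<Longrightarrow> 1/2 \<le> gram v"
proof -
  assume v: "0 \<le> v"
  have "(\<Sum>m\<in>{0}. v ^ m / (fact (Suc m) * zeta_nat m)) \<le> gram v"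
    unfolding gram_def
    using v by (intro sum_le_suminf gram_summable) (auto intro!: divide_nonneg_nonneg mult_nonneg_nonneg less_imp_le[OF zeta_nat_pos])
  moreover have "1/2 \<le> 1 / zeta_nat 0" using zeta_nat_bounds[of 0] by (intro divide_left_mono) auto
  ultimately show ?thesis by simp
qed

text \<open>\<open>1 - 1 / zeta_nat m\<close> is at most \<open>1 / 2^m\<close>, so the difference
  is dominated termwise by the exponential series at \<open>v / 2\<close>.\<close>

lemma gram_close: "0 \<le> v \<Longrightarrow> wgt v - gram v \<le> 1 * exp (v / 2)"
proof -
  assume v: "0 \<le> v"
  have s: "(\<lambda>m. v ^ m / fact (Suc m) - v ^ m / (fact (Suc m) * zeta_nat m)) sums (wgt v - gram v)"
    unfolding gram_def by (intro sums_diff wgt_sums summable_sums gram_summable)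
  have e: "(\<lambda>m. (v / 2) ^ m /\<^sub>R fact m) sums exp (v / 2)" by (rule exp_converges)
  have "v ^ m / fact (Suc m) - v ^ m / (fact (Suc m) * zeta_nat m) \<le> (v / 2) ^ m /\<^sub>R fact m" for m
  proof -
    have z: "0 < zeta_nat m" using zeta_nat_bounds(1)[of m] by linarith
    have "1 - 1 / zeta_nat m \<le> 1 / 2 ^ m"
    proof -
      have "1 - 1 / zeta_nat m = (zeta_nat m - 1) / zeta_nat m" using z by (simp add: field_simps)
      also have "\<dots> \<le> (zeta_nat m - 1) / 1" using zeta_nat_bounds(1)[of m] by (intro divide_left_mono) auto
      finally show ?thesis using zeta_nat_bounds(2)[of m] by simp
    qed
    moreover have "v ^ m / fact (Suc m) \<le> v ^ m / fact m"
      using v by (intro divide_left_mono fact_mono) auto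
    moreover have "0 \<le> 1 - 1 / zeta_nat m" using zeta_nat_bounds(1)[of m] by simp
    ultimately have "v ^ m / fact (Suc m) * (1 - 1 / zeta_nat m) \<le> v ^ m / fact m * (1 / 2 ^ m)"
      using v by (intro mult_mono) auto
    also have "v ^ m / fact m * (1 / 2 ^ m) = (v / 2) ^ m /\<^sub>R fact m"
      by (simp add: power_divide field_simps)
    finally show ?thesis by (simp add: right_diff_distrib)
  qed
  then have "wgt v - gram v \<le> exp (v / 2)"
    using sums_le[OF _ s e] by simp
  then show ?thesis by simp
qed

lemma gram_cont: "continuous_on A gram"
proof -
  have "isCont gram v" for v
    unfolding gram_def[abs_def]
    using isCont_powser_converges_everywhere[of "\<lambda>m. 1 / (fact (Suc m) * zeta_nat m)" v] gram_summable by simp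
  then show ?thesis by (simp add: continuous_at_imp_continuous_on)
qed

text \<open>Gram's series for Riemann's function at \<open>exp V\<close>, without its constant term
  1.\<close>

definition Gram_int :: "real \<Rightarrow> real" where "Gram_int V = (\<Sum>m. V ^ Suc m / (real (Suc m) * fact (Suc m) * zeta_nat m))"

lemma Gram_int_summable: "summable (\<lambda>m. V ^ Suc m / (real (Suc m) * fact (Suc m) * zeta_nat m))"
proof (rule summable_comparison_test'[OF summable_mult[OF summable_wgt[of "\<bar>V\<bar>"], of "\<bar>V\<bar>"]])
  fix m
  have z: "1 \<le> zeta_nat m" by (rule zeta_nat_bounds)
  have "norm (V ^ Suc m / (real (Suc m) * fact (Suc m) * zeta_nat m)) = \<bar>V\<bar> * \<bar>V ^ m / (fact (Suc m) * zeta_nat m)\<bar> / real (Suc m)"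
    using z by (simp add: abs_mult field_simps)
  also have "\<dots> \<le> \<bar>V\<bar> * (\<bar>V\<bar> ^ m / fact (Suc m)) / 1"
    by (intro frac_le mult_left_mono norm_gram_term) auto
  finally show "norm (V ^ Suc m / (real (Suc m) * fact (Suc m) * zeta_nat m)) \<le> \<bar>V\<bar> * (\<bar>V\<bar> ^ m / fact (Suc m))" by simp
qed

lemma has_integral_power_series:
  fixes c :: "nat \<Rightarrow> real"
  assumes c: "\<And>v. summable (\<lambda>m. c m * v ^ m)" and d: "\<And>v. summable (\<lambda>m. c m / real (Suc m) * v ^ Suc m)" and V: "0 \<le> V"
  shows "((\<lambda>v. \<Sum>m. c m * v ^ m) has_integral (\<Sum>m. c m / real (Suc m) * V ^ Suc m)) {0..V}"
proof -
  \<comment> \<open>Shifted by one index, so that termwise differentiation of \<open>b\<close>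
    returns \<open>c\<close>.\<close>
  define b where "b n = (case n of 0 \<Rightarrow> 0 | Suc m \<Rightarrow> c m / real (Suc m))" for n
  have b: "summable (\<lambda>n. b n * v ^ n)" for v
    using d[of v] by (subst summable_Suc_iff[symmetric]) (simp add: b_def)
  have eq: "(\<Sum>n. b n * v ^ n) = (\<Sum>m. c m / real (Suc m) * v ^ Suc m)" for v
    using suminf_split_head[OF b[of v]] by (simp add: b_def)
  have diffs: "diffs b m = c m" for m by (simp add: diffs_def b_def)
  have der: "((\<lambda>v. \<Sum>n. b n * v ^ n) has_real_derivative (\<Sum>m. c m * v ^ m)) (at v)" for v
    using termdiffs_strong_converges_everywhere[OF b, of v] unfolding diffs .
  have "((\<lambda>v. \<Sum>m. c m * v ^ m) has_integral (\<Sum>n. b n * V ^ n) - (\<Sum>n. b n * 0 ^ n)) {0..V}"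
    using V der by (intro fundamental_theorem_of_calculus)
      (auto simp: has_real_derivative_iff_has_vector_derivative[symmetric] intro: DERIV_subset)
  moreover have "(\<Sum>n. b n * 0 ^ n) = 0" unfolding eq by simp
  ultimately show ?thesis unfolding eq by simp
qed

lemma integral_gram: "0 \<le> V \<Longrightarrow> integral {0..V} gram = Gram_int V"
  unfolding gram_def[abs_def] Gram_int_def
  using has_integral_power_series[of "\<lambda>m. 1 / (fact (Suc m) * zeta_nat m)" V] gram_summable Gram_int_summable
  by (intro integral_unique) (simp add: mult_ac)

lemma Li_summable: "summable (\<lambda>m. (V::real) ^ Suc m / (real (Suc m) * fact (Suc m)))"
proof (rule summable_comparison_test'[OF summable_mult[OF summable_wgt[of "\<bar>V\<bar>"], of "\<bar>V\<bar>"]])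
  fix m
  have "norm (V ^ Suc m / (real (Suc m) * fact (Suc m))) = \<bar>V\<bar> * (\<bar>V\<bar> ^ m / fact (Suc m)) / real (Suc m)"
    by (simp add: abs_mult power_abs field_simps)
  also have "\<dots> \<le> \<bar>V\<bar> * (\<bar>V\<bar> ^ m / fact (Suc m)) / 1" by (intro divide_left_mono) auto
  finally show "norm (V ^ Suc m / (real (Suc m) * fact (Suc m))) \<le> \<bar>V\<bar> * (\<bar>V\<bar> ^ m / fact (Suc m))" by simp
qed

lemma integral_wgt: "0 \<le> V \<Longrightarrow> integral {0..V} wgt = (\<Sum>m. V ^ Suc m / (real (Suc m) * fact (Suc m)))"
proof -
  assume V: "0 \<le> V"
  have "wgt = (\<lambda>v. \<Sum>m. 1 / fact (Suc m) * v ^ m)" using wgt_sums by (auto simp: sums_iff fun_eq_iff)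
  then show ?thesis
    using has_integral_power_series[of "\<lambda>m. 1 / fact (Suc m)" V] summable_wgt Li_summable V
    by (intro integral_unique) (simp add: mult_ac)
qed

text \<open>Summing $\mathrm{Gram_int}(V/\nu)/\nu$ over $\nu$ multiplies the $m$-th coefficient by the zeta value
  it was divided by, so that $\mathrm{Li}(e^V)$ is recovered up to the tail of that zeta series.\<close>

lemma Gram_int_sum_close:
  assumes V: "0 \<le> V" and N: "1 \<le> N"
  shows "\<bar>(\<Sum>n<N. Gram_int (V / real (Suc n)) / real (Suc n)) - integral {0..V} wgt\<bar> \<le> exp (V / real N)"
proof -
  define q where "q m = (\<Sum>n<N. 1 / real (Suc n) ^ (m + 2))" for m
  define b where "b m = V ^ Suc m / (real (Suc m) * fact (Suc m))" for m
  have b0: "0 \<le> b m" for m using V by (simp add: b_def)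
  have t: "(\<lambda>m. b m / zeta_nat m / real (Suc n) ^ (m + 2)) sums (Gram_int (V / real (Suc n)) / real (Suc n))" for n
  proof -
    have "(\<lambda>m. (V / real (Suc n)) ^ Suc m / (real (Suc m) * fact (Suc m) * zeta_nat m) / real (Suc n)) sums (Gram_int (V / real (Suc n)) / real (Suc n))"
      unfolding Gram_int_def by (intro sums_divide summable_sums Gram_int_summable)
    moreover have "(V / real (Suc n)) ^ Suc m / (real (Suc m) * fact (Suc m) * zeta_nat m) / real (Suc n) = b m / zeta_nat m / real (Suc n) ^ (m + 2)" for m
      unfolding b_def power_divide by (simp add: field_simps del: fact_Suc of_nat_Suc)
    ultimately show ?thesis by simp
  qed
  have "(\<lambda>m. \<Sum>n<N. b m / zeta_nat m / real (Suc n) ^ (m + 2)) sums (\<Sum>n<N. Gram_int (V / real (Suc n)) / real (Suc n))"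
    by (intro sums_sum t)
  moreover have "(\<Sum>n<N. b m / zeta_nat m / real (Suc n) ^ (m + 2)) = b m / zeta_nat m * q m" for m
    unfolding q_def sum_distrib_left by simp
  ultimately have s1: "(\<lambda>m. b m / zeta_nat m * q m) sums (\<Sum>n<N. Gram_int (V / real (Suc n)) / real (Suc n))" by simp
  have s2: "b sums integral {0..V} wgt"
    unfolding b_def integral_wgt[OF V] by (intro summable_sums Li_summable)
  have s3: "(\<lambda>m. b m - b m / zeta_nat m * q m) sums (integral {0..V} wgt - (\<Sum>n<N. Gram_int (V / real (Suc n)) / real (Suc n)))"
    by (rule sums_diff[OF s2 s1])
  have e: "(\<lambda>m. (V / real N) ^ Suc m /\<^sub>R fact (Suc m)) sums (exp (V / real N) - (V / real N) ^ 0 /\<^sub>R fact 0)"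
    using exp_converges[of "V / real N"] by (subst sums_Suc_iff) simp
  have nn: "0 \<le> b m - b m / zeta_nat m * q m" and le: "b m - b m / zeta_nat m * q m \<le> (V / real N) ^ Suc m /\<^sub>R fact (Suc m)" for m
  proof -
    have z: "1 \<le> zeta_nat m" by (rule zeta_nat_bounds)
    have eq: "b m - b m / zeta_nat m * q m = b m * ((zeta_nat m - q m) / zeta_nat m)" using z by (simp add: field_simps)
    have q: "q m \<le> zeta_nat m" unfolding q_def by (rule zeta_nat_split(1)[OF N])
    show "0 \<le> b m - b m / zeta_nat m * q m" unfolding eq using b0[of m] q z by simp
    have "(zeta_nat m - q m) / zeta_nat m \<le> (zeta_nat m - q m) / 1" using q z by (intro divide_left_mono) auto
    also have "\<dots> \<le> 1 / (real (Suc N) ^ m * real N)" using zeta_nat_split(2)[OF N, of m] by (simp add: q_def)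
    \<comment> \<open>Giving up \<open>Suc N\<close> for \<open>N\<close> makes the tail a pure
      power, and the terms add up to the exponential series at \<open>V / N\<close>.\<close>
    also have "\<dots> \<le> 1 / (real N ^ m * real N)"
      using N by (intro divide_left_mono mult_right_mono power_mono) auto
    also have "\<dots> = 1 / real N ^ Suc m" by (simp add: mult.commute)
    finally have "b m * ((zeta_nat m - q m) / zeta_nat m) \<le> b m * (1 / real N ^ Suc m)" by (intro mult_left_mono b0)
    also have "\<dots> = V ^ Suc m / real N ^ Suc m / fact (Suc m) / real (Suc m)"
      by (simp add: b_def)
    also have "\<dots> \<le> V ^ Suc m / real N ^ Suc m / fact (Suc m) / 1"
      using V by (intro divide_left_mono) auto
    also have "\<dots> = (V / real N) ^ Suc m /\<^sub>R fact (Suc m)"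
      unfolding power_divide by (simp add: divide_inverse mult_ac)
    finally show "b m - b m / zeta_nat m * q m \<le> (V / real N) ^ Suc m /\<^sub>R fact (Suc m)" unfolding eq .
  qed
  have "0 \<le> integral {0..V} wgt - (\<Sum>n<N. Gram_int (V / real (Suc n)) / real (Suc n))"
    using sums_le[OF nn sums_zero s3] .
  moreover have "integral {0..V} wgt - (\<Sum>n<N. Gram_int (V / real (Suc n)) / real (Suc n)) \<le> exp (V / real N) - 1"
    using sums_le[OF le s3 e] by simp
  ultimately show ?thesis by linarith
qed

lemma harm_le_ln: assumes "1 \<le> n" shows "harm n \<le> ln (real n) + (1 :: real)"
  using decseqD[OF decseq_harm_diff_ln, of 0 "n - 1"] assms by (simp add: harm_expand)

lemma ln_ln_plus_const_bigo: "(\<lambda>x. ln (ln x) + K) \<in> O(\<lambda>x :: real. ln (ln x) :: real)"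
  by real_asymp

section \<open>The weighted prime power count for the Gram density\<close>

context beurling_sample begin

text \<open>Once \<nu> exceeds \<open>ln x / l 0\<close>, the \<nu>-th root of \<open>x\<close> is
  below the least prime.\<close>

lemma bPi_p:
  assumes "1 \<le> x"
  shows "bPi p x = (\<Sum>n<nat \<lfloor>ln x / l 0\<rfloor>. real (J (ln x / real (Suc n))) / real (Suc n))"
proof -
  have J: "bpi p (x powr (1 / real (Suc n))) = J (ln x / real (Suc n))" for n
    using assms by (subst bpi_p) (auto simp: ln_powr)
  have "J (ln x / real (Suc n)) = 0" if "nat \<lfloor>ln x / l 0\<rfloor> \<le> n" for n
  proof -
    have "ln x / l 0 < real (Suc n)" using that by linarith
    then have "ln x / real (Suc n) < l 0" using l_pos[of 0] by (simp add: field_simps)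
    then show ?thesis using l_le_iff[of 0 "ln x / real (Suc n)"] by simp
  qed
  then show ?thesis
    unfolding bPi_def J by (intro suminf_finite) auto
qed

text \<open>Each \<nu> up to \<open>N\<close>, about \<open>ln x / l 0\<close>, costs at most
  \<open>1 / \<nu>\<close> by \<open>J_close\<close>; the harmonic sum is the source of log log x.
  The truncated zeta tails cost \<open>exp (L / N)\<close>, bounded because
  \<open>L / l 0 < N + 1 \<le> 2 * N\<close>.\<close>

lemma bPi_close:
  assumes "f = gram" and x: "1 \<le> ln x / l 0" and True: "1 \<le> x"
  shows "\<bar>bPi p x - Li x\<bar> \<le> ln (ln x / l 0) + 1 + exp (2 * l 0)"
proof -
  define L where "L = ln x"
  define N where "N = nat \<lfloor>L / l 0\<rfloor>"
  have l0: "0 < l 0" by simp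
  have L: "l 0 \<le> L" using x l0 by (simp add: L_def pos_le_divide_eq)
  have N: "1 \<le> N" "real N \<le> L / l 0" "L / l 0 < real N + 1"
    using x unfolding N_def L_def by linarith+
  have LN: "L / real N \<le> 2 * l 0"
  proof -
    have "L / l 0 \<le> 2 * real N" using N by linarith
    then show ?thesis using N l0 by (simp add: field_simps)
  qed
  have "\<bar>bPi p x - (\<Sum>n<N. Gram_int (L / real (Suc n)) / real (Suc n))\<bar> =
      \<bar>\<Sum>n<N. (real (J (L / real (Suc n))) - Gram_int (L / real (Suc n))) / real (Suc n)\<bar>"
    unfolding bPi_p[OF True] L_def[symmetric] N_def[symmetric] by (simp add: sum_subtractf diff_divide_distrib)
  also have "\<dots> \<le> (\<Sum>n<N. \<bar>(real (J (L / real (Suc n))) - Gram_int (L / real (Suc n))) / real (Suc n)\<bar>)"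
    by (rule sum_abs)
  also have "\<dots> \<le> (\<Sum>n<N. 1 / real (Suc n))"
  proof (rule sum_mono)
    fix n
    have "0 \<le> L / real (Suc n)" using L less_imp_le[OF l0] by (intro divide_nonneg_nonneg) linarith+
    then have "\<bar>real (J (L / real (Suc n))) - Gram_int (L / real (Suc n))\<bar> \<le> 1"
      using J_close[of "L / real (Suc n)"] integral_gram[of "L / real (Suc n)"] assms(1) by simp
    then show "\<bar>(real (J (L / real (Suc n))) - Gram_int (L / real (Suc n))) / real (Suc n)\<bar> \<le> 1 / real (Suc n)"
      unfolding abs_divide abs_of_nat by (rule divide_right_mono) simp
  qed
  also have "\<dots> = harm N"
    unfolding harm_def by (rule sum.reindex_bij_witness[of _ "\<lambda>n. n - 1" Suc]) (auto simp: inverse_eq_divide)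
  also have "\<dots> \<le> ln (real N) + 1" using N(1) by (rule harm_le_ln)
  also have "ln (real N) \<le> ln (L / l 0)" using N by (intro ln_mono) auto
  finally have 1: "\<bar>bPi p x - (\<Sum>n<N. Gram_int (L / real (Suc n)) / real (Suc n))\<bar> \<le> ln (L / l 0) + 1" by simp
  have "\<bar>(\<Sum>n<N. Gram_int (L / real (Suc n)) / real (Suc n)) - integral {0..L} wgt\<bar> \<le> exp (L / real N)"
    using order_trans[OF less_imp_le[OF l0] L] N(1) by (intro Gram_int_sum_close)
  also have "\<dots> \<le> exp (2 * l 0)" using LN by simp
  also have "integral {0..L} wgt = Li x"
    using Li_exp[of L] True L l0 by (simp add: L_def)
  finally show ?thesis using 1 unfolding L_def by linarith
qed

end

theorem theorem4p1:
  shows "\<exists>p1 p2 :: nat \<Rightarrow> real.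
    beurling_primes p1 \<and> beurling_primes p2 \<and>
    (\<lambda>x. bpi p1 x - Li x) \<in> O(\<lambda>x. 1) \<and>
    (\<lambda>x. bPi p2 x - Li x) \<in> O(\<lambda>x. ln (ln x)) \<and>
    (\<forall>p \<in> {p1, p2}. \<exists>\<rho> > 0. (bN p \<sim>[at_top] (\<lambda>x. \<rho> * x)) \<and>
       (\<forall>c > 2 * sqrt 2. Omega_pm (\<lambda>x. bN p x - \<rho> * x)
          (\<lambda>x. x * exp (- c * sqrt (ln x * ln (ln x))))))"
proof -
  obtain lam1 l1 T1 where 1: "resonant_sample wgt 0 lam1 l1 T1"
    using exists_resonant_sample[of wgt 0] wgt_ge_1 by (force intro!: continuous_intros)
  obtain lam2 l2 T2 where 2: "resonant_sample gram 1 lam2 l2 T2"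
    using exists_resonant_sample[of gram 1] gram_cont gram_ge gram_le gram_close by blast
  interpret P1: resonant_sample wgt 0 lam1 l1 T1 by (rule 1)
  interpret P2: resonant_sample gram 1 lam2 l2 T2 by (rule 2)
  have "(\<lambda>x. bpi P1.p x - Li x) \<in> O(\<lambda>x. 1)"
  proof (rule bigoI[of _ 1])
    show "\<forall>\<^sub>F x in at_top. norm (bpi P1.p x - Li x) \<le> 1 * norm (1 :: real)"
      using eventually_ge_at_top[of 1]
    proof eventually_elim
      case (elim x)
      then show ?case using P1.bpi_close[of x] Li_exp[of "ln x"] by simp
    qed
  qed
  moreover have "(\<lambda>x. bPi P2.p x - Li x) \<in> O(\<lambda>x. ln (ln x))"
  proof (rule landau_o.big_trans[OF bigoI[of _ 1]])
    have "\<forall>\<^sub>F x in at_top. l2 0 < ln x"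
      using ln_at_top by (simp add: filterlim_at_top_dense)
    then show "\<forall>\<^sub>F x in at_top. norm (bPi P2.p x - Li x) \<le> 1 * norm (ln (ln x) + (1 - ln (l2 0) + exp (2 * l2 0)))"
      using eventually_ge_at_top[of 1]
    proof eventually_elim
      case (elim x)
      then have "\<bar>bPi P2.p x - Li x\<bar> \<le> ln (ln x / l2 0) + 1 + exp (2 * l2 0)"
        by (intro P2.bPi_close) (auto simp: pos_le_divide_eq)
      also have "ln (ln x / l2 0) = ln (ln x) - ln (l2 0)"
        using elim P2.l_pos[of 0] by (intro ln_divide_pos) linarith+
      finally show ?case by simp
    qed
    show "(\<lambda>x. ln (ln x) + (1 - ln (l2 0) + exp (2 * l2 0))) \<in> O(\<lambda>x. ln (ln x))"
      by (rule ln_ln_plus_const_bigo)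
  qed
  ultimately show ?thesis
    using P1.beurling_primes_p P2.beurling_primes_p P1.rho_pos P2.rho_pos
      P1.bN_density P2.bN_density P1.Omega_pm_bN P2.Omega_pm_bN
    by (intro exI[of _ P1.p] exI[of _ P2.p]) auto
qed

end
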